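(* Let $\mathcal{M}$ be a von Neumann algebra. Then $\tau_o(\mathcal{M}_{sa},\preceq)=\tau_o(\mathcal{M}_{sa},\leq)$ if and only if $\mathcal{M}$ is abelian.
   Context: A von Neumann algebra $\mathcal{M}$ is a strongly operator closed C*-subalgebra of $\mathcal{B}(\mathcal{H})$, $\mathcal{H}$ a complex Hilbert space; $\mathcal{M}_{sa}$ is its self-adjoint part. $\leq$ is the standard order on $\mathcal{M}_{sa}$ given by the positive cone. For $x\in\mathcal{M}_{sa}$, $(E^x_\lambda)_{\lambda\in\mathbb{R}}$ is its (right-continuous) spectral family: $E^x_\lambda$ is the spectral projection of $x$ for $(-\infty,\lambda]$. The spectral order $\preceq$ on $\mathcal{M}_{sa}$ is defined by: $x\preceq y$ iff $E^y_\lambda\le E^x_\lambda$ for every $\lambda\in\mathbb{R}$. A net $(x_\alpha)_{\alpha\in\Lambda}$ in a poset $(P,\leq)$ is order convergent to $x\in P$ if there are an increasing net $(y_\alpha)_{\alpha\in\Lambda}$ and a decreasing net $(z_\alpha)_{\alpha\in\Lambda}$ in $P$ (with the same index set) such that $y_\alpha\le x_\alpha\le z_\alpha$ for all $\alpha$ and $\sup_\alpha y_\alpha=\inf_\alpha z_\alpha=x$. A set $M\subseteq P$ is order closed if no net in $M$ is order convergent to a point in $P\setminus M$. The complements of the order closed sets form the order topology $\tau_o(P,\leq)$. *)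

theory Defs
  imports "HOL-Analysis.Analysis"
begin

section \<open>Complex Hilbert spaces\<close>

text \<open>
  The inner product is linear in the first and conjugate-linear in the second argument.
  The last axiom says that the norm is the one induced by the inner product; positive
  definiteness follows from the norm axioms. Completeness comes from \<^class>\<open>banach\<close>.
\<close>

class complex_hilbert_space = banach +
  fixes scaleC :: "complex \<Rightarrow> 'a \<Rightarrow> 'a" (infixr "*\<^sub>c" 75)
    and cinner :: "'a \<Rightarrow> 'a \<Rightarrow> complex"
  assumes scaleC_add_right: "c *\<^sub>c (x + y) = c *\<^sub>c x + c *\<^sub>c y"
    and scaleC_add_left: "(c + d) *\<^sub>c x = c *\<^sub>c x + d *\<^sub>c x"
    and scaleC_scaleC: "c *\<^sub>c (d *\<^sub>c x) = (c * d) *\<^sub>c x"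
    and scaleC_of_real: "complex_of_real r *\<^sub>c x = r *\<^sub>R x"
    and cinner_commute: "cinner x y = cnj (cinner y x)"
    and cinner_add_left: "cinner (x + y) z = cinner x z + cinner y z"
    and cinner_scaleC_left: "cinner (c *\<^sub>c x) y = c * cinner x y"
    and cinner_self: "cinner x x = complex_of_real ((norm x)\<^sup>2)"

lemma cinner_scaleC_right:
  fixes x y :: "'h::complex_hilbert_space"
  shows "cinner x (c *\<^sub>c y) = cnj c * cinner x y"
  by (metis cinner_commute cinner_scaleC_left complex_cnj_mult)

lemma norm_scaleC:
  fixes x :: "'h::complex_hilbert_space"
  shows "norm (c *\<^sub>c x) = cmod c * norm x"
proof -
  have "complex_of_real ((norm (c *\<^sub>c x))\<^sup>2) = c * cnj c * complex_of_real ((norm x)\<^sup>2)"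
    by (metis cinner_self cinner_scaleC_left cinner_scaleC_right mult.assoc)
  also have "\<dots> = complex_of_real ((cmod c * norm x)\<^sup>2)"
    by (simp add: complex_norm_square[symmetric] power_mult_distrib)
  finally have "(norm (c *\<^sub>c x))\<^sup>2 = (cmod c * norm x)\<^sup>2"
    using of_real_eq_iff by blast
  then show ?thesis
    by (simp add: power2_eq_iff_nonneg)
qed

lemma bounded_linear_scaleC:
  "bounded_linear (\<lambda>x :: 'h::complex_hilbert_space. c *\<^sub>c x)"
proof (rule bounded_linear_intro[where K = "cmod c"])
  fix r and x :: 'h
  show "c *\<^sub>c (r *\<^sub>R x) = r *\<^sub>R (c *\<^sub>c x)"
    by (metis mult.commute scaleC_of_real scaleC_scaleC)
qed (auto simp: scaleC_add_right norm_scaleC mult.commute)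


section \<open>Bounded operators\<close>

text \<open>
  The type \<open>'h \<Rightarrow>\<^sub>L 'h\<close> consists of the real-linear bounded operators; \<open>B(H)\<close> is
  the subset of complex-linear ones.
\<close>

definition bounded_ops :: "('h::complex_hilbert_space \<Rightarrow>\<^sub>L 'h) set" where
  "bounded_ops = {T :: 'h \<Rightarrow>\<^sub>L 'h. \<forall>c x. T (c *\<^sub>c x) = c *\<^sub>c T x}"

lift_definition scaleC_op ::
  "complex \<Rightarrow> ('h::complex_hilbert_space \<Rightarrow>\<^sub>L 'h) \<Rightarrow> ('h \<Rightarrow>\<^sub>L 'h)" is "\<lambda>c T x. c *\<^sub>c T x"
  by (rule bounded_linear_compose[OF bounded_linear_scaleC])

definition adj_op :: "('h::complex_hilbert_space \<Rightarrow>\<^sub>L 'h) \<Rightarrow> ('h \<Rightarrow>\<^sub>L 'h)" where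
  "adj_op T = (THE S. S \<in> bounded_ops \<and> (\<forall>x y. cinner (T x) y = cinner x (S y)))"

definition positive_op :: "('h::complex_hilbert_space \<Rightarrow>\<^sub>L 'h) \<Rightarrow> bool" where
  "positive_op T \<longleftrightarrow> T \<in> bounded_ops \<and> (\<forall>x. cinner (T x) x \<in> \<real> \<and> 0 \<le> Re (cinner (T x) x))"

definition op_le :: "('h::complex_hilbert_space \<Rightarrow>\<^sub>L 'h) \<Rightarrow> ('h \<Rightarrow>\<^sub>L 'h) \<Rightarrow> bool" where
  "op_le S T \<longleftrightarrow> positive_op (T - S)"

definition projection_op :: "('h::complex_hilbert_space \<Rightarrow>\<^sub>L 'h) \<Rightarrow> bool" where
  "projection_op p \<longleftrightarrow> p \<in> bounded_ops \<and> p o\<^sub>L p = p \<and> adj_op p = p"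


section \<open>Von Neumann algebras\<close>

text \<open>The identity of \<open>B(H)\<close> is not required to belong to the algebra.\<close>

definition cstar_subalgebra :: "('h::complex_hilbert_space \<Rightarrow>\<^sub>L 'h) set \<Rightarrow> bool" where
  "cstar_subalgebra M \<longleftrightarrow>
     M \<subseteq> bounded_ops \<and> 0 \<in> M \<and>
     (\<forall>S\<in>M. \<forall>T\<in>M. S + T \<in> M) \<and>
     (\<forall>c. \<forall>T\<in>M. scaleC_op c T \<in> M) \<and>
     (\<forall>S\<in>M. \<forall>T\<in>M. S o\<^sub>L T \<in> M) \<and>
     (\<forall>T\<in>M. adj_op T \<in> M) \<and>
     closed M"

definition von_neumann_algebra :: "('h::complex_hilbert_space \<Rightarrow>\<^sub>L 'h) set \<Rightarrow> bool" where
  "von_neumann_algebra M \<longleftrightarrow> cstar_subalgebra M \<and> closedin strong_operator_topology M"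

definition abelian :: "('h::complex_hilbert_space \<Rightarrow>\<^sub>L 'h) set \<Rightarrow> bool" where
  "abelian M \<longleftrightarrow> (\<forall>S\<in>M. \<forall>T\<in>M. S o\<^sub>L T = T o\<^sub>L S)"

definition self_adjoint_part ::
  "('h::complex_hilbert_space \<Rightarrow>\<^sub>L 'h) set \<Rightarrow> ('h \<Rightarrow>\<^sub>L 'h) set" where
  "self_adjoint_part M = {T \<in> M. adj_op T = T}"


section \<open>Spectral families and the spectral order\<close>

text \<open>
  A bounded right-continuous resolution of the identity \<open>E\<close> with \<open>x = \<integral> t dE(t)\<close>.
  For each vector \<open>\<xi>\<close>, the measure with distribution function \<open>t \<mapsto> \<langle>E(t) \<xi>, \<xi>\<rangle>\<close>
  is the spectral measure of \<open>x\<close> at \<open>\<xi>\<close>, so \<open>E(t)\<close> is the spectral projection of \<open>x\<close>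
  for the interval from minus infinity to \<open>t\<close>, including \<open>t\<close>.
\<close>

definition spectral_resolution ::
  "(real \<Rightarrow> ('h::complex_hilbert_space \<Rightarrow>\<^sub>L 'h)) \<Rightarrow> ('h \<Rightarrow>\<^sub>L 'h) \<Rightarrow> bool" where
  "spectral_resolution E x \<longleftrightarrow>
     (\<forall>t. projection_op (E t)) \<and>
     (\<forall>s t. s \<le> t \<longrightarrow> op_le (E s) (E t)) \<and>
     (\<forall>\<xi> s. ((\<lambda>t. E t \<xi>) \<longlongrightarrow> E s \<xi>) (at_right s)) \<and>
     (\<exists>a b. (\<forall>t<a. E t = 0) \<and> (\<forall>t\<ge>b. E t = id_blinfun)) \<and>
     (\<forall>\<xi>. cinner (x \<xi>) \<xi> =
        complex_of_real (\<integral>t. t \<partial>interval_measure (\<lambda>t. Re (cinner (E t \<xi>) \<xi>))))"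

definition spectral_family ::
  "('h::complex_hilbert_space \<Rightarrow>\<^sub>L 'h) \<Rightarrow> real \<Rightarrow> ('h \<Rightarrow>\<^sub>L 'h)" where
  "spectral_family x = (THE E. spectral_resolution E x)"

definition spectral_le :: "('h::complex_hilbert_space \<Rightarrow>\<^sub>L 'h) \<Rightarrow> ('h \<Rightarrow>\<^sub>L 'h) \<Rightarrow> bool" where
  "spectral_le x y \<longleftrightarrow> (\<forall>t. op_le (spectral_family y t) (spectral_family x t))"


section \<open>Order convergence and the order topology\<close>

definition is_sup :: "'a set \<Rightarrow> ('a \<Rightarrow> 'a \<Rightarrow> bool) \<Rightarrow> 'a set \<Rightarrow> 'a \<Rightarrow> bool" where
  "is_sup P le A s \<longleftrightarrow>
     s \<in> P \<and> (\<forall>a\<in>A. le a s) \<and> (\<forall>u\<in>P. (\<forall>a\<in>A. le a u) \<longrightarrow> le s u)"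

definition is_inf :: "'a set \<Rightarrow> ('a \<Rightarrow> 'a \<Rightarrow> bool) \<Rightarrow> 'a set \<Rightarrow> 'a \<Rightarrow> bool" where
  "is_inf P le A s \<longleftrightarrow>
     s \<in> P \<and> (\<forall>a\<in>A. le s a) \<and> (\<forall>u\<in>P. (\<forall>a\<in>A. le u a) \<longrightarrow> le u s)"

definition directed_set :: "'i set \<Rightarrow> ('i \<Rightarrow> 'i \<Rightarrow> bool) \<Rightarrow> bool" where
  "directed_set I r \<longleftrightarrow>
     I \<noteq> {} \<and> reflp_on I r \<and> transp_on I r \<and> (\<forall>i\<in>I. \<forall>j\<in>I. \<exists>k\<in>I. r i k \<and> r j k)"

definition order_convergent ::
  "'a set \<Rightarrow> ('a \<Rightarrow> 'a \<Rightarrow> bool) \<Rightarrow> 'i set \<Rightarrow> ('i \<Rightarrow> 'i \<Rightarrow> bool) \<Rightarrow> ('i \<Rightarrow> 'a) \<Rightarrow> 'a \<Rightarrow> bool" where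
  "order_convergent P le I r x l \<longleftrightarrow>
     (\<exists>y z. y ` I \<subseteq> P \<and> z ` I \<subseteq> P \<and>
        monotone_on I r le y \<and> monotone_on I r (\<lambda>a b. le b a) z \<and>
        (\<forall>i\<in>I. le (y i) (x i) \<and> le (x i) (z i)) \<and>
        is_sup P le (y ` I) l \<and> is_inf P le (z ` I) l)"

text \<open>
  A definition cannot quantify over all index types. Index sets inside \<open>'a \<times> 'a \<times> 'a\<close> suffice:
  an order convergent net with any index type can be reindexed by the triples of the values of
  the lower bounding net, the net itself and the upper bounding net.
  This is lemma \<open>order_closed_net\<close> below.
\<close>

definition order_closed :: "'a set \<Rightarrow> ('a \<Rightarrow> 'a \<Rightarrow> bool) \<Rightarrow> 'a set \<Rightarrow> bool" where
  "order_closed P le C \<longleftrightarrow>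
     C \<subseteq> P \<and>
     \<not> (\<exists>(I :: ('a \<times> 'a \<times> 'a) set) r x l.
          directed_set I r \<and> x ` I \<subseteq> C \<and> l \<in> P - C \<and> order_convergent P le I r x l)"

definition order_top :: "'a set \<Rightarrow> ('a \<Rightarrow> 'a \<Rightarrow> bool) \<Rightarrow> 'a topology" where
  "order_top P le = topology (\<lambda>U. U \<subseteq> P \<and> order_closed P le (P - U))"

lemma order_closed_net:
  fixes I :: "'i set" and x :: "'i \<Rightarrow> 'a"
  assumes po: "reflp_on P le" "transp_on P le"
    and C: "order_closed P le C"
    and dir: "directed_set I r"
    and xC: "x ` I \<subseteq> C" and l: "l \<in> P"
    and conv: "order_convergent P le I r x l"
  shows "l \<in> C"
proof (rule ccontr)
  assume nl: "l \<notin> C"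
  obtain y z where yz: "y ` I \<subseteq> P" "z ` I \<subseteq> P"
      "monotone_on I r le y" "monotone_on I r (\<lambda>a b. le b a) z"
      "\<forall>i\<in>I. le (y i) (x i) \<and> le (x i) (z i)"
      "is_sup P le (y ` I) l" "is_inf P le (z ` I) l"
    using conv unfolding order_convergent_def by blast
  define g where "g = (\<lambda>i. (y i, x i, z i))"
  define r' where "r' = (\<lambda>(a :: 'a \<times> 'a \<times> 'a) (b :: 'a \<times> 'a \<times> 'a). le (fst a) (fst b) \<and> le (snd (snd b)) (snd (snd a)))"
  have d: "directed_set (g ` I) r'"
    unfolding directed_set_def
  proof (intro conjI)
    show "g ` I \<noteq> {}" using dir by (auto simp: directed_set_def)
    show "reflp_on (g ` I) r'"
      using po(1) yz(1,2) by (auto simp: reflp_on_def g_def r'_def)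
    show "transp_on (g ` I) r'"
      using po(2) yz(1,2) unfolding transp_on_def g_def r'_def
      by (simp add: image_subset_iff) blast
    show "\<forall>i\<in>g ` I. \<forall>j\<in>g ` I. \<exists>k\<in>g ` I. r' i k \<and> r' j k"
    proof (intro ballI)
      fix a b assume "a \<in> g ` I" "b \<in> g ` I"
      then obtain i j where ij: "i \<in> I" "j \<in> I" "a = g i" "b = g j" by auto
      then obtain k where k: "k \<in> I" "r i k" "r j k"
        using dir unfolding directed_set_def by blast
      then have "r' (g i) (g k) \<and> r' (g j) (g k)"
        using ij yz(3,4) by (simp add: monotone_on_def g_def r'_def)
      then show "\<exists>k\<in>g ` I. r' a k \<and> r' b k" using ij k by blast
    qed
  qed
  have "order_convergent P le (g ` I) r' (\<lambda>a. fst (snd a)) l"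
    unfolding order_convergent_def
  proof (intro exI conjI)
    show "fst ` (g ` I) \<subseteq> P" "(\<lambda>a. snd (snd a)) ` (g ` I) \<subseteq> P"
      using yz(1,2) by (auto simp: g_def)
    show "monotone_on (g ` I) r' le fst" "monotone_on (g ` I) r' (\<lambda>a b. le b a) (\<lambda>a. snd (snd a))"
      by (auto simp: monotone_on_def r'_def)
    show "\<forall>i\<in>g ` I. le (fst i) (fst (snd i)) \<and> le (fst (snd i)) (snd (snd i))"
      using yz(5) by (auto simp: g_def)
    show "is_sup P le (fst ` g ` I) l" "is_inf P le ((\<lambda>a. snd (snd a)) ` g ` I) l"
      using yz(6,7) by (simp_all add: g_def image_image)
  qed
  moreover have "(\<lambda>a. fst (snd a)) ` (g ` I) \<subseteq> C" using xC by (auto simp: g_def)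
  ultimately show False
    using C d l nl unfolding order_closed_def by blast
qed

lemma order_convergent_cofinal:
  assumes tr: "transp_on P le" and dir: "directed_set I r" and JI: "J \<subseteq> I"
    and cof: "\<forall>i\<in>I. \<exists>j\<in>J. r i j"
    and conv: "order_convergent P le I r x l"
  shows "directed_set J r" "order_convergent P le J r x l"
proof -
  show "directed_set J r"
    unfolding directed_set_def
  proof (intro conjI ballI)
    show "J \<noteq> {}" using cof dir by (auto simp: directed_set_def)
    show "reflp_on J r" "transp_on J r"
      using dir JI unfolding directed_set_def by (meson reflp_on_subset transp_on_subset)+
    fix i j assume ij: "i \<in> J" "j \<in> J"
    then obtain k where k: "k \<in> I" "r i k" "r j k"
      using dir JI unfolding directed_set_def by blast
    then obtain m where m: "m \<in> J" "r k m" using cof by blast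
    have "transp_on I r" using dir by (simp add: directed_set_def)
    then have "r i m" "r j m" using ij k m JI unfolding transp_on_def by blast+
    then show "\<exists>k\<in>J. r i k \<and> r j k" using m by blast
  qed
  obtain y z where yz: "y ` I \<subseteq> P" "z ` I \<subseteq> P"
      "monotone_on I r le y" "monotone_on I r (\<lambda>a b. le b a) z"
      "\<forall>i\<in>I. le (y i) (x i) \<and> le (x i) (z i)"
      "is_sup P le (y ` I) l" "is_inf P le (z ` I) l"
    using conv unfolding order_convergent_def by blast
  have ub: "\<forall>i\<in>I. le (y i) u" if "u \<in> P" "\<forall>j\<in>J. le (y j) u" for u
  proof
    fix i assume i: "i \<in> I"
    then obtain j where j: "j \<in> J" "r i j" using cof by blast
    then have "le (y i) (y j)" using yz(3) i JI by (auto simp: monotone_on_def)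
    then show "le (y i) u"
      using that j i JI yz(1) tr unfolding transp_on_def by blast
  qed
  have lb: "\<forall>i\<in>I. le u (z i)" if "u \<in> P" "\<forall>j\<in>J. le u (z j)" for u
  proof
    fix i assume i: "i \<in> I"
    then obtain j where j: "j \<in> J" "r i j" using cof by blast
    then have "le (z j) (z i)" using yz(4) i JI by (auto simp: monotone_on_def)
    then show "le u (z i)"
      using that j i JI yz(2) tr unfolding transp_on_def by blast
  qed
  show "order_convergent P le J r x l"
    unfolding order_convergent_def
  proof (intro exI conjI)
    show "y ` J \<subseteq> P" "z ` J \<subseteq> P" using yz JI by blast+
    show "monotone_on J r le y" "monotone_on J r (\<lambda>a b. le b a) z"
      using yz JI by (meson monotone_on_subset)+
    show "\<forall>i\<in>J. le (y i) (x i) \<and> le (x i) (z i)" using yz JI by blast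
    show "is_sup P le (y ` J) l"
      using yz(6) ub JI unfolding is_sup_def by (auto simp: subset_iff)
    show "is_inf P le (z ` J) l"
      using yz(7) lb JI unfolding is_inf_def by (auto simp: subset_iff)
  qed
qed

lemma order_closed_Un:
  assumes tr: "transp_on P le" and A: "order_closed P le A" and B: "order_closed P le B"
  shows "order_closed P le (A \<union> B)"
  unfolding order_closed_def
proof (intro conjI notI)
  show "A \<union> B \<subseteq> P" using A B by (auto simp: order_closed_def)
  assume "\<exists>(I :: ('a \<times> 'a \<times> 'a) set) r x l. directed_set I r \<and> x ` I \<subseteq> A \<union> B \<and>
            l \<in> P - (A \<union> B) \<and> order_convergent P le I r x l"
  then obtain I :: "('a \<times> 'a \<times> 'a) set" and r x l where
    *: "directed_set I r" "x ` I \<subseteq> A \<union> B" "l \<in> P - (A \<union> B)" "order_convergent P le I r x l"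
    by blast
  define J where "J = (\<lambda>D. {i \<in> I. x i \<in> D})"
  have "(\<forall>i\<in>I. \<exists>j\<in>J A. r i j) \<or> (\<forall>i\<in>I. \<exists>j\<in>J B. r i j)"
  proof (rule ccontr)
    assume "\<not> ?thesis"
    then obtain i j where ij: "i \<in> I" "\<forall>k\<in>J A. \<not> r i k" "j \<in> I" "\<forall>k\<in>J B. \<not> r j k" by blast
    then obtain k where k: "k \<in> I" "r i k" "r j k"
      using *(1) unfolding directed_set_def by blast
    then have "k \<notin> J A" "k \<notin> J B" using ij by blast+
    moreover have "x k \<in> A \<union> B" using *(2) k(1) by blast
    ultimately show False using k(1) by (simp add: J_def)
  qed
  then obtain D where D: "D = A \<or> D = B" "\<forall>i\<in>I. \<exists>j\<in>J D. r i j" by blast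
  have "J D \<subseteq> I" by (auto simp: J_def)
  from order_convergent_cofinal[OF tr *(1) this D(2) *(4)]
  have "directed_set (J D) r" "order_convergent P le (J D) r x l" .
  moreover have "x ` J D \<subseteq> D" by (auto simp: J_def)
  moreover have "order_closed P le D" "l \<in> P - D" using D(1) A B *(3) by auto
  ultimately show False unfolding order_closed_def by blast
qed

lemma openin_order_top:
  assumes tr: "transp_on P le"
  shows "openin (order_top P le) U \<longleftrightarrow> U \<subseteq> P \<and> order_closed P le (P - U)"
proof -
  have "istopology (\<lambda>U. U \<subseteq> P \<and> order_closed P le (P - U))"
    unfolding istopology_def
  proof (intro conjI allI impI)
    fix S T assume "S \<subseteq> P \<and> order_closed P le (P - S)" "T \<subseteq> P \<and> order_closed P le (P - T)"
    then show "S \<inter> T \<subseteq> P" "order_closed P le (P - S \<inter> T)"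
      using order_closed_Un[OF tr, of "P - S" "P - T"] by (auto simp: Diff_Int)
  next
    fix K assume K: "\<forall>U\<in>K. U \<subseteq> P \<and> order_closed P le (P - U)"
    then show "\<Union>K \<subseteq> P" by blast
    show "order_closed P le (P - \<Union>K)"
      unfolding order_closed_def
    proof (intro conjI notI)
      show "P - \<Union>K \<subseteq> P" by blast
      assume "\<exists>(I :: ('a \<times> 'a \<times> 'a) set) r x l. directed_set I r \<and> x ` I \<subseteq> P - \<Union>K \<and>
            l \<in> P - (P - \<Union>K) \<and> order_convergent P le I r x l"
      then obtain I :: "('a \<times> 'a \<times> 'a) set" and r x l where
        *: "directed_set I r" "x ` I \<subseteq> P - \<Union>K" "l \<in> P - (P - \<Union>K)"
           "order_convergent P le I r x l"
        by blast
      then obtain U where U: "U \<in> K" "l \<in> U" by blast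
      then have "x ` I \<subseteq> P - U" "l \<in> P - (P - U)" using * by blast+
      then show False using K U *(1,4) unfolding order_closed_def by blast
    qed
  qed
  then show ?thesis by (simp add: order_top_def topology_inverse')
qed

end

theory Submission
  imports Defs
begin

text \<open>
  For hermitian \<open>x\<close> with spectral family \<open>E\<close>, the form \<open>\<langle>x v, v\<rangle>\<close> is the Stieltjes integral of \<open>t\<close>
  against \<open>\<langle>E t v, v\<rangle>\<close>, and it grows when the family decreases. Hence the spectral order is always
  contained in the usual one (\<open>spectral_le_imp_op_le\<close>). If \<open>x \<le> y\<close> commute, so do their spectral
  projections; a vector \<open>w\<close> with \<open>E\<^sup>y t w = w\<close> and \<open>E\<^sup>x s w = 0\<close>, where \<open>t < s\<close>, satisfies
  \<open>s \<parallel>w\<parallel>\<^sup>2 \<le> \<langle>x w, w\<rangle> \<le> \<langle>y w, w\<rangle> \<le> t \<parallel>w\<parallel>\<^sup>2\<close> and is zero, so that \<open>x\<close> is also below \<open>y\<close> in the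
  spectral order (\<open>op_le_imp_spectral_le\<close>). In an abelian algebra the two orders therefore coincide,
  and with them the two topologies.

  If \<open>M\<close> is not abelian, it contains a projection \<open>p\<close> and a positive \<open>h\<close> that do not commute
  (\<open>noncommuting_pair\<close>). The sequence \<open>X n = p + h / (n + 1)\<close> decreases to \<open>p\<close> in the usual order, so
  its range is not order closed there. It is order closed for the spectral order
  (\<open>perturbed_projection_order_closed\<close>). Indeed, let a net with values in this range lie between
  \<open>y i\<close>, increasing to \<open>l\<close>, and \<open>z i\<close>, decreasing to \<open>l\<close>. If it takes some value \<open>X m\<close> cofinally, then
  \<open>l = X m\<close>. Otherwise its index tends to infinity; since spectral inequalities survive limits in
  norm (\<open>spectral_le_limit_right\<close>, \<open>spectral_le_limit_left\<close>), \<open>y i \<preceq> p \<preceq> z i\<close> and \<open>l = p\<close>. Fix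
  \<open>0 < t < 1\<close> and let \<open>u\<close> be in the range of \<open>E\<^sup>z t\<close> for \<open>z = z i\<close>. Then \<open>p u = 0\<close>, and \<open>u\<close> lies in
  the range of \<open>E\<^sup>X t\<close> for some \<open>X = X n\<close>; this range is invariant under \<open>X\<close>, and \<open>X u = h u / (n + 1)\<close>.
  So \<open>h u\<close> lies in it, whence \<open>\<parallel>p h u\<parallel>\<^sup>2 \<le> \<langle>X h u, h u\<rangle> \<le> t \<parallel>h u\<parallel>\<^sup>2\<close>. Because \<open>p\<close> is the infimum of the
  \<open>z i\<close> in the spectral order, the vectors \<open>u\<close> of this kind are dense in the kernel of \<open>p\<close>
  (\<open>inf_projection_approx\<close>). Letting \<open>t\<close> tend to zero gives \<open>p h (1 - p) = 0\<close>, so \<open>p\<close> and \<open>h\<close> commute,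
  a contradiction.

  Spectral families have to be constructed first. The projection for \<open>(-\<infinity>, t]\<close> is the projection
  onto the kernel of the positive part of \<open>x - t\<close> (\<open>spectral_cut\<close>); absolute values come from an
  iteration for the square root (\<open>absolute_value_exists\<close>), and kernel projections are strong limits
  of polynomials (\<open>kernel_projection_limit\<close>). Uniqueness of the spectral family and stability of the
  spectral order under norm limits both follow from one estimate in the style of Davis and Kahan:
  \<open>\<parallel>(1 - E' s) E t\<parallel> \<le> \<parallel>x' - x\<parallel> / (s - t)\<close> for \<open>t < s\<close> (\<open>spectral_gap_estimate\<close>).
\<close>


section \<open>The real inner product\<close>

text \<open>
  With its real part as inner product, \<open>H\<close> is a real Hilbert space. A complex-linear operator that is
  symmetric for \<open>rip\<close> is self-adjoint, so almost everything below can be done with real numbers.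
\<close>
definition rip :: "'h::complex_hilbert_space \<Rightarrow> 'h \<Rightarrow> real" where
  "rip x y = Re (cinner x y)"

lemma scaleC_scaleR: "c *\<^sub>c (r *\<^sub>R x) = r *\<^sub>R (c *\<^sub>c (x::'h::complex_hilbert_space))"
  by (metis mult.commute scaleC_of_real scaleC_scaleC)

lemma scaleC_0: "c *\<^sub>c 0 = (0::'h::complex_hilbert_space)"
  by (metis scaleC_scaleR scaleR_zero_left)

lemma scaleC_diff: "c *\<^sub>c (x - y) = c *\<^sub>c x - c *\<^sub>c (y::'h::complex_hilbert_space)"
  using bounded_linear.linear[OF bounded_linear_scaleC] linear_diff by blast

lemma scaleC_i_i: "\<i> *\<^sub>c (\<i> *\<^sub>c x) = - (x::'h::complex_hilbert_space)"
  using scaleC_of_real[of "-1" x] by (simp add: scaleC_scaleC)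

lemma scaleC_split: "c *\<^sub>c x = Re c *\<^sub>R x + Im c *\<^sub>R (\<i> *\<^sub>c (x::'h::complex_hilbert_space))"
proof -
  have "c *\<^sub>c x = (complex_of_real (Re c) + \<i> * complex_of_real (Im c)) *\<^sub>c x"
    by (metis complex_eq)
  then show ?thesis
    by (simp add: scaleC_add_left scaleC_scaleC[symmetric] scaleC_of_real scaleC_scaleR)
qed

lemma rip_commute: "rip x y = rip y x"
  unfolding rip_def by (subst cinner_commute) simp

lemma rip_self: "rip x x = (norm x)\<^sup>2"
  by (simp add: rip_def cinner_self)

lemma rip_add_left: "rip (x + y) z = rip x z + rip y z"
  by (simp add: rip_def cinner_add_left)

lemma rip_scaleR_left: "rip (r *\<^sub>R x) z = r * rip x z"
  by (metis rip_def scaleC_of_real cinner_scaleC_left Re_complex_of_real Im_complex_of_real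
      times_complex.sel(1) mult_zero_left diff_zero)

lemma rip_add_right: "rip z (x + y) = rip z x + rip z y"
  by (metis rip_add_left rip_commute)

lemma rip_scaleR_right: "rip z (r *\<^sub>R x) = r * rip z x"
  by (metis rip_scaleR_left rip_commute)

lemma rip_Cauchy_Schwarz: "\<bar>rip x y\<bar> \<le> norm x * norm y"
proof (cases "y = 0")
  case True
  then show ?thesis using rip_scaleR_right[of x 0 0] by simp
next
  case False
  define c where "c = - rip x y / (norm y)\<^sup>2"
  have "0 \<le> rip (x + c *\<^sub>R y) (x + c *\<^sub>R y)"
    by (simp add: rip_self)
  also have "\<dots> = (norm x)\<^sup>2 + 2 * c * rip x y + c\<^sup>2 * (norm y)\<^sup>2"
    by (simp add: rip_self[symmetric] rip_add_left rip_add_right rip_scaleR_left rip_scaleR_right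
        rip_commute[of y x] power2_eq_square[of c] algebra_simps)
  also have "\<dots> = (norm x)\<^sup>2 - (rip x y)\<^sup>2 / (norm y)\<^sup>2"
    using False by (simp add: c_def field_simps power2_eq_square)
  finally have "(rip x y)\<^sup>2 \<le> (norm x * norm y)\<^sup>2"
    using False by (simp add: field_simps power_mult_distrib)
  then show ?thesis
    using abs_le_square_iff[of "rip x y" "norm x * norm y"] by (simp add: abs_mult)
qed

interpretation rip: bounded_bilinear rip
proof
  show "\<exists>K. \<forall>a b. norm (rip a b) \<le> norm a * norm b * K"
    by (rule exI[of _ 1]) (simp add: rip_Cauchy_Schwarz)
qed (auto simp: rip_add_left rip_add_right rip_scaleR_left rip_scaleR_right)

lemmas rip_simps = rip.add_left rip.add_right rip.diff_left rip.diff_right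
  rip.scaleR_left rip.scaleR_right rip.minus_left rip.minus_right rip.zero_left rip.zero_right

lemma rip_scaleC: "rip (c *\<^sub>c x) y = rip x (cnj c *\<^sub>c y)"
  by (simp add: rip_def cinner_scaleC_left cinner_scaleC_right)

lemma Im_cinner: "Im (cinner x y) = - rip (\<i> *\<^sub>c x) y"
  by (simp add: rip_def cinner_scaleC_left)

lemma norm_add_sq: "(norm (x + y))\<^sup>2 = (norm x)\<^sup>2 + 2 * rip x y + (norm y)\<^sup>2"
  by (simp add: rip_self[symmetric] rip_simps rip_commute[of y x])

lemma norm_diff_sq: "(norm (x - y))\<^sup>2 = (norm x)\<^sup>2 - 2 * rip x y + (norm y)\<^sup>2"
  by (simp add: rip_self[symmetric] rip_simps rip_commute[of y x])

lemma parallelogram: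
  fixes x y :: "'h::complex_hilbert_space"
  shows "(norm (x + y))\<^sup>2 + (norm (x - y))\<^sup>2 = 2 * (norm x)\<^sup>2 + 2 * (norm y)\<^sup>2"
  unfolding norm_add_sq norm_diff_sq by simp

lemma rip_eqI: "(\<And>y. rip x y = rip x' y) \<Longrightarrow> x = x'"
proof -
  assume "\<And>y. rip x y = rip x' y"
  then have "rip (x - x') (x - x') = 0" by (simp add: rip.diff_left)
  then show ?thesis by (simp add: rip_self)
qed

section \<open>Orthogonal projections\<close>

text \<open>
  A minimizing sequence for the distance from \<open>x\<close> to \<open>V\<close> is Cauchy by the parallelogram law; its limit
  is the foot of the perpendicular.
\<close>
lemma nearest_point_exists:
  fixes V :: "'h::complex_hilbert_space set"
  assumes V: "subspace V" "closed V"
  shows "\<exists>y\<in>V. \<forall>v\<in>V. rip (x - y) v = 0"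
proof -
  define d where "d = (INF v\<in>V. (norm (x - v))\<^sup>2)"
  have ne: "V \<noteq> {}" using V(1) subspace_0 by blast
  have bdd: "bdd_below ((\<lambda>v. (norm (x - v))\<^sup>2) ` V)" by (rule bdd_belowI2[of _ 0]) simp
  have dle: "d \<le> (norm (x - v))\<^sup>2" if "v \<in> V" for v
    unfolding d_def by (rule cINF_lower[OF bdd that])
  have "\<exists>v\<in>V. (norm (x - v))\<^sup>2 < d + 1 / real (Suc n)" for n
    using cINF_less_iff[OF ne bdd, of "d + 1 / real (Suc n)"] by (simp add: d_def)
  then obtain f where f: "\<And>n. f n \<in> V" "\<And>n. (norm (x - f n))\<^sup>2 < d + 1 / real (Suc n)"
    by metis
  have mid: "(norm (f m - f n))\<^sup>2 \<le> 2 / real (Suc m) + 2 / real (Suc n)" for m n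
  proof -
    have "(1/2) *\<^sub>R (f m + f n) \<in> V"
      using V(1) f(1) by (simp add: subspace_add subspace_scale)
    from dle[OF this] have "4 * d \<le> (2 * norm (x - (1/2) *\<^sub>R (f m + f n)))\<^sup>2"
      by (simp add: power_mult_distrib)
    also have "2 * norm (x - (1/2) *\<^sub>R (f m + f n)) = norm ((x - f m) + (x - f n))"
    proof -
      have "(x - f m) + (x - f n) = 2 *\<^sub>R (x - (1/2) *\<^sub>R (f m + f n))"
        by (simp add: algebra_simps scaleR_2)
      then show ?thesis by simp
    qed
    finally have "4 * d \<le> (norm ((x - f m) + (x - f n)))\<^sup>2" .
    moreover have "(x - f m) - (x - f n) = - (f m - f n)" by simp
    then have "norm ((x - f m) - (x - f n)) = norm (f m - f n)" by (metis norm_minus_cancel)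
    ultimately show ?thesis
      using parallelogram[of "x - f m" "x - f n"] f(2)[of m] f(2)[of n] by simp
  qed
  have "Cauchy f"
  proof (rule metric_CauchyI)
    fix e :: real assume e: "0 < e"
    obtain N where N: "4 / e\<^sup>2 < real N" using reals_Archimedean2 by blast
    show "\<exists>M. \<forall>m\<ge>M. \<forall>n\<ge>M. dist (f m) (f n) < e"
    proof (intro exI allI impI)
      fix m n assume mn: "N \<le> m" "N \<le> n"
      have Npos: "0 < real N" using N e by (smt (verit) divide_pos_pos zero_less_power)
      have "1 / real (Suc m) < 1 / real N" "1 / real (Suc n) < 1 / real N"
        using mn Npos by (simp_all add: frac_less2)
      then have "(norm (f m - f n))\<^sup>2 < 4 / real N" using mid[of m n] by simp
      also have "\<dots> < e\<^sup>2" using N Npos e by (simp add: field_simps)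
      finally show "dist (f m) (f n) < e"
        using e by (simp add: dist_norm power_less_imp_less_base)
    qed
  qed
  then obtain y where y: "f \<longlonglongrightarrow> y" using convergent_eq_Cauchy by auto
  have yV: "y \<in> V" using V(2) f(1) y closed_sequentially by blast
  have lim: "(\<lambda>n. (norm (x - f n))\<^sup>2) \<longlonglongrightarrow> (norm (x - y))\<^sup>2"
    by (intro tendsto_intros y)
  have "(\<lambda>n. d + 1 / real (Suc n)) \<longlonglongrightarrow> d + 0"
    by (intro tendsto_intros LIMSEQ_Suc[OF lim_1_over_n, unfolded comp_def])
  then have yd: "(norm (x - y))\<^sup>2 \<le> d"
    using LIMSEQ_le[OF lim, of "\<lambda>n. d + 1 / real (Suc n)" d] less_imp_le[OF f(2)] by simp
  show ?thesis
  proof (intro bexI[OF _ yV] ballI)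
    fix v assume v: "v \<in> V"
    show "rip (x - y) v = 0"
    proof (cases "v = 0")
      case False
      define c where "c = rip (x - y) v / (norm v)\<^sup>2"
      have "y + c *\<^sub>R v \<in> V" using V(1) yV v by (simp add: subspace_add subspace_scale)
      from order_trans[OF yd dle[OF this]]
      have "(norm (x - y))\<^sup>2 \<le> (norm ((x - y) - c *\<^sub>R v))\<^sup>2"
        unfolding diff_diff_eq .
      then have "0 \<le> - 2 * c * rip (x - y) v + c\<^sup>2 * (norm v)\<^sup>2"
        by (simp add: norm_diff_sq[of "x - y"] rip_simps power_mult_distrib)
      also have "\<dots> = - (rip (x - y) v)\<^sup>2 / (norm v)\<^sup>2"
        using False by (simp add: c_def field_simps power2_eq_square)
      finally show ?thesis using False by (simp add: divide_le_0_iff)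
    qed (simp add: rip_simps)
  qed
qed

definition proj_pt :: "'h::complex_hilbert_space set \<Rightarrow> 'h \<Rightarrow> 'h" where
  "proj_pt V x = (SOME y. y \<in> V \<and> (\<forall>v\<in>V. rip (x - y) v = 0))"

definition Proj :: "'h::complex_hilbert_space set \<Rightarrow> ('h \<Rightarrow>\<^sub>L 'h)" where
  "Proj V = Blinfun (proj_pt V)"

definition closed_csubspace :: "'h::complex_hilbert_space set \<Rightarrow> bool" where
  "closed_csubspace V \<longleftrightarrow> subspace V \<and> closed V \<and> (\<forall>c. \<forall>v\<in>V. c *\<^sub>c v \<in> V)"

definition hermitian :: "('h::complex_hilbert_space \<Rightarrow>\<^sub>L 'h) \<Rightarrow> bool" where
  "hermitian T \<longleftrightarrow> T \<in> bounded_ops \<and> (\<forall>x y. rip (T x) y = rip x (T y))"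

definition is_projection :: "('h::complex_hilbert_space \<Rightarrow>\<^sub>L 'h) \<Rightarrow> bool" where
  "is_projection P \<longleftrightarrow> hermitian P \<and> (\<forall>x. P (P x) = P x)"

lemma
  fixes V :: "'h::complex_hilbert_space set"
  assumes V: "subspace V" "closed V"
  shows Proj_in: "Proj V x \<in> V" and Proj_orth: "v \<in> V \<Longrightarrow> rip (x - Proj V x) v = 0"
    and Proj_eqI: "y \<in> V \<Longrightarrow> (\<And>v. v \<in> V \<Longrightarrow> rip (x - y) v = 0) \<Longrightarrow> Proj V x = y"
proof -
  let ?p = "proj_pt V"
  have "\<exists>y. y \<in> V \<and> (\<forall>v\<in>V. rip (x - y) v = 0)" for x
    using nearest_point_exists[OF V, of x] by blast
  from someI_ex[OF this] have p: "?p x \<in> V" "\<forall>v\<in>V. rip (x - ?p x) v = 0" for x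
    unfolding proj_pt_def by blast+
  have u: "?p x = y" if "y \<in> V" "\<And>v. v \<in> V \<Longrightarrow> rip (x - y) v = 0" for x y
  proof -
    have "?p x - y \<in> V" using V(1) p(1) that(1) by (simp add: subspace_diff)
    from that(2)[OF this] p(2)[rule_format, OF this, of x]
    have "rip ((x - y) - (x - ?p x)) (?p x - y) = 0"
      unfolding rip.diff_left[of "x - y"] by simp
    moreover have "(x - y) - (x - ?p x) = ?p x - y" by simp
    ultimately show ?thesis by (simp add: rip_self)
  qed
  have "bounded_linear ?p"
  proof (rule bounded_linear_intro[where K = 1])
    show "?p (x + y) = ?p x + ?p y" for x y
    proof (rule u)
      show "?p x + ?p y \<in> V" using V(1) p(1) by (simp add: subspace_add)
      have "rip ((x - ?p x) + (y - ?p y)) v = 0" if "v \<in> V" for v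
        unfolding rip.add_left using p(2) that by simp
      moreover have "x + y - (?p x + ?p y) = (x - ?p x) + (y - ?p y)" by simp
      ultimately show "rip (x + y - (?p x + ?p y)) v = 0" if "v \<in> V" for v
        using that by metis
    qed
    show "?p (r *\<^sub>R x) = r *\<^sub>R ?p x" for r x
    proof (rule u)
      show "r *\<^sub>R ?p x \<in> V" using V(1) p(1) by (simp add: subspace_scale)
      show "rip (r *\<^sub>R x - r *\<^sub>R ?p x) v = 0" if "v \<in> V" for v
        using p(2) that by (simp add: rip.scaleR_left flip: scaleR_diff_right)
    qed
    fix x
    have "rip (x - ?p x) (?p x) = 0" using p by blast
    then have "(norm x)\<^sup>2 = (norm (x - ?p x))\<^sup>2 + (norm (?p x))\<^sup>2"
      using norm_add_sq[of "x - ?p x" "?p x"] by simp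
    then have "(norm (?p x))\<^sup>2 \<le> (norm x)\<^sup>2" by simp
    then show "norm (?p x) \<le> norm x * 1" using power2_le_imp_le by force
  qed
  then have eq: "blinfun_apply (Proj V) = ?p"
    unfolding Proj_def by (simp add: bounded_linear_Blinfun_apply)
  show "Proj V x \<in> V" "v \<in> V \<Longrightarrow> rip (x - Proj V x) v = 0"
    "y \<in> V \<Longrightarrow> (\<And>v. v \<in> V \<Longrightarrow> rip (x - y) v = 0) \<Longrightarrow> Proj V x = y"
    using p u eq by auto
qed

lemma Proj_fix: "subspace V \<Longrightarrow> closed V \<Longrightarrow> x \<in> V \<Longrightarrow> Proj V x = x"
  by (rule Proj_eqI) (auto simp: rip_simps)

lemma Proj_fix_iff: "subspace V \<Longrightarrow> closed V \<Longrightarrow> Proj V x = x \<longleftrightarrow> x \<in> V"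
  by (metis Proj_fix Proj_in)

lemma Proj_0_iff: "subspace V \<Longrightarrow> closed V \<Longrightarrow> Proj V x = 0 \<longleftrightarrow> (\<forall>v\<in>V. rip x v = 0)"
  using Proj_eqI[of V 0 x] Proj_orth[of V _ x] subspace_0[of V] by auto

lemma Proj_is_projection:
  assumes "closed_csubspace V" shows "is_projection (Proj V)"
proof -
  have V: "subspace V" "closed V" "\<And>c v. v \<in> V \<Longrightarrow> c *\<^sub>c v \<in> V" using assms by (auto simp: closed_csubspace_def)
  have 1: "Proj V (c *\<^sub>c x) = c *\<^sub>c Proj V x" for c x
  proof (rule Proj_eqI[OF V(1,2)])
    show "c *\<^sub>c Proj V x \<in> V" using V Proj_in by blast
    show "rip (c *\<^sub>c x - c *\<^sub>c Proj V x) v = 0" if "v \<in> V" for v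
      unfolding scaleC_diff[symmetric] rip_scaleC using Proj_orth[OF V(1,2)] V(3) that by blast
  qed
  have 2: "rip (Proj V x) y = rip x (Proj V y)" for x y
  proof -
    have "rip x (Proj V y) - rip (Proj V x) (Proj V y) = 0"
      "rip y (Proj V x) - rip (Proj V y) (Proj V x) = 0"
      unfolding rip.diff_left[symmetric] using Proj_in[OF V(1,2)] Proj_orth[OF V(1,2)] by blast+
    then show ?thesis by (metis eq_iff_diff_eq_0 rip_commute)
  qed
  show ?thesis unfolding is_projection_def hermitian_def bounded_ops_def
    using 1 2 Proj_fix[OF V(1,2) Proj_in[OF V(1,2)]] by blast
qed

section \<open>Riesz representation, adjoints and hermitian operators\<close>

text \<open>
  The representing vector spans the orthogonal complement of the kernel of \<open>f\<close>.
\<close>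
lemma riesz_representation:
  fixes f :: "'h::complex_hilbert_space \<Rightarrow> real"
  assumes f: "bounded_linear f"
  shows "\<exists>z. \<forall>x. f x = rip x z"
proof (cases "\<forall>x. f x = 0")
  case True then show ?thesis by (auto intro: exI[of _ 0] simp: rip_simps)
next
  case False
  interpret f: bounded_linear f by (rule f)
  define K where "K = {x. f x = 0}"
  have K: "subspace K" "closed K"
    unfolding K_def using f
    by (auto simp: subspace_def f.add f.scaleR
        intro!: closed_Collect_eq linear_continuous_on continuous_on_const)
  from False obtain u where u: "f u \<noteq> 0" by blast
  define v where "v = u - Proj K u"
  have fv: "f v = f u" unfolding v_def using Proj_in[OF K, of u] by (simp add: K_def f.diff)
  then have v0: "v \<noteq> 0" using u f.zero by auto
  have "f x = rip x ((f v / (norm v)\<^sup>2) *\<^sub>R v)" for x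
  proof -
    have "x - (f x / f v) *\<^sub>R v \<in> K" using fv u by (simp add: K_def f.diff f.scaleR)
    from Proj_orth[OF K this, of u] have "rip v (x - (f x / f v) *\<^sub>R v) = 0" by (simp add: v_def)
    then have "rip x v = f x / f v * (norm v)\<^sup>2" by (simp add: rip_simps rip_commute rip_self)
    then show ?thesis using fv u v0 by (simp add: rip_simps field_simps)
  qed
  then show ?thesis by blast
qed

lemma adjoint_exists:
  fixes T :: "'h::complex_hilbert_space \<Rightarrow>\<^sub>L 'h"
  assumes T: "T \<in> bounded_ops"
  shows "\<exists>S. S \<in> bounded_ops \<and> (\<forall>x y. rip (T x) y = rip x (S y))"
proof -
  have "\<exists>z. \<forall>x. rip (T x) y = rip x z" for y
    by (intro riesz_representation bounded_linear_compose[OF rip.bounded_linear_left] blinfun.bounded_linear_right)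
  then obtain g where g: "\<And>x y. rip (T x) y = rip x (g y)" by metis
  have g': "rip (g y) x = rip y (T x)" for x y by (metis g rip_commute)
  have "bounded_linear g"
  proof (rule bounded_linear_intro[where K = "norm T"])
    show "g (x + y) = g x + g y" for x y by (rule rip_eqI) (simp add: g' rip_simps)
    show "g (r *\<^sub>R x) = r *\<^sub>R g x" for r x by (rule rip_eqI) (simp add: g' rip_simps)
    fix y
    have "(norm (g y))\<^sup>2 = rip y (T (g y))" by (metis g' rip_self)
    also have "\<dots> \<le> norm y * norm (T (g y))" using rip_Cauchy_Schwarz abs_le_D1 by blast
    also have "\<dots> \<le> norm y * (norm T * norm (g y))"
      by (intro mult_left_mono norm_blinfun norm_ge_zero)
    finally have "norm (g y) * norm (g y) \<le> (norm y * norm T) * norm (g y)"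
      by (simp add: power2_eq_square mult.assoc)
    then show "norm (g y) \<le> norm y * norm T"
      by (cases "g y = 0") auto
  qed
  then have ap: "blinfun_apply (Blinfun g) = g" by (simp add: bounded_linear_Blinfun_apply)
  have "g (c *\<^sub>c x) = c *\<^sub>c g x" for c x
  proof (rule rip_eqI)
    fix y
    have "T (cnj c *\<^sub>c y) = cnj c *\<^sub>c T y" using T by (simp add: bounded_ops_def)
    then show "rip (g (c *\<^sub>c x)) y = rip (c *\<^sub>c g x) y" by (simp add: g' rip_scaleC)
  qed
  then have "Blinfun g \<in> bounded_ops" by (simp add: bounded_ops_def ap)
  then show ?thesis using g ap by metis
qed

text \<open>
  Imaginary parts are real parts at \<open>\<i> x\<close>, so the real identity suffices.
\<close>
lemma cinner_eq_iff_rip: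
  assumes "T \<in> bounded_ops" "S \<in> bounded_ops"
  shows "(\<forall>x y. cinner (T x) y = cinner x (S y)) \<longleftrightarrow> (\<forall>x y. rip (T x) y = rip x (S y))"
proof
  assume "\<forall>x y. cinner (T x) y = cinner x (S y)" then show "\<forall>x y. rip (T x) y = rip x (S y)"
    by (simp add: rip_def)
next
  assume r: "\<forall>x y. rip (T x) y = rip x (S y)"
  show "\<forall>x y. cinner (T x) y = cinner x (S y)"
  proof (intro allI complex_eqI)
    fix x y
    show "Re (cinner (T x) y) = Re (cinner x (S y))" using r by (simp add: rip_def)
    have "T (\<i> *\<^sub>c x) = \<i> *\<^sub>c T x" using assms by (simp add: bounded_ops_def)
    then show "Im (cinner (T x) y) = Im (cinner x (S y))" using r by (metis Im_cinner)
  qed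
qed

lemma
  fixes T :: "'h::complex_hilbert_space \<Rightarrow>\<^sub>L 'h"
  assumes T: "T \<in> bounded_ops"
  shows adj_rip: "rip (T x) y = rip x (adj_op T y)"
    and adj_eqI: "S \<in> bounded_ops \<Longrightarrow> (\<And>x y. rip (T x) y = rip x (S y)) \<Longrightarrow> adj_op T = S"
proof -
  have u: "S = S'" if "\<forall>x y. rip (T x) y = rip x (S y)" "\<forall>x y. rip (T x) y = rip x (S' y)" for S S' :: "'h \<Rightarrow>\<^sub>L 'h"
    by (rule blinfun_eqI, rule rip_eqI) (metis that rip_commute)
  have eq: "adj_op T = S" if "S \<in> bounded_ops" "\<And>x y. rip (T x) y = rip x (S y)" for S
    unfolding adj_op_def
  proof (rule the_equality)
    show "S \<in> bounded_ops \<and> (\<forall>x y. cinner (T x) y = cinner x (S y))"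
      using that cinner_eq_iff_rip[OF T] by blast
    show "S' = S" if "S' \<in> bounded_ops \<and> (\<forall>x y. cinner (T x) y = cinner x (S' y))" for S'
      using that \<open>\<And>x y. rip (T x) y = rip x (S y)\<close> cinner_eq_iff_rip[OF T, of S'] u by blast
  qed
  obtain S where S: "S \<in> bounded_ops" "\<And>x y. rip (T x) y = rip x (S y)"
    using adjoint_exists[OF T] by blast
  show "rip (T x) y = rip x (adj_op T y)" using eq[OF S] S by auto
  show "S \<in> bounded_ops \<Longrightarrow> (\<And>x y. rip (T x) y = rip x (S y)) \<Longrightarrow> adj_op T = S" for S
    by (rule eq)
qed

lemma hermitian_iff: "hermitian T \<longleftrightarrow> T \<in> bounded_ops \<and> adj_op T = T"
proof
  assume "hermitian T" then show "T \<in> bounded_ops \<and> adj_op T = T"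
    unfolding hermitian_def using adj_eqI[of T T] by blast
next
  assume a: "T \<in> bounded_ops \<and> adj_op T = T"
  then have "rip (T x) y = rip x (T y)" for x y using adj_rip[of T x y] by metis
  with a show "hermitian T" by (simp add: hermitian_def)
qed

lemma projection_op_iff: "projection_op P \<longleftrightarrow> is_projection P"
proof -
  have "P o\<^sub>L P = P \<longleftrightarrow> (\<forall>x. P (P x) = P x)"
    by (metis blinfun_apply_blinfun_compose blinfun_eqI)
  then show ?thesis unfolding projection_op_def is_projection_def hermitian_iff by blast
qed

lemma bounded_ops_scaleC: "T \<in> bounded_ops \<Longrightarrow> T (c *\<^sub>c x) = c *\<^sub>c T x"
  by (simp add: bounded_ops_def)

lemma bounded_opsI:
  fixes T :: "'h::complex_hilbert_space \<Rightarrow>\<^sub>L 'h"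
  shows "(\<And>c x. T (c *\<^sub>c x) = c *\<^sub>c T x) \<Longrightarrow> T \<in> bounded_ops"
  by (simp add: bounded_ops_def)

lemma bounded_ops_intros [intro]:
  fixes S T :: "'h::complex_hilbert_space \<Rightarrow>\<^sub>L 'h"
  shows "(0 :: 'h \<Rightarrow>\<^sub>L 'h) \<in> bounded_ops"
    and "(id_blinfun :: 'h \<Rightarrow>\<^sub>L 'h) \<in> bounded_ops"
    and "S \<in> bounded_ops \<Longrightarrow> T \<in> bounded_ops \<Longrightarrow> S + T \<in> bounded_ops"
    and "S \<in> bounded_ops \<Longrightarrow> T \<in> bounded_ops \<Longrightarrow> S - T \<in> bounded_ops"
    and "T \<in> bounded_ops \<Longrightarrow> r *\<^sub>R T \<in> bounded_ops"
    and "S \<in> bounded_ops \<Longrightarrow> T \<in> bounded_ops \<Longrightarrow> S o\<^sub>L T \<in> bounded_ops"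
       apply (rule bounded_opsI, simp add: scaleC_0)
      apply (rule bounded_opsI, simp)
     apply (rule bounded_opsI, simp add: blinfun.add_left bounded_ops_scaleC scaleC_add_right)
    apply (rule bounded_opsI, simp add: blinfun.diff_left bounded_ops_scaleC scaleC_diff)
   apply (rule bounded_opsI, simp add: blinfun.scaleR_left bounded_ops_scaleC scaleC_scaleR)
  apply (rule bounded_opsI, simp add: bounded_ops_scaleC)
  done

lemma hermitian_bounded_ops [dest]: "hermitian T \<Longrightarrow> T \<in> bounded_ops" by (simp add: hermitian_def)

lemma hermitian_rip: "hermitian T \<Longrightarrow> rip (T x) y = rip x (T y)" by (simp add: hermitian_def)

lemma hermitianI:
  fixes T :: "'h::complex_hilbert_space \<Rightarrow>\<^sub>L 'h"
  shows "T \<in> bounded_ops \<Longrightarrow> (\<And>x y. rip (T x) y = rip x (T y)) \<Longrightarrow> hermitian T"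
  by (simp add: hermitian_def)

lemma hermitian_intros [intro]:
  fixes S T :: "'h::complex_hilbert_space \<Rightarrow>\<^sub>L 'h"
  shows "hermitian (0 :: 'h \<Rightarrow>\<^sub>L 'h)" and "hermitian (id_blinfun :: 'h \<Rightarrow>\<^sub>L 'h)"
    and "hermitian S \<Longrightarrow> hermitian T \<Longrightarrow> hermitian (S + T)"
    and "hermitian S \<Longrightarrow> hermitian T \<Longrightarrow> hermitian (S - T)"
    and "hermitian T \<Longrightarrow> hermitian (r *\<^sub>R T)"
      apply (rule hermitianI[OF bounded_ops_intros(1)], simp add: rip_simps)
     apply (rule hermitianI[OF bounded_ops_intros(2)], simp)
    apply (rule hermitianI[OF bounded_ops_intros(3)], auto simp: blinfun.add_left rip_simps hermitian_rip)[1]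
   apply (rule hermitianI[OF bounded_ops_intros(4)], auto simp: blinfun.diff_left rip_simps hermitian_rip)[1]
  apply (rule hermitianI[OF bounded_ops_intros(5)], auto simp: blinfun.scaleR_left rip_simps hermitian_rip)[1]
  done

lemma hermitian_compose: "hermitian S \<Longrightarrow> hermitian T \<Longrightarrow> S o\<^sub>L T = T o\<^sub>L S \<Longrightarrow> hermitian (S o\<^sub>L T)"
  unfolding hermitian_def by (metis blinfun_apply_blinfun_compose bounded_ops_intros(6))

lemma hermitian_square: "hermitian T \<Longrightarrow> hermitian (T o\<^sub>L T)" by (rule hermitian_compose) auto

lemma hermitian_cinner_real:
  assumes "hermitian T" shows "cinner (T x) x = complex_of_real (rip (T x) x)"
proof -
  have "cinner (T x) y = cinner x (T y)" for x y
    using assms cinner_eq_iff_rip[of T T] by (auto simp: hermitian_def)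
  then have "cinner (T x) x = cnj (cinner (T x) x)" by (metis cinner_commute)
  then show ?thesis by (simp add: rip_def complex_eq_iff)
qed

lemma op_le_iff:
  assumes "hermitian S" "hermitian T"
  shows "op_le S T \<longleftrightarrow> (\<forall>x. rip (S x) x \<le> rip (T x) x)"
proof -
  have s: "hermitian (T - S)" using assms by blast
  have c: "cinner ((T - S) x) x = complex_of_real (rip (T x) x - rip (S x) x)" for x
    using hermitian_cinner_real[OF s, of x] by (simp add: blinfun.bilinear_simps rip_simps)
  show ?thesis unfolding op_le_def positive_op_def
    using hermitian_bounded_ops[OF s] by (simp add: c)
qed

lemma hermitian_eqI_form:
  assumes S: "hermitian S" and T: "hermitian T" and q: "\<And>x. rip (S x) x = rip (T x) x"
  shows "S = T"
proof (intro blinfun_eqI rip_eqI)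
  fix x y
  have "rip (S (x + y)) (x + y) = rip (T (x + y)) (x + y)" by (rule q)
  then have "rip (S x) y + rip (S y) x = rip (T x) y + rip (T y) x"
    using q[of x] q[of y] by (simp add: blinfun.bilinear_simps rip_simps)
  moreover have "rip (S y) x = rip (S x) y" "rip (T y) x = rip (T x) y"
    using S T by (metis hermitian_rip rip_commute)+
  ultimately show "rip (S x) y = rip (T x) y" by simp
qed

lemma op_le_antisym: "hermitian S \<Longrightarrow> hermitian T \<Longrightarrow> op_le S T \<Longrightarrow> op_le T S \<Longrightarrow> S = T"
  by (rule hermitian_eqI_form) (auto simp: op_le_iff intro!: order.antisym)

text \<open>
  The norm of a hermitian operator is its numerical radius: polarize \<open>\<langle>T x, y\<rangle>\<close> with \<open>y\<close> in the
  direction of \<open>T x\<close> and of the same norm as \<open>x\<close>, then apply the parallelogram law.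
\<close>
lemma norm_le_form:
  assumes T: "hermitian T" and q: "\<And>x. \<bar>rip (T x) x\<bar> \<le> r * (norm x)\<^sup>2" and r: "0 \<le> r"
  shows "norm (T x) \<le> r * norm x"
proof (cases "T x = 0 \<or> x = 0")
  case True then show ?thesis using r by (auto simp: blinfun.zero_right)
next
  case False
  define y where "y = (norm x / norm (T x)) *\<^sub>R T x"
  have ny: "norm y = norm x" using False by (simp add: y_def)
  have "4 * rip (T x) y = rip (T (x + y)) (x + y) - rip (T (x - y)) (x - y)"
    using T by (simp add: blinfun.bilinear_simps rip_simps) (metis hermitian_rip rip_commute)
  also have "\<dots> \<le> r * (norm (x + y))\<^sup>2 + r * (norm (x - y))\<^sup>2"
    using q[of "x + y"] q[of "x - y"] by linarith
  also have "\<dots> = r * ((norm (x + y))\<^sup>2 + (norm (x - y))\<^sup>2)" by (simp add: algebra_simps)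
  also have "\<dots> = 4 * r * (norm x)\<^sup>2" unfolding parallelogram ny by (simp add: algebra_simps)
  finally have "rip (T x) y \<le> r * (norm x)\<^sup>2" by simp
  moreover have "rip (T x) y = norm x * norm (T x)"
    using False by (simp add: y_def rip_simps rip_self power2_eq_square)
  ultimately show ?thesis using False by (simp add: power2_eq_square)
qed

lemma form_bound:
  fixes T :: "'h::complex_hilbert_space \<Rightarrow>\<^sub>L 'h"
  shows "\<bar>rip (T x) x\<bar> \<le> norm T * (norm x)\<^sup>2"
proof -
  have "\<bar>rip (T x) x\<bar> \<le> norm (T x) * norm x" by (rule rip_Cauchy_Schwarz)
  also have "\<dots> \<le> (norm T * norm x) * norm x" by (intro mult_right_mono norm_blinfun) simp
  finally show ?thesis by (simp add: power2_eq_square)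
qed

lemma norm_is_projection: "is_projection P \<Longrightarrow> (norm (P x))\<^sup>2 = rip (P x) x"
  by (metis is_projection_def rip_self hermitian_rip rip_commute)

lemma is_projection_pythagoras: "is_projection P \<Longrightarrow> (norm x)\<^sup>2 = (norm (P x))\<^sup>2 + (norm (x - P x))\<^sup>2"
  by (simp add: norm_diff_sq norm_is_projection rip_commute)

lemma is_projection_norm_le: "is_projection P \<Longrightarrow> norm (P x) \<le> norm x"
  by (rule power2_le_imp_le) (simp_all add: is_projection_pythagoras[of P x])

lemma is_projection_compl: "is_projection P \<Longrightarrow> is_projection (id_blinfun - P)"
  unfolding is_projection_def by (auto simp: blinfun.bilinear_simps)

text \<open>
  Since \<open>\<langle>P x, x\<rangle> = \<parallel>P x\<parallel>\<^sup>2\<close>, the inequality of forms says \<open>\<parallel>P x\<parallel> \<le> \<parallel>Q x\<parallel>\<close>; a vector with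
  \<open>\<parallel>Q x\<parallel> = \<parallel>x\<parallel>\<close> is fixed by \<open>Q\<close>. With this the spectral order becomes a statement about ranges.
\<close>
lemma op_le_proj_iff:
  assumes P: "is_projection P" and Q: "is_projection Q"
  shows "op_le P Q \<longleftrightarrow> (\<forall>x. P x = x \<longrightarrow> Q x = x)"
proof -
  have s: "hermitian P" "hermitian Q" using P Q by (auto simp: is_projection_def)
  have "op_le P Q \<longleftrightarrow> (\<forall>x. (norm (P x))\<^sup>2 \<le> (norm (Q x))\<^sup>2)"
    using norm_is_projection[OF P] norm_is_projection[OF Q] by (simp add: op_le_iff[OF s])
  also have "\<dots> \<longleftrightarrow> (\<forall>x. P x = x \<longrightarrow> Q x = x)"
  proof (intro iffI allI impI)
    fix x assume "\<forall>x. (norm (P x))\<^sup>2 \<le> (norm (Q x))\<^sup>2" "P x = x"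
    then have "(norm x)\<^sup>2 \<le> (norm (Q x))\<^sup>2" by metis
    then show "Q x = x" using is_projection_pythagoras[OF Q, of x] by simp
  next
    fix x assume 1: "\<forall>x. P x = x \<longrightarrow> Q x = x"
    have "Q (P x) = P x" for x using 1 P by (simp add: is_projection_def)
    then have "P (Q x) = P x" for x
      by (intro rip_eqI) (metis s hermitian_rip)
    then have "norm (P x) \<le> norm (Q x)" using is_projection_norm_le[OF P, of "Q x"] by metis
    then show "(norm (P x))\<^sup>2 \<le> (norm (Q x))\<^sup>2" by (simp add: power_mono)
  qed
  finally show ?thesis .
qed

lemma is_projection_antisym: "is_projection P \<Longrightarrow> is_projection Q \<Longrightarrow> op_le P Q \<Longrightarrow> op_le Q P \<Longrightarrow> P = Q"
  by (rule op_le_antisym) (auto simp: is_projection_def)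


lemmas blinfun_simps = blinfun.add_left blinfun.diff_left blinfun.scaleR_left
  blinfun.add_right blinfun.diff_right blinfun.scaleR_right blinfun.minus_right
  blinfun.zero_left blinfun.zero_right

section \<open>The strongly closed algebra generated by an operator\<close>

text \<open>
  Strong limits of sequences are enough to reach all spectral projections. Many sets of operators have
  these closure properties: commutants, the hermitian elements of a commutative algebra, the left
  multipliers of a von Neumann algebra. Membership in \<open>generated x\<close> thus yields commutation,
  symmetry and multiplier properties of the spectral projections of \<open>x\<close> at the same time.
\<close>
definition strong_alg :: "('h::complex_hilbert_space \<Rightarrow>\<^sub>L 'h) set \<Rightarrow> bool" where
  "strong_alg N \<longleftrightarrow> id_blinfun \<in> N \<and> (\<forall>S\<in>N. \<forall>T\<in>N. S + T \<in> N) \<and>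
     (\<forall>r. \<forall>T\<in>N. r *\<^sub>R T \<in> N) \<and> (\<forall>S\<in>N. \<forall>T\<in>N. S o\<^sub>L T \<in> N) \<and>
     (\<forall>f T. (\<forall>n. f n \<in> N) \<and> (\<forall>v. (\<lambda>n. blinfun_apply (f n) v) \<longlonglongrightarrow> blinfun_apply T v) \<longrightarrow> T \<in> N)"

definition generated :: "('h::complex_hilbert_space \<Rightarrow>\<^sub>L 'h) \<Rightarrow> ('h \<Rightarrow>\<^sub>L 'h) set" where
  "generated x = \<Inter>{N. strong_alg N \<and> x \<in> N}"

lemma strong_algD:
  assumes "strong_alg N"
  shows "id_blinfun \<in> N" "S \<in> N \<Longrightarrow> T \<in> N \<Longrightarrow> S + T \<in> N" "T \<in> N \<Longrightarrow> r *\<^sub>R T \<in> N"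
    "S \<in> N \<Longrightarrow> T \<in> N \<Longrightarrow> S o\<^sub>L T \<in> N"
    "(\<And>n. f n \<in> N) \<Longrightarrow> (\<And>v. (\<lambda>n. blinfun_apply (f n) v) \<longlonglongrightarrow> blinfun_apply T v) \<Longrightarrow> T \<in> N"
proof -
  note a = assms[unfolded strong_alg_def]
  show "id_blinfun \<in> N" "S \<in> N \<Longrightarrow> T \<in> N \<Longrightarrow> S + T \<in> N" "T \<in> N \<Longrightarrow> r *\<^sub>R T \<in> N"
    "S \<in> N \<Longrightarrow> T \<in> N \<Longrightarrow> S o\<^sub>L T \<in> N"
    using a by simp_all
  assume "\<And>n. f n \<in> N" "\<And>v. (\<lambda>n. blinfun_apply (f n) v) \<longlonglongrightarrow> blinfun_apply T v"
  then show "T \<in> N"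
    using a[THEN conjunct2, THEN conjunct2, THEN conjunct2, THEN conjunct2, THEN spec[of _ f],
        THEN spec[of _ T], THEN mp] by simp
qed

lemma strong_algI:
  assumes "id_blinfun \<in> N" "\<And>S T. S \<in> N \<Longrightarrow> T \<in> N \<Longrightarrow> S + T \<in> N"
    "\<And>r T. T \<in> N \<Longrightarrow> r *\<^sub>R T \<in> N" "\<And>S T. S \<in> N \<Longrightarrow> T \<in> N \<Longrightarrow> S o\<^sub>L T \<in> N"
    "\<And>f T. (\<And>n. f n \<in> N) \<Longrightarrow> (\<And>v. (\<lambda>n. blinfun_apply (f n) v) \<longlonglongrightarrow> blinfun_apply T v) \<Longrightarrow> T \<in> N"
  shows "strong_alg N"
  unfolding strong_alg_def
proof (intro conjI ballI allI impI)
  fix f T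
  assume "(\<forall>n. f n \<in> N) \<and> (\<forall>v. (\<lambda>n. blinfun_apply (f n) v) \<longlonglongrightarrow> blinfun_apply T v)"
  then show "T \<in> N" using assms(5)[of f T] by simp
qed (rule assms; assumption)+

lemma strong_alg_diff: "strong_alg N \<Longrightarrow> S \<in> N \<Longrightarrow> T \<in> N \<Longrightarrow> S - T \<in> N"
  by (metis strong_algD(2,3) scaleR_minus1_left diff_conv_add_uminus)

lemma strong_alg_generated: "strong_alg (generated x)"
proof (rule strong_algI)
  fix f T assume f: "\<And>n. f n \<in> generated x" "\<And>v. (\<lambda>n. blinfun_apply (f n) v) \<longlonglongrightarrow> blinfun_apply T v"
  show "T \<in> generated x"
    unfolding generated_def
  proof clarify
    fix N assume "strong_alg N" "x \<in> N"
    then have "f n \<in> N" for n using f(1)[of n] by (simp add: generated_def)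
    then show "T \<in> N" by (rule strong_algD(5)[OF \<open>strong_alg N\<close> _ f(2)])
  qed
qed (auto simp: generated_def intro: strong_algD(1-4))

lemma generated_self: "x \<in> generated x" by (auto simp: generated_def)

lemma generated_min: "T \<in> generated x \<Longrightarrow> strong_alg N \<Longrightarrow> x \<in> N \<Longrightarrow> T \<in> N" by (auto simp: generated_def)

lemma generated_trans: "T \<in> generated a \<Longrightarrow> a \<in> generated x \<Longrightarrow> T \<in> generated x"
  using generated_min strong_alg_generated by blast

lemma strong_alg_commutant: "strong_alg {T. \<forall>v. blinfun_apply T (blinfun_apply S v) = S (T v)}"
proof (rule strong_algI)
  fix f T assume f: "\<And>n. f n \<in> {T. \<forall>v. blinfun_apply T (S v) = S (blinfun_apply T v)}"
    and T: "\<And>v. (\<lambda>n. blinfun_apply (f n) v) \<longlonglongrightarrow> blinfun_apply T v"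
  have "T (S v) = S (T v)" for v
  proof (rule LIMSEQ_unique[OF T])
    have "(\<lambda>n. S (f n v)) \<longlonglongrightarrow> S (T v)" by (intro blinfun.tendsto tendsto_const T)
    then show "(\<lambda>n. f n (S v)) \<longlonglongrightarrow> S (T v)" using f by simp
  qed
  then show "T \<in> {T. \<forall>v. blinfun_apply T (blinfun_apply S v) = S (T v)}" by simp
qed (simp_all add: blinfun_simps)

lemma generated_commute:
  fixes S :: "'h::complex_hilbert_space \<Rightarrow>\<^sub>L 'h"
  assumes "T \<in> generated x" "\<And>v. x (S v) = S (x v)"
  shows "T (S v) = S (T v)"
  using generated_min[OF assms(1) strong_alg_commutant[of S]] assms(2) by blast

lemma generated_commute2: "S \<in> generated x \<Longrightarrow> T \<in> generated x \<Longrightarrow> S (T v) = T (S v)"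
  by (rule generated_commute[of S x]) (auto simp: generated_commute[of T x])

text \<open>
  Products of commuting hermitian operators are hermitian, so the hermitian elements of \<open>generated x\<close>
  form a strongly closed algebra containing \<open>x\<close>.
\<close>
lemma generated_hermitian:
  assumes "hermitian x" "T \<in> generated x" shows "hermitian T"
proof -
  have "strong_alg {T \<in> generated x. hermitian T}"
  proof (rule strong_algI)
    fix f T assume f: "\<And>n. f n \<in> {T \<in> generated x. hermitian T}"
      and T: "\<And>v. (\<lambda>n. blinfun_apply (f n) v) \<longlonglongrightarrow> blinfun_apply T v"
    have "T \<in> generated x" by (rule strong_algD(5)[OF strong_alg_generated _ T]) (use f in blast)
    moreover have "rip (T v) w = rip v (T w)" for v w
    proof (rule LIMSEQ_unique)
      show "(\<lambda>n. rip (f n v) w) \<longlonglongrightarrow> rip (T v) w" by (intro rip.tendsto tendsto_const T)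
      have "(\<lambda>n. rip v (f n w)) \<longlonglongrightarrow> rip v (T w)" by (intro rip.tendsto tendsto_const T)
      moreover have "rip (f n v) w = rip v (f n w)" for n using f[of n] hermitian_rip by blast
      ultimately show "(\<lambda>n. rip (f n v) w) \<longlonglongrightarrow> rip v (T w)" by simp
    qed
    moreover have "T (c *\<^sub>c v) = c *\<^sub>c T v" for c v
    proof (rule LIMSEQ_unique[OF T])
      have "(\<lambda>n. c *\<^sub>c f n v) \<longlonglongrightarrow> c *\<^sub>c T v"
        by (rule bounded_linear.tendsto[OF bounded_linear_scaleC T])
      moreover have "f n (c *\<^sub>c v) = c *\<^sub>c f n v" for n using f[of n] bounded_ops_scaleC by blast
      ultimately show "(\<lambda>n. f n (c *\<^sub>c v)) \<longlonglongrightarrow> c *\<^sub>c T v" by simp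
    qed
    ultimately show "T \<in> {T \<in> generated x. hermitian T}" using hermitianI[OF bounded_opsI] by blast
  next
    fix S T assume "S \<in> {T \<in> generated x. hermitian T}" "T \<in> {T \<in> generated x. hermitian T}"
    moreover from this have "S o\<^sub>L T = T o\<^sub>L S"
      by (intro blinfun_eqI) (simp add: generated_commute2[of _ x])
    ultimately show "S o\<^sub>L T \<in> {T \<in> generated x. hermitian T}"
      using strong_algD(4)[OF strong_alg_generated] hermitian_compose by blast
  qed (use strong_algD[OF strong_alg_generated] in blast)+
  then show ?thesis using generated_min assms generated_self by blast
qed

lemma strong_alg_closed:
  assumes "strong_alg N" "\<And>n. f n \<in> N" "f \<longlonglongrightarrow> T"
  shows "T \<in> N"
  by (rule strong_algD(5)[OF assms(1,2)]) (rule blinfun.tendsto[OF assms(3) tendsto_const])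

section \<open>Absolute values of hermitian operators\<close>

text \<open>
  For \<open>b = 1 - x\<^sup>2\<close> a fixed point \<open>y\<close> of this iteration satisfies \<open>(1 - y)\<^sup>2 = x\<^sup>2\<close>. The same iteration
  for the number \<open>1\<close> in place of \<open>b\<close> is bounded and increasing and dominates the norms of the
  iterates and of their increments.
\<close>
primrec sqrt_iter :: "('h::complex_hilbert_space \<Rightarrow>\<^sub>L 'h) \<Rightarrow> nat \<Rightarrow> ('h \<Rightarrow>\<^sub>L 'h)" where
  "sqrt_iter b 0 = 0"
| "sqrt_iter b (Suc n) = (1/2) *\<^sub>R (b + (sqrt_iter b n o\<^sub>L sqrt_iter b n))"

primrec sqrt_bound :: "nat \<Rightarrow> real" where
  "sqrt_bound 0 = 0"
| "sqrt_bound (Suc n) = (1/2) * (1 + sqrt_bound n * sqrt_bound n)"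

lemma sqrt_bound_range: "0 \<le> sqrt_bound n \<and> sqrt_bound n \<le> 1"
proof (induction n)
  case (Suc n)
  then have "0 \<le> sqrt_bound n * sqrt_bound n" "sqrt_bound n * sqrt_bound n \<le> 1"
    by (simp_all add: mult_le_one)
  then show ?case by simp
qed simp

lemma sqrt_bound_mono: "sqrt_bound n \<le> sqrt_bound (Suc n)"
proof -
  have "0 \<le> (1 - sqrt_bound n)\<^sup>2" by simp
  then show ?thesis by (simp add: power2_eq_square algebra_simps)
qed

lemma norm_compose_le:
  fixes S T :: "'h::complex_hilbert_space \<Rightarrow>\<^sub>L 'h"
  shows "norm S \<le> a \<Longrightarrow> norm T \<le> b \<Longrightarrow> norm (S o\<^sub>L T) \<le> a * b"
  by (rule order_trans[OF norm_blinfun_compose]) (auto intro!: mult_mono intro: order_trans[OF norm_ge_zero])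

text \<open>
  The operator \<open>m = 1 - y\<close> is the absolute value of \<open>x\<close>. It is positive because \<open>\<parallel>y\<parallel> \<le> 1\<close>. All iterates commute,
  so \<open>y\<^sub>n\<^sub>+\<^sub>1\<^sup>2 - y\<^sub>n\<^sup>2\<close> factors as a difference times a sum, which is what makes the scalar iteration a
  majorant.
\<close>
lemma absolute_value_exists:
  fixes x :: "'h::complex_hilbert_space \<Rightarrow>\<^sub>L 'h"
  assumes x: "hermitian x" and contr: "\<And>v. norm (x v) \<le> norm v"
  shows "\<exists>m\<in>generated x. (\<forall>v. m (m v) = x (x v)) \<and> (\<forall>v. 0 \<le> rip (m v) v)"
proof -
  note A = strong_alg_generated[of x]
  define b where "b = id_blinfun - (x o\<^sub>L x)"
  define y where "y = sqrt_iter b"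
  let ?s = sqrt_bound
  have bg: "b \<in> generated x"
    unfolding b_def by (intro strong_alg_diff[OF A] strong_algD(1,4)[OF A] generated_self)
  have yg: "y n \<in> generated x" for n
    unfolding y_def
  proof (induction n)
    case 0 show ?case using strong_algD(3)[OF A generated_self, of 0] by simp
  next
    case (Suc n) then show ?case using bg by (simp add: strong_algD(2,3,4)[OF A])
  qed
  have bform: "rip (b v) v = (norm v)\<^sup>2 - (norm (x v))\<^sup>2" for v
    using hermitian_rip[OF x, of "x v" v] by (simp add: b_def blinfun_simps rip_simps rip_self)
  have "\<bar>rip (b v) v\<bar> \<le> 1 * (norm v)\<^sup>2" for v
    using contr[of v] by (simp add: bform power_mono)
  then have nb: "norm b \<le> 1"
    using norm_le_form[OF generated_hermitian[OF x bg], of 1] by (intro norm_blinfun_bound) auto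
  have ny: "norm (y n) \<le> ?s n" for n
    unfolding y_def
  proof (induction n)
    case (Suc n)
    show ?case
      using norm_triangle_le[OF add_mono[OF nb norm_compose_le[OF Suc Suc]]] by simp
  qed simp
  have dy: "norm (y (Suc n) - y n) \<le> ?s (Suc n) - ?s n" for n
  proof (induction n)
    case 0 show ?case using nb by (simp add: y_def)
  next
    case (Suc n)
    have "y (Suc (Suc n)) - y (Suc n) = (1/2) *\<^sub>R ((y (Suc n) - y n) o\<^sub>L (y (Suc n) + y n))"
    proof (rule blinfun_eqI)
      fix v
      have s: "y (Suc k) v = (1/2) *\<^sub>R (b v + y k (y k v))" for k v
        by (simp add: y_def blinfun_simps)
      have c: "y n (y (Suc n) v) = y (Suc n) (y n v)" by (rule generated_commute2[OF yg yg])
      have "(y (Suc (Suc n)) - y (Suc n)) v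
          = (1/2) *\<^sub>R (b v + y (Suc n) (y (Suc n) v)) - (1/2) *\<^sub>R (b v + y n (y n v))"
        by (simp only: blinfun.diff_left s[of "Suc n"] s[of n v])
      also have "\<dots> = (1/2) *\<^sub>R (y (Suc n) (y (Suc n) v) - y n (y n v))"
        by (simp add: scaleR_diff_right scaleR_add_right)
      also have "\<dots> = (1/2) *\<^sub>R ((y (Suc n) - y n) ((y (Suc n) + y n) v))"
        by (simp add: blinfun.diff_left blinfun.add_left blinfun.add_right c)
      finally show "(y (Suc (Suc n)) - y (Suc n)) v
          = ((1/2) *\<^sub>R ((y (Suc n) - y n) o\<^sub>L (y (Suc n) + y n))) v"
        by (simp add: blinfun.scaleR_left)
    qed
    also have "norm \<dots> \<le> (1/2) * ((?s (Suc n) - ?s n) * (?s (Suc n) + ?s n))"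
      using norm_compose_le[OF Suc norm_triangle_le[OF add_mono[OF ny[of "Suc n"] ny[of n]]]] by simp
    also have "\<dots> = ?s (Suc (Suc n)) - ?s (Suc n)" by (simp add: field_simps)
    finally show ?case .
  qed
  have dy': "norm (y m - y n) \<le> ?s m - ?s n" if "n \<le> m" for m n
    using that
  proof (induction m rule: dec_induct)
    case (step m)
    then show ?case using norm_triangle_ineq[of "y (Suc m) - y m" "y m - y n"] dy[of m] by simp
  qed simp
  have "incseq ?s" using sqrt_bound_mono by (rule incseq_SucI)
  then have "convergent ?s" using sqrt_bound_range by (metis incseq_convergent convergentI)
  then have Cs: "Cauchy ?s" by (rule convergent_Cauchy)
  have "Cauchy y"
  proof (rule metric_CauchyI)
    fix e :: real assume "0 < e"
    then obtain N where N: "\<And>m n. N \<le> m \<Longrightarrow> N \<le> n \<Longrightarrow> dist (?s m) (?s n) < e"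
      using metric_CauchyD[OF Cs] by blast
    have "dist (y m) (y n) < e" if "N \<le> m" "N \<le> n" for m n
      using that
    proof (induction n m rule: linorder_wlog)
      case (le n m)
      then show ?case using dy'[of n m] N[of m n] by (simp add: dist_norm)
    qed (simp add: dist_commute)
    then show "\<exists>M. \<forall>m\<ge>M. \<forall>n\<ge>M. dist (y m) (y n) < e" by blast
  qed
  then obtain Y where Y: "y \<longlonglongrightarrow> Y" using convergent_eq_Cauchy by blast
  have Yg: "Y \<in> generated x" by (rule strong_alg_closed[OF A yg Y])
  have "(\<lambda>n. (1/2) *\<^sub>R (b + (y n o\<^sub>L y n))) \<longlonglongrightarrow> (1/2) *\<^sub>R (b + (Y o\<^sub>L Y))"
    by (intro tendsto_intros bounded_bilinear.tendsto[OF bounded_bilinear_blinfun_compose] Y)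
  then have "(\<lambda>n. y (Suc n)) \<longlonglongrightarrow> (1/2) *\<^sub>R (b + (Y o\<^sub>L Y))" by (simp add: y_def)
  then have fix_eq: "Y = (1/2) *\<^sub>R (b + (Y o\<^sub>L Y))" by (rule LIMSEQ_unique[OF LIMSEQ_Suc[OF Y]])
  have "2 *\<^sub>R Y v = b v + Y (Y v)" for v
    by (subst (1) fix_eq) (simp add: blinfun_simps)
  then have YY: "Y (Y v) = 2 *\<^sub>R Y v - v + x (x v)" for v
    by (simp add: b_def blinfun_simps algebra_simps)
  have nY: "norm Y \<le> 1"
    using LIMSEQ_le_const2[OF tendsto_norm[OF Y]] ny sqrt_bound_range order_trans by meson
  show ?thesis
  proof (intro bexI[of _ "id_blinfun - Y"] conjI allI)
    show "id_blinfun - Y \<in> generated x" by (intro strong_alg_diff[OF A] strong_algD(1)[OF A] Yg)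
    fix v
    show "(id_blinfun - Y) ((id_blinfun - Y) v) = x (x v)"
      by (simp add: blinfun_simps YY scaleR_2)
    have "norm Y * (norm v)\<^sup>2 \<le> 1 * (norm v)\<^sup>2" by (intro mult_right_mono nY) simp
    then show "0 \<le> rip ((id_blinfun - Y) v) v"
      using form_bound[of Y v] by (simp add: blinfun_simps rip_simps rip_self)
  qed
qed

section \<open>Kernel projections as strong limits\<close>

primrec op_power :: "('h::complex_hilbert_space \<Rightarrow>\<^sub>L 'h) \<Rightarrow> nat \<Rightarrow> ('h \<Rightarrow>\<^sub>L 'h)" where
  "op_power C 0 = id_blinfun"
| "op_power C (Suc n) = C o\<^sub>L op_power C n"

lemma kernel_csubspace: "T \<in> bounded_ops \<Longrightarrow> closed_csubspace {v. blinfun_apply T v = 0}"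
  unfolding closed_csubspace_def subspace_def
  by (auto simp: blinfun_simps bounded_ops_scaleC scaleC_0
      intro!: closed_Collect_eq linear_continuous_on blinfun.bounded_linear_right continuous_on_const)

lemma fixed_csubspace: "T \<in> bounded_ops \<Longrightarrow> closed_csubspace {v. blinfun_apply T v = v}"
  unfolding closed_csubspace_def subspace_def
  by (auto simp: blinfun_simps bounded_ops_scaleC
      intro!: closed_Collect_eq linear_continuous_on blinfun.bounded_linear_right bounded_linear_ident)

lemma closed_csubspaceD: "closed_csubspace V \<Longrightarrow> subspace V" "closed_csubspace V \<Longrightarrow> closed V" by (auto simp: closed_csubspace_def)

text \<open>
  Put \<open>C = 1 - w\<^sup>2\<close>. The numbers \<open>\<parallel>C\<^sup>k v\<parallel>\<^sup>2\<close> decrease and the inner product of \<open>C\<^sup>m v\<close> and \<open>C\<^sup>n v\<close> depends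
  only on \<open>m + n\<close>, so even powers form a Cauchy sequence. Its limit is fixed by \<open>C\<^sup>2\<close>, which forces it
  into the kernel of \<open>w\<close>, and vectors of that kernel are fixed by every power of \<open>C\<close>.
\<close>
lemma kernel_projection_limit:
  fixes w :: "'h::complex_hilbert_space \<Rightarrow>\<^sub>L 'h"
  assumes w: "hermitian w" and contr: "\<And>v. norm (w v) \<le> norm v"
  shows "(\<lambda>n. op_power (id_blinfun - (w o\<^sub>L w)) (2 * n) v) \<longlonglongrightarrow> Proj {v. w v = 0} v"
proof -
  define C where "C = id_blinfun - (w o\<^sub>L w)"
  let ?c = "op_power C"
  have Cs: "hermitian C" unfolding C_def using w hermitian_square by blast
  have Cform: "rip (C v) v = (norm v)\<^sup>2 - (norm (w v))\<^sup>2" for v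
    using hermitian_rip[OF w, of "w v" v] by (simp add: C_def blinfun_simps rip_simps rip_self)
  have "\<bar>rip (C v) v\<bar> \<le> 1 * (norm v)\<^sup>2" for v
    using contr[of v] by (simp add: Cform power_mono)
  then have nC: "norm (C v) \<le> norm v" for v
    using norm_le_form[OF Cs, of 1] by simp
  have cC: "?c n (C v) = C (?c n v)" for n v by (induction n) auto
  have cadd: "?c (m + n) v = ?c m (?c n v)" for m n v by (induction m) auto
  have crip: "rip (?c n v) u = rip v (?c n u)" for n v u
  proof (induction n arbitrary: u)
    case (Suc n) then show ?case by (simp add: hermitian_rip[OF Cs] cC)
  qed simp
  define f where "f k = (norm (?c k v))\<^sup>2" for k
  have dec: "decseq f"
    by (rule decseq_SucI) (simp add: f_def nC power_mono)
  have "bdd_below (range f)" by (rule bdd_belowI2[of _ 0]) (simp add: f_def)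
  from LIMSEQ_decseq_INF[OF this dec] obtain L where L: "f \<longlonglongrightarrow> L" by blast
  have Lle: "L \<le> f k" for k using decseq_ge[OF dec L] .
  have diff: "(norm (?c (2*a) v - ?c (2*b) v))\<^sup>2 = f (2*a) + f (2*b) - 2 * f (a+b)" for a b
  proof -
    have "rip (?c (2*a) v) (?c (2*b) v) = rip v (?c (2*a + 2*b) v)"
      by (simp only: crip cadd)
    also have "2*a + 2*b = (a+b) + (a+b)" by simp
    also have "rip v (?c \<dots> v) = f (a+b)" unfolding cadd[of "a+b"] f_def by (simp add: crip[symmetric] rip_self)
    finally show ?thesis by (simp add: norm_diff_sq f_def)
  qed
  have "Cauchy (\<lambda>n. ?c (2*n) v)"
  proof (rule metric_CauchyI)
    fix e :: real assume e: "0 < e"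
    have "L < L + e\<^sup>2 / 2" using e by simp
    from order_tendstoD(2)[OF L this] obtain N where N: "\<And>n. N \<le> n \<Longrightarrow> f n < L + e\<^sup>2 / 2"
      by (auto simp: eventually_sequentially)
    have "dist (?c (2*m) v) (?c (2*n) v) < e" if "N \<le> m" "N \<le> n" for m n
    proof -
      have "(norm (?c (2*m) v - ?c (2*n) v))\<^sup>2 < e\<^sup>2"
        unfolding diff using N[of "2*m"] N[of "2*n"] Lle[of "m+n"] that by simp
      then show ?thesis using e by (simp add: dist_norm power_less_imp_less_base)
    qed
    then show "\<exists>M. \<forall>m\<ge>M. \<forall>n\<ge>M. dist (?c (2*m) v) (?c (2*n) v) < e" by blast
  qed
  then obtain u where u: "(\<lambda>n. ?c (2*n) v) \<longlonglongrightarrow> u" using convergent_eq_Cauchy by blast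
  have "(\<lambda>n. C (C (?c (2*n) v))) \<longlonglongrightarrow> C (C u)" by (intro blinfun.tendsto tendsto_const u)
  moreover have "(\<lambda>n. C (C (?c (2*n) v))) = (\<lambda>n. ?c (2 * Suc n) v)" by simp
  ultimately have "C (C u) = u" using LIMSEQ_unique[OF LIMSEQ_Suc[OF u]] by metis
  then have "w (w (w (w u))) = 2 *\<^sub>R w (w u)"
    by (simp add: C_def blinfun_simps scaleR_2 algebra_simps)
  then have "2 * norm (w (w u)) = norm (w (w (w (w u))))" by simp
  also have "\<dots> \<le> norm (w (w u))" using contr order_trans by blast
  finally have "w (w u) = 0" by simp
  then have "(norm (w u))\<^sup>2 = 0" using hermitian_rip[OF w, of "w u" u] by (simp add: rip_simps rip_self)
  then have wu: "w u = 0" by simp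
  have "Proj {v. w v = 0} v = u"
  proof (rule Proj_eqI[OF closed_csubspaceD[OF kernel_csubspace[OF hermitian_bounded_ops[OF w]]]])
    show "u \<in> {v. w v = 0}" using wu by simp
    fix z assume "z \<in> {v. w v = 0}"
    then have "C z = z" by (simp add: C_def blinfun_simps)
    then have cz: "?c n z = z" for n by (induction n) auto
    have "(\<lambda>n. rip (v - ?c (2*n) v) z) \<longlonglongrightarrow> rip (v - u) z"
      by (intro rip.tendsto tendsto_intros u)
    moreover have "rip (v - ?c (2*n) v) z = 0" for n by (simp add: rip.diff_left crip cz)
    ultimately show "rip (v - u) z = 0" by (simp add: LIMSEQ_const_iff)
  qed
  then show ?thesis using u by (simp add: C_def)
qed

lemma op_power_in:
  assumes "id_blinfun \<in> N" "C \<in> N" "\<And>S T. S \<in> N \<Longrightarrow> T \<in> N \<Longrightarrow> S o\<^sub>L T \<in> N"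
  shows "op_power C n \<in> N"
  using assms by (induction n) auto

section \<open>A single spectral projection\<close>

text \<open>
  For a positive contraction \<open>m\<close>, evaluate the form at \<open>v - m v\<close>.
\<close>
lemma form_zero:
  assumes m: "hermitian m" and contr: "\<And>v. norm (m v) \<le> norm v" and pos: "\<And>v. 0 \<le> rip (m v) v"
    and z: "rip (m v) v = 0"
  shows "m v = 0"
proof -
  have "0 \<le> rip (m (v - m v)) (v - m v)" by (rule pos)
  also have "\<dots> = rip (m v) v - rip (m v) (m v) - rip (m (m v)) v + rip (m (m v)) (m v)"
    by (simp add: blinfun_simps rip_simps)
  also have "\<dots> = - 2 * (norm (m v))\<^sup>2 + rip (m (m v)) (m v)"
    using hermitian_rip[OF m, of "m v" v] z by (simp add: rip_self)
  finally have "2 * (norm (m v))\<^sup>2 \<le> norm (m (m v)) * norm (m v)"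
    using abs_le_D1[OF rip_Cauchy_Schwarz[of "m (m v)" "m v"]] by linarith
  also have "\<dots> \<le> norm (m v) * norm (m v)" by (intro mult_right_mono contr) simp
  finally have "norm (m v) * norm (m v) \<le> 0" by (simp add: power2_eq_square)
  then show ?thesis by (simp add: mult_le_0_iff)
qed

text \<open>
  Let \<open>a\<close> be \<open>x - t\<close>, scaled to a contraction, and let \<open>m\<close> be its absolute value. On the kernel of \<open>m + a\<close> one
  has \<open>a = -m \<le> 0\<close>. Since \<open>(m + a) (m - a) = 0\<close>, on the orthogonal complement of that kernel \<open>a = m\<close>, and
  the form of \<open>m\<close> vanishes there only at \<open>0\<close>; this makes the lower bound strict, which is
  what right continuity of the spectral family rests on.
\<close>
lemma spectral_cut:
  fixes x :: "'h::complex_hilbert_space \<Rightarrow>\<^sub>L 'h"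
  assumes x: "hermitian x"
  shows "\<exists>P\<in>generated x. is_projection P \<and> (\<forall>v. P v = v \<longrightarrow> rip (x v) v \<le> t * (norm v)\<^sup>2) \<and>
    (\<forall>v. P v = 0 \<longrightarrow> v \<noteq> 0 \<longrightarrow> t * (norm v)\<^sup>2 < rip (x v) v)"
proof -
  note A = strong_alg_generated[of x]
  define R where "R = norm x + \<bar>t\<bar> + 1"
  have R: "R > 0" unfolding R_def by (simp add: add_nonneg_pos)
  define a where "a = (1/R) *\<^sub>R (x - t *\<^sub>R id_blinfun)"
  have ag: "a \<in> generated x"
    unfolding a_def by (intro strong_algD(1,3)[OF A] strong_alg_diff[OF A] generated_self)
  have as: "hermitian a" by (rule generated_hermitian[OF x ag])
  have ax: "R * rip (a v) v = rip (x v) v - t * (norm v)\<^sup>2" for v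
    using R by (simp add: a_def blinfun_simps rip_simps rip_self)
  have nx: "norm (x v - t *\<^sub>R v) \<le> R * norm v" for v
    using norm_triangle_ineq4[of "x v" "t *\<^sub>R v"] norm_blinfun[of x v]
    by (simp add: R_def algebra_simps) (smt (verit) norm_ge_zero)
  have ca: "norm (a v) \<le> norm v" for v
  proof -
    have "a v = (1/R) *\<^sub>R (x v - t *\<^sub>R v)" by (simp add: a_def blinfun_simps)
    then have "norm (a v) = norm (x v - t *\<^sub>R v) / R" using R by simp
    then show ?thesis using nx[of v] R by (simp add: pos_divide_le_eq mult.commute)
  qed
  obtain m where mg0: "m \<in> generated a" and mm: "\<And>v. m (m v) = a (a v)" and mpos: "\<And>v. 0 \<le> rip (m v) v"
    using absolute_value_exists[OF as ca] by blast
  have mg: "m \<in> generated x" using generated_trans[OF mg0 ag] .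
  have ms: "hermitian m" by (rule generated_hermitian[OF x mg])
  have ma: "m (a v) = a (m v)" for v by (rule generated_commute2[OF mg ag])
  have "(norm (m v))\<^sup>2 = (norm (a v))\<^sup>2" for v
    using hermitian_rip[OF ms, of v "m v"] hermitian_rip[OF as, of v "a v"] by (simp add: mm rip_self)
  then have nm: "norm (m v) = norm (a v)" for v by (simp add: power2_eq_iff_nonneg)
  then have cm: "norm (m v) \<le> norm v" for v using ca by simp
  define w where "w = (1/2) *\<^sub>R (m + a)"
  have wg: "w \<in> generated x" unfolding w_def by (intro strong_algD(2,3)[OF A] mg ag)
  have ws: "hermitian w" by (rule generated_hermitian[OF x wg])
  have cw: "norm (w v) \<le> norm v" for v
    using norm_triangle_ineq[of "m v" "a v"] cm[of v] ca[of v] by (simp add: w_def blinfun_simps)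
  define K where "K = {v. w v = 0}"
  have K: "closed_csubspace K" unfolding K_def using ws kernel_csubspace by blast
  note K' = closed_csubspaceD[OF K]
  have Kiff: "v \<in> K \<longleftrightarrow> m v + a v = 0" for v by (simp add: K_def w_def blinfun_simps)
  have PK: "Proj K \<in> generated x"
  proof (rule strong_algD(5)[OF A])
    show "op_power (id_blinfun - (w o\<^sub>L w)) (2 * n) \<in> generated x" for n
      by (intro op_power_in strong_algD(1,4)[OF A] strong_alg_diff[OF A] wg)
    show "(\<lambda>n. op_power (id_blinfun - (w o\<^sub>L w)) (2 * n) v) \<longlonglongrightarrow> Proj K v" for v
      unfolding K_def by (rule kernel_projection_limit[OF ws cw])
  qed
  show ?thesis
  proof (intro bexI[OF _ PK] conjI allI impI)
    show "is_projection (Proj K)" by (rule Proj_is_projection[OF K])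
  next
    fix v assume "Proj K v = v"
    then have "m v + a v = 0" using Proj_fix_iff[OF K'] Kiff by blast
    then have "rip (a v) v = - rip (m v) v" by (metis add_eq_0_iff rip.minus_left)
    then have "R * rip (a v) v \<le> 0" using mpos[of v] R by (simp add: mult_le_0_iff)
    then show "rip (x v) v \<le> t * (norm v)\<^sup>2" by (simp add: ax)
  next
    fix v assume "Proj K v = 0" and v0: "v \<noteq> 0"
    then have orth: "\<And>z. z \<in> K \<Longrightarrow> rip v z = 0" using Proj_0_iff[OF K'] by blast
    have inK: "m z - a z \<in> K" for z
      unfolding Kiff by (simp add: blinfun_simps mm ma)
    define d where "d = m v - a v"
    have "rip d d = rip v (m d - a d)"
      using hermitian_rip[OF ms, of v d] hermitian_rip[OF as, of v d] by (simp add: d_def[of] rip_simps)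
    then have "rip d d = 0" using orth[OF inK] by simp
    then have d0: "m v = a v" by (simp add: rip_self d_def)
    have "rip (m v) v \<noteq> 0"
    proof
      assume "rip (m v) v = 0"
      from form_zero[OF ms cm mpos this] have "v \<in> K" unfolding Kiff by (simp add: d0[symmetric])
      from orth[OF this] show False using v0 by (simp add: rip_self)
    qed
    then have "0 < R * rip (a v) v" using mpos[of v] R d0 by (simp add: less_le)
    then show "t * (norm v)\<^sup>2 < rip (x v) v" by (simp add: ax)
  qed
qed

section \<open>Decreasing families of projections\<close>

lemma proj_ker_range:
  assumes P: "is_projection P" and Q: "is_projection Q" and sub: "\<And>v. Q v = v \<Longrightarrow> P v = v" and z: "P z = 0"
  shows "Q z = 0"
proof -
  have QQ: "Q (Q z) = Q z" using Q by (simp add: is_projection_def)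
  have "rip (Q z) (Q z) = rip z (Q (Q z))" using Q by (simp add: is_projection_def hermitian_rip)
  also have "\<dots> = rip z (P (Q z))" using QQ sub[OF QQ] by simp
  also have "\<dots> = rip (P z) (Q z)" using P by (simp add: is_projection_def hermitian_rip)
  finally show ?thesis by (simp add: z rip_simps rip_self)
qed

lemma subspace_closureI:
  fixes U :: "'a::real_normed_vector set"
  assumes U: "subspace U" shows "subspace (closure U)"
  unfolding subspace_def
proof (intro conjI ballI allI)
  show "0 \<in> closure U" using subspace_0[OF U] closure_subset by blast
  fix x assume "x \<in> closure U"
  then obtain f where f: "\<And>n. f n \<in> U" "f \<longlonglongrightarrow> x" by (metis closure_sequential)
  show "c *\<^sub>R x \<in> closure U" for c
    unfolding closure_sequential using f subspace_scale[OF U]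
    by (intro exI[of _ "\<lambda>n. c *\<^sub>R f n"]) (auto intro: tendsto_intros)
  fix y assume "y \<in> closure U"
  then obtain g where g: "\<And>n. g n \<in> U" "g \<longlonglongrightarrow> y" by (metis closure_sequential)
  show "x + y \<in> closure U"
    unfolding closure_sequential using f g subspace_add[OF U]
    by (intro exI[of _ "\<lambda>n. f n + g n"]) (auto intro: tendsto_intros)
qed

lemma closed_csubspace_INT: "(\<And>i. i \<in> I \<Longrightarrow> closed_csubspace (V i)) \<Longrightarrow> closed_csubspace (\<Inter>i\<in>I. V i)"
  unfolding closed_csubspace_def subspace_def by auto

text \<open>
  The kernels of the \<open>Q i\<close> form a directed family. A vector orthogonal to all of them lies in all ranges,
  so their union is dense in the orthogonal complement of the intersection of the ranges.
\<close>
lemma proj_decreasing_limit: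
  fixes Q :: "'i \<Rightarrow> ('h::complex_hilbert_space \<Rightarrow>\<^sub>L 'h)"
  assumes Q: "\<And>i. i \<in> I \<Longrightarrow> is_projection (Q i)" and ne: "I \<noteq> {}"
    and dir: "\<And>i j. i \<in> I \<Longrightarrow> j \<in> I \<Longrightarrow>
       \<exists>k\<in>I. \<forall>v. Q k v = v \<longrightarrow> Q i v = v \<and> Q j v = v"
    and e: "0 < e"
  shows "\<exists>i\<in>I. \<forall>j\<in>I. (\<forall>v. Q j v = v \<longrightarrow> Q i v = v) \<longrightarrow>
     norm (Q j x - Proj (\<Inter>i\<in>I. {v. Q i v = v}) x) < e"
proof -
  define W where "W = (\<Inter>i\<in>I. {v. Q i v = v})"
  have Qb: "Q i \<in> bounded_ops" if "i \<in> I" for i using Q[OF that] by (auto simp: is_projection_def)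
  have W: "closed_csubspace W" unfolding W_def using Qb by (intro closed_csubspace_INT fixed_csubspace)
  note W' = closed_csubspaceD[OF W]
  define U where "U = (\<Union>i\<in>I. {v. Q i v = 0})"
  have U: "subspace U"
    unfolding subspace_def
  proof (intro conjI ballI allI)
    show "0 \<in> U" using ne by (auto simp: U_def blinfun_simps)
    fix a b assume "a \<in> U" "b \<in> U"
    then obtain i j where ij: "i \<in> I" "j \<in> I" "Q i a = 0" "Q j b = 0" by (auto simp: U_def)
    from dir[OF ij(1,2)] obtain k where k: "k \<in> I" "\<And>v. Q k v = v \<Longrightarrow> Q i v = v \<and> Q j v = v" by blast
    have "Q k a = 0" "Q k b = 0"
      using proj_ker_range[OF Q[OF ij(1)] Q[OF k(1)]] proj_ker_range[OF Q[OF ij(2)] Q[OF k(1)]] k(2) ij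
      by blast+
    then have "Q k (a + b) = 0" by (simp add: blinfun_simps)
    then show "a + b \<in> U" using k(1) by (auto simp: U_def)
  qed (auto simp: U_def blinfun_simps)
  define V where "V = closure U"
  have V: "subspace V" "closed V" unfolding V_def using U by (auto intro: subspace_closureI)
  let ?d = "x - Proj W x"
  define r where "r = ?d - Proj V ?d"
  have rV: "rip r v = 0" if "v \<in> V" for v unfolding r_def by (rule Proj_orth[OF V that])
  have "Q i r = r" if i: "i \<in> I" for i
  proof -
    have q: "Q i (r - Q i r) = 0" using Q[OF i] by (simp add: is_projection_def blinfun_simps)
    then have "r - Q i r \<in> U" using i by (auto simp: U_def)
    then have "r - Q i r \<in> V" unfolding V_def using closure_subset by blast
    then have "rip r (r - Q i r) = 0" by (rule rV)
    moreover have "rip (Q i r) (r - Q i r) = 0"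
      using Q[OF i] q by (simp add: is_projection_def hermitian_rip rip_simps)
    ultimately have "rip (r - Q i r) (r - Q i r) = 0" by (simp only: rip.diff_left[of r])
    then show ?thesis by (simp add: rip_self)
  qed
  then have "r \<in> W" by (auto simp: W_def)
  then have "rip ?d r = 0" by (rule Proj_orth[OF W'])
  moreover have "rip (Proj V ?d) r = 0" using rV[OF Proj_in[OF V]] by (simp add: rip_commute)
  moreover have "rip r r = rip ?d r - rip (Proj V ?d) r"
    unfolding rip.diff_left[symmetric] by (simp only: r_def[symmetric])
  ultimately have "rip r r = 0" by simp
  then have "?d = Proj V ?d" by (simp add: rip_self r_def)
  then have "?d \<in> closure U" using Proj_in[OF V, of ?d] by (simp add: V_def)
  then obtain z where z: "z \<in> U" "dist z ?d < e" using e closure_approachable by blast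
  then obtain i where i: "i \<in> I" "Q i z = 0" by (auto simp: U_def)
  have "norm (Q j x - Proj W x) < e" if j: "j \<in> I" "\<forall>v. Q j v = v \<longrightarrow> Q i v = v" for j
  proof -
    have "Q j z = 0" using proj_ker_range[OF Q[OF i(1)] Q[OF j(1)]] j(2) i(2) by blast
    moreover have "Q j (Proj W x) = Proj W x" using Proj_in[OF W', of x] j(1) by (auto simp: W_def)
    ultimately have "Q j x - Proj W x = Q j (?d - z)" by (simp add: blinfun_simps)
    also have "norm \<dots> \<le> norm (?d - z)" by (rule is_projection_norm_le[OF Q[OF j(1)]])
    also have "\<dots> < e" using z(2) by (simp add: dist_norm norm_minus_commute)
    finally show ?thesis .
  qed
  then show ?thesis using i(1) unfolding W_def by blast
qed

section \<open>Existence of the spectral family\<close>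

text \<open>
  A description of the spectral family without measures: the family reduces \<open>x\<close>, with \<open>x \<le> t\<close> on the
  range and \<open>t \<le> x\<close> on the kernel of \<open>E t\<close>.
\<close>
definition spectral_char :: "(real \<Rightarrow> ('h::complex_hilbert_space \<Rightarrow>\<^sub>L 'h)) \<Rightarrow> ('h \<Rightarrow>\<^sub>L 'h) \<Rightarrow> bool" where
  "spectral_char E x \<longleftrightarrow>
    (\<forall>t. is_projection (E t)) \<and> (\<forall>s t v. s \<le> t \<longrightarrow> E s v = v \<longrightarrow> E t v = v) \<and>
    (\<forall>v s. ((\<lambda>t. E t v) \<longlongrightarrow> E s v) (at_right s)) \<and>
    (\<exists>a b. (\<forall>t<a. E t = 0) \<and> (\<forall>t\<ge>b. E t = id_blinfun)) \<and>
    (\<forall>t v. E t (x v) = x (E t v)) \<and>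
    (\<forall>t v. E t v = v \<longrightarrow> rip (x v) v \<le> t * (norm v)\<^sup>2) \<and>
    (\<forall>t v. E t v = 0 \<longrightarrow> t * (norm v)\<^sup>2 \<le> rip (x v) v)"

text \<open>
  The cuts at different \<open>t\<close> commute, as they lie in \<open>generated x\<close>. Monotonicity and right continuity both
  come from vectors \<open>z\<close> in the kernel of one cut and the range of another, on which the form of \<open>x\<close>
  would have to satisfy contradictory bounds unless \<open>z = 0\<close>.
\<close>
lemma spectral_char_exists:
  fixes x :: "'h::complex_hilbert_space \<Rightarrow>\<^sub>L 'h"
  assumes x: "hermitian x"
  shows "\<exists>E. spectral_char E x \<and> (\<forall>t. E t \<in> generated x) \<and>
    (\<forall>t v. E t v = 0 \<longrightarrow> v \<noteq> 0 \<longrightarrow> t * (norm v)\<^sup>2 < rip (x v) v)"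
proof -
  obtain E where Eg: "\<And>t. E t \<in> generated x" and P: "\<And>t. is_projection (E t)"
    and up: "\<And>t v. E t v = v \<Longrightarrow> rip (x v) v \<le> t * (norm v)\<^sup>2"
    and lo: "\<And>t v. E t v = 0 \<Longrightarrow> v \<noteq> 0 \<Longrightarrow> t * (norm v)\<^sup>2 < rip (x v) v"
    using spectral_cut[OF x] by metis
  have PP: "E t (E t v) = E t v" for t v using P by (simp add: is_projection_def)
  have mono: "E t v = v" if st: "s \<le> t" and v: "E s v = v" for s t v
  proof (rule ccontr)
    assume n: "E t v \<noteq> v"
    define z where "z = v - E t v"
    have "E t z = 0" by (simp add: z_def blinfun_simps PP)
    then have 1: "t * (norm z)\<^sup>2 < rip (x z) z" using lo n by (simp add: z_def)
    have "E s z = z" by (simp add: z_def blinfun_simps generated_commute2[OF Eg Eg, of s t] v)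
    then have "rip (x z) z \<le> s * (norm z)\<^sup>2" by (rule up)
    also have "\<dots> \<le> t * (norm z)\<^sup>2" by (intro mult_right_mono st) simp
    finally show False using 1 by simp
  qed
  have inter: "E s v = v" if v: "\<And>t. t > s \<Longrightarrow> E t v = v" for s v
  proof (rule ccontr)
    assume n: "E s v \<noteq> v"
    define z where "z = v - E s v"
    have "E s z = 0" by (simp add: z_def blinfun_simps PP)
    then have 1: "s * (norm z)\<^sup>2 < rip (x z) z" using lo n by (simp add: z_def)
    have "E t z = z" if "t > s" for t
      using v[OF that] mono[of s t "E s v"] that by (simp add: z_def blinfun_simps PP)
    then have 2: "rip (x z) z \<le> t * (norm z)\<^sup>2" if "t > s" for t using up that by blast
    have z0: "0 < (norm z)\<^sup>2" using n by (simp add: z_def)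
    have "rip (x z) z / (norm z)\<^sup>2 \<le> s"
    proof (rule dense_ge)
      fix t assume "s < t"
      from 2[OF this] z0 show "rip (x z) z / (norm z)\<^sup>2 \<le> t" by (simp only: pos_divide_le_eq)
    qed
    then have "rip (x z) z \<le> s * (norm z)\<^sup>2" using z0 by (simp only: pos_divide_le_eq)
    then show False using 1 by simp
  qed
  have rc: "((\<lambda>t. E t v) \<longlongrightarrow> E s v) (at_right s)" for v s
  proof (rule tendstoI)
    fix e :: real assume e: "0 < e"
    define W where "W = (\<Inter>i\<in>{s<..}. {v. E i v = v})"
    have W: "closed_csubspace W" unfolding W_def
      using P by (intro closed_csubspace_INT fixed_csubspace) (auto simp: is_projection_def)
    have "Proj W v = E s v"
    proof (rule Proj_eqI[OF closed_csubspaceD[OF W]])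
      have "E i (E s v) = E s v" if "s < i" for i using mono[OF less_imp_le[OF that] PP] .
      then show "E s v \<in> W" by (simp add: W_def)
      fix z assume "z \<in> W"
      then have "E i z = z" if "s < i" for i using that by (simp add: W_def)
      then have Ez: "E s z = z" by (rule inter)
      have "hermitian (E s)" using P by (simp add: is_projection_def)
      from hermitian_rip[OF this, of "v - E s v" z] have "rip (v - E s v) z = rip (E s (v - E s v)) z"
        unfolding Ez by simp
      then show "rip (v - E s v) z = 0" by (simp add: blinfun_simps PP rip_simps)
    qed
    moreover have "\<exists>i\<in>{s<..}. \<forall>j\<in>{s<..}. (\<forall>v. E j v = v \<longrightarrow> E i v = v) \<longrightarrow>
       norm (E j v - Proj W v) < e"
      unfolding W_def
    proof (rule proj_decreasing_limit[OF P _ _ e])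
      show "{s<..} \<noteq> {}" by (metis greaterThan_non_empty)
      fix i j assume ij: "i \<in> {s<..}" "j \<in> {s<..}"
      show "\<exists>k\<in>{s<..}. \<forall>v. E k v = v \<longrightarrow> E i v = v \<and> E j v = v"
      proof (intro bexI[of _ "min i j"] allI impI)
        fix v assume "E (min i j) v = v"
        then show "E i v = v \<and> E j v = v"
          using mono[of "min i j" i v] mono[of "min i j" j v] by simp
      qed (use ij in simp)
    qed
    ultimately obtain i where i: "i > s"
      "\<And>j. j > s \<Longrightarrow> (\<And>v. E j v = v \<Longrightarrow> E i v = v) \<Longrightarrow> norm (E j v - E s v) < e" by auto
    show "\<forall>\<^sub>F t in at_right s. dist (E t v) (E s v) < e"
      unfolding eventually_at_right_field dist_norm
      using i mono[of _ i] less_imp_le by blast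
  qed
  have b1: "E t = 0" if t: "t < - norm x" for t
  proof (rule blinfun_eqI)
    fix v
    have "rip (x (E t v)) (E t v) \<le> t * (norm (E t v))\<^sup>2" by (rule up[OF PP])
    then have "0 \<le> (norm x + t) * (norm (E t v))\<^sup>2"
      using form_bound[of x "E t v"] by (simp add: algebra_simps)
    then show "E t v = blinfun_apply 0 v" using t by (auto simp: zero_le_mult_iff)
  qed
  have b2: "E t = id_blinfun" if t: "norm x \<le> t" for t
  proof (rule blinfun_eqI, rule ccontr)
    fix v assume n: "E t v \<noteq> blinfun_apply id_blinfun v"
    define z where "z = v - E t v"
    have "E t z = 0" by (simp add: z_def blinfun_simps PP)
    then have "t * (norm z)\<^sup>2 < rip (x z) z" using lo n by (simp add: z_def)
    also have "\<dots> \<le> norm x * (norm z)\<^sup>2" using form_bound[of x z] by simp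
    also have "\<dots> \<le> t * (norm z)\<^sup>2" by (intro mult_right_mono t) simp
    finally show False by simp
  qed
  have "spectral_char E x"
    unfolding spectral_char_def
  proof (intro conjI allI impI)
    show "\<exists>a b. (\<forall>t<a. E t = 0) \<and> (\<forall>t\<ge>b. E t = id_blinfun)" using b1 b2 by blast
    show "E t (x v) = x (E t v)" for t v by (rule generated_commute2[OF Eg generated_self])
    show "t * (norm v)\<^sup>2 \<le> rip (x v) v" if "E t v = 0" for t v
      using lo[OF that] by (cases "v = 0") (auto simp: blinfun_simps rip_simps)
  qed (use P mono rc up in blast)+
  then show ?thesis using Eg lo by blast
qed


section \<open>Stieltjes integrals of monotone functions\<close>

text \<open>
  Stieltjes integrals \<open>i = \<integral> t dF(t)\<close> of nondecreasing functions that are constant outside a bounded interval and vanish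
  at minus infinity, described through the running integral \<open>I\<close>, whose increments lie between \<open>s dF\<close> and \<open>t dF\<close> on \<open>(s, t]\<close>. Both the measure theoretic
  integral and the operator form \<open>\<langle>x E(t) v, v\<rangle>\<close> are such running integrals, which is how they are
  identified.
\<close>
definition stieltjes_wit :: "(real \<Rightarrow> real) \<Rightarrow> real \<Rightarrow> (real \<Rightarrow> real) \<Rightarrow> real \<Rightarrow> real \<Rightarrow> bool" where
  "stieltjes_wit F i I a b \<longleftrightarrow>
     (\<forall>s t. s \<le> t \<longrightarrow> s * (F t - F s) \<le> I t - I s \<and> I t - I s \<le> t * (F t - F s)) \<and>
     (\<forall>t<a. I t = 0 \<and> F t = 0) \<and> (\<forall>t\<ge>b. I t = i)"

definition stieltjes :: "(real \<Rightarrow> real) \<Rightarrow> real \<Rightarrow> bool" where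
  "stieltjes F i \<longleftrightarrow> (\<exists>I a b. stieltjes_wit F i I a b)"

lemma stieltjes_witD:
  assumes "stieltjes_wit F i I a b"
  shows "s \<le> t \<Longrightarrow> s * (F t - F s) \<le> I t - I s" "s \<le> t \<Longrightarrow> I t - I s \<le> t * (F t - F s)"
    "t < a \<Longrightarrow> I t = 0" "t < a \<Longrightarrow> F t = 0" "b \<le> t \<Longrightarrow> I t = i"
  using assms unfolding stieltjes_wit_def by simp_all

lemma stieltjesI:
  assumes "\<And>s t. s \<le> t \<Longrightarrow> s * (F t - F s) \<le> I t - I s"
    "\<And>s t. s \<le> t \<Longrightarrow> I t - I s \<le> t * (F t - F s)"
    "\<And>t. t < a \<Longrightarrow> I t = 0" "\<And>t. t < a \<Longrightarrow> F t = 0" "\<And>t. b \<le> t \<Longrightarrow> I t = i"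
  shows "stieltjes F i"
  unfolding stieltjes_def stieltjes_wit_def using assms by blast

lemma stieltjes_add:
  assumes "stieltjes F i" "stieltjes G j" shows "stieltjes (\<lambda>t. F t + G t) (i + j)"
proof -
  from assms(1) obtain I a b where WI: "stieltjes_wit F i I a b" unfolding stieltjes_def by blast
  note I = stieltjes_witD[OF WI]
  from assms(2) obtain J c d where WJ: "stieltjes_wit G j J c d" unfolding stieltjes_def by blast
  note J = stieltjes_witD[OF WJ]
  show ?thesis
  proof (rule stieltjesI[of _ "\<lambda>t. I t + J t" "min a c" "max b d"])
    fix s t :: real assume st: "s \<le> t"
    show "s * (F t + G t - (F s + G s)) \<le> I t + J t - (I s + J s)"
      using I(1)[OF st] J(1)[OF st] by (simp add: algebra_simps)
    show "I t + J t - (I s + J s) \<le> t * (F t + G t - (F s + G s))"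
      using I(2)[OF st] J(2)[OF st] by (simp add: algebra_simps)
  qed (use I(3,4,5) J(3,4,5) in simp_all)
qed

text \<open>
  Integrating by parts, \<open>\<integral> t dF = \<beta> F(\<beta>) - \<integral> F\<close>, so a larger \<open>F\<close> has a smaller integral. The function
  \<open>K\<close> is the difference of \<open>- \<integral> G\<close> and \<open>- \<integral> F\<close> up to the given time. Its increments are at least \<open>- (t - s) (G t - G s)\<close>; over a
  subdivision into \<open>n\<close> equal steps these errors add up to \<open>O(1 / n)\<close>.
\<close>
lemma stieltjes_le:
  assumes F: "stieltjes F i" and G: "stieltjes G j" and le: "\<And>t. G t \<le> F t"
    and top: "\<And>t. c \<le> t \<Longrightarrow> F t = G t"
  shows "i \<le> j"
proof -
  from F obtain I a b where WI: "stieltjes_wit F i I a b" unfolding stieltjes_def by blast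
  note I = stieltjes_witD[OF WI]
  from G obtain J a' b' where WJ: "stieltjes_wit G j J a' b'" unfolding stieltjes_def by blast
  note J = stieltjes_witD[OF WJ]
  define \<alpha> where "\<alpha> = min a a' - 1"
  define \<beta> where "\<beta> = max (max b b') (max c \<alpha>)"
  have ab: "\<alpha> \<le> \<beta>" by (simp add: \<beta>_def)
  define K where "K t = (J t - t * G t) - (I t - t * F t)" for t
  have K: "- (t - s) * (G t - G s) \<le> K t - K s" if st: "s \<le> t" for s t
  proof -
    have "0 \<le> (t - s) * (F s - G s)" using st le[of s] by simp
    then show ?thesis using I(2)[OF st] J(1)[OF st] by (simp add: K_def algebra_simps)
  qed
  have "K \<alpha> = 0" "G \<alpha> = 0" using I(3,4) J(3,4) by (simp_all add: K_def \<alpha>_def)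
  have Kb: "K \<beta> = j - i" using I(5)[of \<beta>] J(5)[of \<beta>] top[of \<beta>] by (simp add: K_def \<beta>_def)
  \<comment> \<open>The bound for \<open>n + 1\<close> equal steps from \<open>\<alpha>\<close> to \<open>\<beta>\<close>.\<close>
  have *: "- ((\<beta> - \<alpha>) * G \<beta>) * (1 / real (Suc n)) \<le> j - i" for n
  proof -
    define d where "d = (\<beta> - \<alpha>) / real (Suc n)"
    have d0: "0 \<le> d" using ab by (simp add: d_def)
    have "- d * (G (\<alpha> + real k * d) - G \<alpha>) \<le> K (\<alpha> + real k * d) - K \<alpha>" for k
    proof (induction k)
      case (Suc k)
      have "\<alpha> + real k * d \<le> \<alpha> + real (Suc k) * d" using d0 by (simp add: algebra_simps)
      from K[OF this] have "- d * (G (\<alpha> + real (Suc k) * d) - G (\<alpha> + real k * d))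
          \<le> K (\<alpha> + real (Suc k) * d) - K (\<alpha> + real k * d)"
        by (simp add: algebra_simps)
      then show ?case using Suc by (simp add: algebra_simps)
    qed simp
    from this[of "Suc n"] have "- d * (G \<beta> - G \<alpha>) \<le> K \<beta> - K \<alpha>"
      by (simp add: d_def)
    then show ?thesis using \<open>K \<alpha> = 0\<close> \<open>G \<alpha> = 0\<close> Kb by (simp add: d_def)
  qed
  have "(\<lambda>n. - ((\<beta> - \<alpha>) * G \<beta>) * (1 / real (Suc n))) \<longlonglongrightarrow> - ((\<beta> - \<alpha>) * G \<beta>) * 0"
    by (intro tendsto_mult tendsto_const LIMSEQ_Suc[OF lim_1_over_n, unfolded comp_def])
  then have "- ((\<beta> - \<alpha>) * G \<beta>) * 0 \<le> j - i"
    by (rule LIMSEQ_le_const2) (use * in blast)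
  then show ?thesis by simp
qed

lemma stieltjes_unique: "stieltjes F i \<Longrightarrow> stieltjes F j \<Longrightarrow> i = j"
  using stieltjes_le[of F i F j] stieltjes_le[of F j F i] by force

lemma stieltjes_upper:
  assumes F: "stieltjes F i" and top: "\<And>u. t \<le> u \<Longrightarrow> F u = F t"
  shows "i \<le> t * F t"
proof -
  from F obtain I a b where WI: "stieltjes_wit F i I a b" unfolding stieltjes_def by blast
  note I = stieltjes_witD[OF WI]
  have "I (max b t) \<le> I t" using I(2)[of t "max b t"] top[of "max b t"] by simp
  moreover have "I t \<le> t * F t"
    using I(2)[of "min (a - 1) t" t] I(3)[of "min (a - 1) t"] I(4)[of "min (a - 1) t"] by simp
  ultimately show ?thesis using I(5)[of "max b t"] by simp
qed

lemma stieltjes_lower: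
  assumes F: "stieltjes F i" and bot: "\<And>s. s \<le> t \<Longrightarrow> F s = 0" and top: "\<And>u. c \<le> u \<Longrightarrow> F u = m"
  shows "t * m \<le> i"
proof -
  from F obtain I a b where WI: "stieltjes_wit F i I a b" unfolding stieltjes_def by blast
  note I = stieltjes_witD[OF WI]
  define s where "s = min (a - 1) t"
  have "0 \<le> I t"
    using I(1)[of s t] I(3)[of s] bot[of s] bot[of t] by (simp add: s_def)
  moreover define u where "u = max (max b c) t"
  have "t * (F u - F t) \<le> I u - I t" by (rule I(1)) (simp add: u_def)
  then have "t * m \<le> I u - I t" using top[of u] bot[of t] by (simp add: u_def)
  moreover have "I u = i" by (rule I(5)) (simp add: u_def)
  ultimately show ?thesis by simp
qed

lemma stieltjes_interval_measure:
  fixes F :: "real \<Rightarrow> real"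
  assumes mono: "\<And>x y. x \<le> y \<Longrightarrow> F x \<le> F y"
    and rc: "\<And>a. continuous (at_right a) F"
    and a: "\<And>t. t < a \<Longrightarrow> F t = 0" and b: "\<And>t. b \<le> t \<Longrightarrow> F t = m"
  shows "stieltjes F (\<integral>t. t \<partial>interval_measure F)"
proof -
  define \<mu> where "\<mu> = interval_measure F"
  have em: "emeasure \<mu> {s<..t} = F t - F s" if "s \<le> t" for s t
    unfolding \<mu>_def by (rule emeasure_interval_measure_Ioc[OF that mono rc])
  have [simp]: "sets \<mu> = sets borel" "space \<mu> = UNIV" by (simp_all add: \<mu>_def)
  have [measurable_cong]: "sets \<mu> = sets borel" by simp
  define c where "c = min (a - 1) (b - 1)"
  have low: "{..t} \<in> null_sets \<mu>" if "t < a" for t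
  proof -
    have "(\<Union>n. {t - real n<..t}) \<in> null_sets \<mu>"
    proof (rule null_sets_UN)
      fix n
      show "{t - real n<..t} \<in> null_sets \<mu>"
        using em[of "t - real n" t] a[of t] a[of "t - real n"] that by (simp add: null_sets_def)
    qed
    moreover have "(\<Union>n. {t - real n<..t}) = {..t}"
    proof (auto)
      fix u
      obtain n where "t - u < real n" using reals_Archimedean2 by blast
      then show "\<exists>n. t - real n < u" by (intro exI[of _ n]) simp
    qed
    ultimately show ?thesis by simp
  qed
  have high: "{t<..} \<in> null_sets \<mu>" if "b \<le> t" for t
  proof -
    have "(\<Union>n. {t<..t + real n}) \<in> null_sets \<mu>"
    proof (rule null_sets_UN)
      fix n
      show "{t<..t + real n} \<in> null_sets \<mu>"
        using em[of t "t + real n"] b[of t] b[of "t + real n"] that by (simp add: null_sets_def)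
    qed
    moreover have "(\<Union>n. {t<..t + real n}) = {t<..}"
    proof (auto)
      fix u
      obtain n where "u - t < real n" using reals_Archimedean2 by blast
      then show "\<exists>n. u \<le> t + real n" by (intro exI[of _ n]) simp
    qed
    ultimately show ?thesis by simp
  qed
  have AElow: "AE u in \<mu>. t < u" if "t < a" for t
    using AE_not_in[OF low[OF that]] by eventually_elim auto
  have AEhigh: "AE u in \<mu>. u \<le> t" if "b \<le> t" for t
    using AE_not_in[OF high[OF that]] by eventually_elim auto
  have "c < a" "c \<le> b" by (auto simp: c_def)
  have "finite_measure \<mu>"
  proof
    have "emeasure \<mu> UNIV \<le> emeasure \<mu> {..c} + emeasure \<mu> ({c<..b} \<union> {b<..})"
    proof -
      have "UNIV = {..c} \<union> ({c<..b} \<union> {b<..})" using \<open>c \<le> b\<close> by auto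
      then show ?thesis by (metis emeasure_subadditive \<open>sets \<mu> = sets borel\<close> atMost_borel
            greaterThanAtMost_borel greaterThan_borel sets.Un)
    qed
    also have "\<dots> \<le> emeasure \<mu> {..c} + (emeasure \<mu> {c<..b} + emeasure \<mu> {b<..})"
      by (intro add_left_mono emeasure_subadditive) auto
    also have "\<dots> = emeasure \<mu> {c<..b}"
      using low[OF \<open>c < a\<close>] high[of b] by (simp add: null_setsD1)
    also have "\<dots> < \<infinity>" using em[OF \<open>c \<le> b\<close>] by simp
    finally show "emeasure \<mu> (space \<mu>) \<noteq> \<infinity>" by simp
  qed
  then interpret finite_measure \<mu> .
  have AEb: "AE u in \<mu>. \<bar>u\<bar> \<le> \<bar>c\<bar> + \<bar>b\<bar>"
    using AElow[OF \<open>c < a\<close>] AEhigh[of b] by (auto elim: eventually_elim2)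
  have int: "integrable \<mu> (\<lambda>u. u * indicator S u)" if S: "S \<in> sets borel" for S :: "real set"
  proof (rule integrable_const_bound)
    show "AE u in \<mu>. norm (u * indicator S u) \<le> \<bar>c\<bar> + \<bar>b\<bar>"
      using AEb by eventually_elim (auto simp: indicator_def)
    show "(\<lambda>u. u * indicator S u) \<in> borel_measurable \<mu>" using S by measurable
  qed
  define I where "I t = (\<integral>u. u * indicator {..t} u \<partial>\<mu>)" for t
  have diff: "I t - I s = (\<integral>u. u * indicator {s<..t} u \<partial>\<mu>)" if "s \<le> t" for s t
  proof -
    have "(\<integral>u. u * indicator {s<..t} u \<partial>\<mu>) = (\<integral>u. u * indicator {..t} u - u * indicator {..s} u \<partial>\<mu>)"
      using that by (intro Bochner_Integration.integral_cong) (auto simp: indicator_def)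
    then show ?thesis
      unfolding I_def by (subst (asm) Bochner_Integration.integral_diff) (auto intro: int)
  qed
  have const: "(\<integral>u. r * indicator {s<..t} u \<partial>\<mu>) = r * (F t - F s)" if "s \<le> t" for r s t
    using em[OF that] mono[OF that] by (simp add: measure_def)
  have intc: "integrable \<mu> (\<lambda>u. r * indicator {s<..t} u)" for r s t :: real
    by (intro integrable_mult_right integrable_real_indicator) (auto simp: emeasure_eq_measure)
  show ?thesis
    unfolding \<mu>_def[symmetric]
  proof (rule stieltjesI[of F I a b])
    fix s t :: real assume st: "s \<le> t"
    show "s * (F t - F s) \<le> I t - I s"
      unfolding const[OF st, symmetric] diff[OF st]
      by (intro integral_mono intc int) (auto simp: indicator_def)
    show "I t - I s \<le> t * (F t - F s)"
      unfolding const[OF st, symmetric] diff[OF st]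
      by (intro integral_mono intc int) (auto simp: indicator_def)
  next
    show "I t = 0" if "t < a" for t
    proof -
      have "I t = (\<integral>u. 0 \<partial>\<mu>)"
        unfolding I_def
      proof (rule integral_cong_AE)
        show "AE u in \<mu>. u * indicator {..t} u = 0"
          using AElow[OF that] by eventually_elim simp
      qed auto
      then show ?thesis by simp
    qed
    show "I t = (\<integral>u. u \<partial>\<mu>)" if "b \<le> t" for t
      unfolding I_def
    proof (rule integral_cong_AE)
      show "AE u in \<mu>. u * indicator {..t} u = u"
        using AEhigh[OF that] by eventually_elim simp
    qed auto
  qed (rule a)
qed

section \<open>Characterization and uniqueness of the spectral family\<close>

lemma is_projectionD: "is_projection P \<Longrightarrow> hermitian P" "is_projection P \<Longrightarrow> P (P v) = P v" "is_projection P \<Longrightarrow> P \<in> bounded_ops"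
  by (auto simp: is_projection_def)

locale proj_family =
  fixes E :: "real \<Rightarrow> ('h::complex_hilbert_space \<Rightarrow>\<^sub>L 'h)"
  assumes P: "is_projection (E t)" and mono: "s \<le> t \<Longrightarrow> E s v = v \<Longrightarrow> E t v = v"
    and rc: "((\<lambda>t. E t v) \<longlongrightarrow> E s v) (at_right s)"
    and bounds: "\<exists>a b. (\<forall>t<a. E t = 0) \<and> (\<forall>t\<ge>b. E t = id_blinfun)"
begin

lemma PP: "E t (E t v) = E t v" using is_projectionD(2)[OF P] .

lemma le1: "s \<le> t \<Longrightarrow> E t (E s v) = E s v" using mono PP by blast

lemma le2: assumes "s \<le> t" shows "E s (E t v) = E s v"
proof (rule rip_eqI)
  fix y
  show "rip (E s (E t v)) y = rip (E s v) y"
    by (simp only: hermitian_rip[OF is_projectionD(1)[OF P]] le1[OF assms])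
qed

lemma commute: "E s (E t v) = E t (E s v)"
  using le1 le2 by (metis linear)

lemma form: "rip (E t v) v = (norm (E t v))\<^sup>2" using norm_is_projection[OF P] by simp

lemma form_mono: "s \<le> t \<Longrightarrow> rip (E s v) v \<le> rip (E t v) v"
  unfolding form using is_projection_norm_le[OF P, of s "E t v"] by (simp add: le2 power_mono)

lemma form_rc: "continuous (at_right s) (\<lambda>t. rip (E t v) v)"
  unfolding continuous_within by (intro rip.tendsto tendsto_const rc)

lemma fix_right: assumes "\<And>s. t < s \<Longrightarrow> E s v = v" shows "E t v = v"
proof -
  have "\<forall>\<^sub>F s in at_right t. E s v = v"
    using assms eventually_at_right_less[of t] by (auto elim: eventually_mono)
  then have "((\<lambda>s. E s v) \<longlongrightarrow> v) (at_right t)" by (simp add: tendsto_eventually)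
  from tendsto_unique[OF _ rc this] show ?thesis by simp
qed

lemma stieltjes_integral: "stieltjes (\<lambda>t. rip (E t v) v) (\<integral>t. t \<partial>interval_measure (\<lambda>t. rip (E t v) v))"
proof -
  obtain a b where "\<And>t. t < a \<Longrightarrow> E t = 0" "\<And>t. b \<le> t \<Longrightarrow> E t = id_blinfun" using bounds by blast
  then show ?thesis
    by (intro stieltjes_interval_measure[of _ a b "(norm v)\<^sup>2"])
       (auto simp: form_mono form_rc rip_simps rip_self)
qed

end

lemma spectral_char_proj_family: "spectral_char E x \<Longrightarrow> proj_family E"
  unfolding spectral_char_def proj_family_def by (elim conjE, intro conjI) assumption+

lemma spectral_resolution_iff:
  assumes x: "hermitian x"
  shows "spectral_resolution E x \<longleftrightarrow> proj_family E \<and> (\<forall>v. stieltjes (\<lambda>t. rip (E t v) v) (rip (x v) v))"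
proof -
  have c: "cinner (x v) v = complex_of_real i \<longleftrightarrow> rip (x v) v = i" for v i
    by (simp add: hermitian_cinner_real[OF x])
  have F: "(\<lambda>t. Re (cinner (E t v) v)) = (\<lambda>t. rip (E t v) v)" for v by (simp add: rip_def)
  have "spectral_resolution E x \<longleftrightarrow> proj_family E \<and>
     (\<forall>v. rip (x v) v = (\<integral>t. t \<partial>interval_measure (\<lambda>t. rip (E t v) v)))"
  proof (cases "\<forall>t. is_projection (E t)")
    case True
    then have "op_le (E s) (E t) \<longleftrightarrow> (\<forall>v. E s v = v \<longrightarrow> E t v = v)" for s t
      using op_le_proj_iff by blast
    then have A: "(\<forall>s t. s \<le> t \<longrightarrow> op_le (E s) (E t)) \<longleftrightarrow> (\<forall>s t v. s \<le> t \<longrightarrow> E s v = v \<longrightarrow> E t v = v)"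
      by auto
    show ?thesis
      unfolding spectral_resolution_def proj_family_def projection_op_iff F c A
      by (simp only: conj_assoc)
  next
    case False
    have "\<not> spectral_resolution E x"
      unfolding spectral_resolution_def projection_op_iff using False by (rule contrapos_nn) (erule conjunct1)
    moreover have "\<not> proj_family E"
      unfolding proj_family_def using False by (rule contrapos_nn) (elim conjE)
    ultimately show ?thesis by blast
  qed
  also have "\<dots> \<longleftrightarrow> proj_family E \<and> (\<forall>v. stieltjes (\<lambda>t. rip (E t v) v) (rip (x v) v))"
    using proj_family.stieltjes_integral stieltjes_unique by metis
  finally show ?thesis .
qed

text \<open>
  The running integral is \<open>\<langle>x E(t) v, v\<rangle>\<close>: its increment over \<open>(s, t]\<close> is the form of \<open>x\<close> at
  \<open>D = E(t) v - E(s) v\<close>, a vector on which \<open>s \<le> x \<le> t\<close>.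
\<close>
lemma spectral_char_resolution:
  assumes x: "hermitian x" and E: "spectral_char E x"
  shows "spectral_resolution E x"
proof -
  interpret proj_family E by (rule spectral_char_proj_family[OF E])
  have comm: "E t (x v) = x (E t v)" and up: "E t v = v \<Longrightarrow> rip (x v) v \<le> t * (norm v)\<^sup>2"
    and lo: "E t v = 0 \<Longrightarrow> t * (norm v)\<^sup>2 \<le> rip (x v) v" for t v
    using E unfolding spectral_char_def by blast+
  obtain a b where ab: "\<And>t. t < a \<Longrightarrow> E t = 0" "\<And>t. b \<le> t \<Longrightarrow> E t = id_blinfun" using bounds by blast
  have "stieltjes (\<lambda>t. rip (E t v) v) (rip (x v) v)" for v
  proof (rule stieltjesI[of _ "\<lambda>t. rip (x (E t v)) v" a b])
    fix s t :: real assume st: "s \<le> t"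
    define D where "D = E t v - E s v"
    have Dt: "E t D = D" by (simp add: D_def blinfun_simps PP le1[OF st])
    have Ds: "E s D = 0" by (simp add: D_def blinfun_simps PP le2[OF st])
    have key: "rip y v = rip y D" if "E t y = y" "E s y = 0" for y
    proof -
      have "rip y (E t v) = rip y v" using hermitian_rip[OF is_projectionD(1)[OF P[of t]], of y v] that by simp
      moreover have "rip y (E s v) = 0"
        using hermitian_rip[OF is_projectionD(1)[OF P[of s]], of y v] that by (simp add: rip_simps)
      ultimately show ?thesis by (simp add: D_def rip_simps)
    qed
    have "rip (E t v) v - rip (E s v) v = rip D v" by (simp add: D_def rip_simps)
    then have 1: "rip (E t v) v - rip (E s v) v = (norm D)\<^sup>2" using key[OF Dt Ds] by (simp add: rip_self)
    have "rip (x (E t v)) v - rip (x (E s v)) v = rip (x D) v" by (simp add: D_def blinfun_simps rip_simps)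
    also have "\<dots> = rip (x D) D" by (rule key) (simp_all add: comm Dt Ds blinfun_simps)
    finally have 2: "rip (x (E t v)) v - rip (x (E s v)) v = rip (x D) D" .
    show "s * (rip (E t v) v - rip (E s v) v) \<le> rip (x (E t v)) v - rip (x (E s v)) v"
      unfolding 1 2 by (rule lo[OF Ds])
    show "rip (x (E t v)) v - rip (x (E s v)) v \<le> t * (rip (E t v) v - rip (E s v) v)"
      unfolding 1 2 by (rule up[OF Dt])
  qed (simp_all add: ab blinfun_simps rip_simps)
  then show ?thesis using spectral_resolution_iff[OF x] proj_family_axioms by blast
qed

text \<open>
  The integral formula determines the form of \<open>x\<close>, and the distribution functions are additive over the
  decomposition of a vector by \<open>E t\<close>. Hence so is the form of \<open>x\<close>, which means that \<open>E t\<close> commutes with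
  \<open>x\<close>.
\<close>
lemma resolution_spectral_char:
  assumes x: "hermitian x" and E: "spectral_resolution E x"
  shows "spectral_char E x"
proof -
  have st: "stieltjes (\<lambda>t. rip (E t v) v) (rip (x v) v)" for v
    using E spectral_resolution_iff[OF x] by blast
  interpret proj_family E using E spectral_resolution_iff[OF x] by blast
  obtain a b where ab: "\<And>t. t < a \<Longrightarrow> E t = 0" "\<And>t. b \<le> t \<Longrightarrow> E t = id_blinfun" using bounds by blast
  have up: "rip (x v) v \<le> t * (norm v)\<^sup>2" if "E t v = v" for t v
    using stieltjes_upper[OF st[of v], of t] mono[OF _ that] that by (simp add: rip_self)
  have lo: "t * (norm v)\<^sup>2 \<le> rip (x v) v" if z: "E t v = 0" for t v
  proof (rule stieltjes_lower[OF st])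
    show "rip (E s v) v = 0" if "s \<le> t" for s using le2[OF that, of v] z by (simp add: blinfun_simps rip_simps)
    show "rip (E u v) v = (norm v)\<^sup>2" if "b \<le> u" for u using ab(2)[OF that] by (simp add: rip_self)
  qed
  have comm: "E t (x v) = x (E t v)" for t v
  proof -
    have orth: "rip (x u) w = 0" if u: "E t u = u" and w: "E t w = 0" for u w
    proof -
      have "rip (E s u) w = 0" "rip (E s w) u = 0" for s
      proof -
        have "rip (E s u) w = rip (E s (E t u)) w" by (simp only: u)
        also have "\<dots> = rip (E s u) (E t w)" by (simp only: commute[of s t] hermitian_rip[OF is_projectionD(1)[OF P[of t]]])
        finally show "rip (E s u) w = 0" by (simp add: w rip_simps)
        then show "rip (E s w) u = 0" using hermitian_rip[OF is_projectionD(1)[OF P[of s]]] rip_commute by metis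
      qed
      then have "rip (E s (u + w)) (u + w) = rip (E s u) u + rip (E s w) w" for s
        by (simp add: blinfun_simps rip_simps)
      then have "stieltjes (\<lambda>s. rip (E s (u + w)) (u + w)) (rip (x u) u + rip (x w) w)"
        using stieltjes_add[OF st[of u] st[of w]] by simp
      from stieltjes_unique[OF this st] have "rip (x u) w + rip (x w) u = 0"
        by (simp add: blinfun_simps rip_simps)
      moreover have "rip (x w) u = rip (x u) w" using hermitian_rip[OF x] rip_commute by metis
      ultimately show ?thesis by simp
    qed
    have xE: "E t (x (E t v)) = x (E t v)" for v
    proof -
      define w where "w = x (E t v) - E t (x (E t v))"
      have w: "E t w = 0" by (simp add: w_def blinfun_simps PP)
      have "rip (x (E t v)) w = 0" by (rule orth[OF PP w])
      moreover have "rip (E t (x (E t v))) w = 0"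
        using hermitian_rip[OF is_projectionD(1)[OF P[of t]], of "x (E t v)" w] w by (simp add: rip_simps)
      ultimately have "rip (x (E t v) - E t (x (E t v))) w = 0" by (simp only: rip.diff_left)
      then have "rip w w = 0" by (simp only: w_def[symmetric])
      then show ?thesis by (simp add: rip_self w_def)
    qed
    show ?thesis
    proof (rule rip_eqI)
      fix y
      have "rip (E t (x v)) y = rip v (x (E t y))"
        by (simp only: hermitian_rip[OF is_projectionD(1)[OF P]] hermitian_rip[OF x])
      also have "\<dots> = rip v (E t (x (E t y)))" by (simp only: xE)
      also have "\<dots> = rip (E t (x (E t v))) y"
        by (simp only: hermitian_rip[OF is_projectionD(1)[OF P]] hermitian_rip[OF x])
      finally show "rip (E t (x v)) y = rip (x (E t v)) y" by (simp only: xE)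
    qed
  qed
  show ?thesis unfolding spectral_char_def using P mono rc bounds comm up lo by blast
qed

text \<open>
  The operator \<open>U = (1 - E' s) E t\<close> satisfies the Sylvester identity
  \<open>(x' - c) U = U (x - c) + (1 - E' s) (x' - x) E t\<close>. For \<open>c\<close> below the spectrum of \<open>x\<close>, the left side
  has norm at least \<open>(s - c) \<parallel>U\<parallel>\<close>, whereas the first term on the right has norm at most
  \<open>(t - c) \<parallel>U\<parallel>\<close>.
\<close>
lemma spectral_gap_estimate:
  fixes x x' :: "'h::complex_hilbert_space \<Rightarrow>\<^sub>L 'h"
  assumes x: "hermitian x" and E: "spectral_char E x" and x': "hermitian x'" and E': "spectral_char E' x'" and ts: "t < s"
  shows "norm (E t v - E' s (E t v)) \<le> norm (x' - x) / (s - t) * norm v"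
proof -
  interpret E: proj_family E by (rule spectral_char_proj_family[OF E])
  interpret E': proj_family E' by (rule spectral_char_proj_family[OF E'])
  have comm: "E t (x v) = x (E t v)" and up: "E t v = v \<Longrightarrow> rip (x v) v \<le> t * (norm v)\<^sup>2" for t v
    using E unfolding spectral_char_def by blast+
  have comm': "E' t (x' v) = x' (E' t v)" and lo: "E' t v = 0 \<Longrightarrow> t * (norm v)\<^sup>2 \<le> rip (x' v) v" for t v
    using E' unfolding spectral_char_def by blast+
  \<comment> \<open>Any \<open>c \<le> t\<close> with \<open>c \<le> x\<close> would do.\<close>
  define c where "c = - (norm x + \<bar>t\<bar>)"
  have ct: "c \<le> t" unfolding c_def using norm_ge_zero[of x] by linarith
  define U where "U = (id_blinfun - E' s) o\<^sub>L E t"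
  have Uv: "U v = E t v - E' s (E t v)" for v by (simp add: U_def blinfun_simps)
  define T where "T = (x - c *\<^sub>R id_blinfun) o\<^sub>L E t"
  have Tv: "T v = x (E t v) - c *\<^sub>R E t v" for v by (simp add: T_def blinfun_simps)
  have Ts: "hermitian T" unfolding T_def
  proof (rule hermitian_compose)
    show "hermitian (x - c *\<^sub>R id_blinfun)" using x by blast
    show "(x - c *\<^sub>R id_blinfun) o\<^sub>L E t = E t o\<^sub>L (x - c *\<^sub>R id_blinfun)"
      by (rule blinfun_eqI) (simp add: blinfun_simps comm)
  qed (rule is_projectionD(1)[OF E.P])
  have nT: "norm (T v) \<le> (t - c) * norm v" for v
  proof (rule norm_le_form[OF Ts])
    fix v
    let ?w = "E t v"
    have "rip (T v) v = rip (T v) ?w"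
      using hermitian_rip[OF is_projectionD(1)[OF E.P], of t "T v" v] by (simp add: Tv blinfun_simps comm E.PP)
    then have f: "rip (T v) v = rip (x ?w) ?w - c * (norm ?w)\<^sup>2" by (simp add: Tv rip_simps rip_self)
    have "rip (x ?w) ?w \<le> t * (norm ?w)\<^sup>2" by (rule up[OF E.PP])
    then have u: "rip (T v) v \<le> (t - c) * (norm ?w)\<^sup>2" by (simp add: f algebra_simps)
    have "(norm ?w)\<^sup>2 \<le> (norm v)\<^sup>2" using is_projection_norm_le[OF E.P] by (simp add: power_mono)
    then have u2: "(t - c) * (norm ?w)\<^sup>2 \<le> (t - c) * (norm v)\<^sup>2" using ct by (intro mult_left_mono) auto
    have n: "0 \<le> \<bar>t\<bar> * (norm ?w)\<^sup>2" by simp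
    have "rip (T v) v = rip (x ?w) ?w + \<bar>t\<bar> * (norm ?w)\<^sup>2 + norm x * (norm ?w)\<^sup>2"
      unfolding f c_def by (simp add: algebra_simps)
    then have "0 \<le> rip (T v) v" using n form_bound[of x ?w] by linarith
    then show "\<bar>rip (T v) v\<bar> \<le> (t - c) * (norm v)\<^sup>2" using u u2 by simp
  qed (use ct in simp)
  have main: "(s - c) * norm (U v) \<le> (norm U * (t - c) + norm (x' - x)) * norm v" for v
  proof -
    let ?u = "U v" and ?y = "(x' - x) (E t v)"
    have z: "E' s ?u = 0" by (simp add: Uv blinfun_simps E'.PP)
    have "(s - c) * (norm ?u)\<^sup>2 \<le> rip (x' ?u - c *\<^sub>R ?u) ?u"
      using lo[OF z] by (simp add: rip_simps rip_self algebra_simps)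
    also have "\<dots> \<le> norm (x' ?u - c *\<^sub>R ?u) * norm ?u" using rip_Cauchy_Schwarz abs_le_D1 by blast
    finally have 1: "(s - c) * norm ?u \<le> norm (x' ?u - c *\<^sub>R ?u)"
      by (cases "?u = 0") (auto simp: power2_eq_square)
    have "x' ?u - c *\<^sub>R ?u = U (T v) + (?y - E' s ?y)"
      by (simp add: Uv Tv blinfun_simps comm comm' E.PP algebra_simps)
    then have "norm (x' ?u - c *\<^sub>R ?u) \<le> norm (U (T v)) + norm (?y - E' s ?y)"
      by (simp add: norm_triangle_ineq)
    also have "norm (U (T v)) \<le> norm U * ((t - c) * norm v)"
      by (rule order_trans[OF norm_blinfun]) (intro mult_left_mono nT norm_ge_zero)
    also have "norm (?y - E' s ?y) \<le> norm (x' - x) * norm v"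
    proof -
      have "norm (?y - E' s ?y) \<le> norm ?y"
        using is_projection_norm_le[OF is_projection_compl[OF E'.P[of s]], of ?y]
        by (simp only: blinfun.diff_left[of id_blinfun] blinfun_apply_id_blinfun)
      also have "\<dots> \<le> norm (x' - x) * norm (E t v)" by (rule norm_blinfun)
      also have "\<dots> \<le> norm (x' - x) * norm v" by (intro mult_left_mono is_projection_norm_le[OF E.P]) simp
      finally show ?thesis .
    qed
    finally show ?thesis using 1 by (simp add: algebra_simps)
  qed
  have sc: "0 < s - c" using ct ts by simp
  have "norm U \<le> (norm U * (t - c) + norm (x' - x)) / (s - c)"
  proof (rule norm_blinfun_bound)
    show "0 \<le> (norm U * (t - c) + norm (x' - x)) / (s - c)" using ct sc by simp
    show "norm (U v) \<le> (norm U * (t - c) + norm (x' - x)) / (s - c) * norm v" for v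
      using main[of v] sc by (simp add: pos_le_divide_eq mult.commute)
  qed
  then have "norm U * (s - t) \<le> norm (x' - x)" using sc by (simp add: pos_le_divide_eq algebra_simps)
  then have "norm U \<le> norm (x' - x) / (s - t)" using ts by (simp add: pos_le_divide_eq)
  then have "norm U * norm v \<le> norm (x' - x) / (s - t) * norm v" by (rule mult_right_mono) simp
  then show ?thesis using norm_blinfun[of U v] by (simp add: Uv)
qed

text \<open>
  The gap estimate for \<open>x' = x\<close> puts the range of \<open>E t\<close> inside that of \<open>E' s\<close> for all \<open>s > t\<close>.
\<close>
lemma spectral_char_unique:
  assumes x: "hermitian x" and E: "spectral_char E x" and E': "spectral_char E' x"
  shows "E = E'"
proof -
  have sub: "E' t v = v" if E: "spectral_char E x" and E': "spectral_char E' x" and v: "E t v = v" for E E' t v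
  proof -
    interpret E': proj_family E' by (rule spectral_char_proj_family[OF E'])
    show ?thesis
    proof (rule E'.fix_right)
      fix s assume "t < s"
      from spectral_gap_estimate[OF x E x E' this, of v] show "E' s v = v" by (simp add: v)
    qed
  qed
  interpret E: proj_family E by (rule spectral_char_proj_family[OF E])
  interpret E': proj_family E' by (rule spectral_char_proj_family[OF E'])
  show ?thesis
  proof
    fix t
    show "E t = E' t"
      by (rule is_projection_antisym[OF E.P E'.P])
         (use sub[OF E E'] sub[OF E' E] in \<open>simp_all add: op_le_proj_iff[OF E.P E'.P] op_le_proj_iff[OF E'.P E.P]\<close>)
  qed
qed

lemma
  assumes x: "hermitian x"
  shows spectral_family_char: "spectral_char (spectral_family x) x"
    and spectral_family_generated: "spectral_family x t \<in> generated x"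
    and spectral_family_strict: "spectral_family x t v = 0 \<Longrightarrow> v \<noteq> 0 \<Longrightarrow> t * (norm v)\<^sup>2 < rip (x v) v"
proof -
  obtain E where E: "spectral_char E x" "\<And>t. E t \<in> generated x"
    "\<And>t v. E t v = 0 \<Longrightarrow> v \<noteq> 0 \<Longrightarrow> t * (norm v)\<^sup>2 < rip (x v) v"
    using spectral_char_exists[OF x] by blast
  have "spectral_family x = E"
    unfolding spectral_family_def
    using spectral_char_resolution[OF x E(1)] resolution_spectral_char[OF x] spectral_char_unique[OF x _ E(1)]
    by (intro the_equality) blast+
  then show "spectral_char (spectral_family x) x" "spectral_family x t \<in> generated x"
    "spectral_family x t v = 0 \<Longrightarrow> v \<noteq> 0 \<Longrightarrow> t * (norm v)\<^sup>2 < rip (x v) v"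
    using E by simp_all
qed


section \<open>The spectral order\<close>

lemma spectral_family_proj_family: "hermitian x \<Longrightarrow> proj_family (spectral_family x)"
  by (rule spectral_char_proj_family[OF spectral_family_char])

lemma
  assumes x: "hermitian x"
  shows spectral_family_commute: "spectral_family x t (x v) = x (spectral_family x t v)"
    and spectral_family_upper: "spectral_family x t v = v \<Longrightarrow> rip (x v) v \<le> t * (norm v)\<^sup>2"
  using spectral_family_char[OF x] unfolding spectral_char_def by blast+

lemma spectral_family_is_projection: "hermitian x \<Longrightarrow> is_projection (spectral_family x t)"
  by (rule proj_family.P[OF spectral_family_proj_family])

lemma spectral_family_idem: "hermitian x \<Longrightarrow> spectral_family x t (spectral_family x t v) = spectral_family x t v"
  by (rule proj_family.PP[OF spectral_family_proj_family])

lemma spectral_family_stieltjes: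
  assumes x: "hermitian x"
  shows "stieltjes (\<lambda>t. rip (spectral_family x t v) v) (rip (x v) v)"
  using spectral_char_resolution[OF x spectral_family_char[OF x]] spectral_resolution_iff[OF x] by blast

lemma spectral_le_iff:
  assumes "hermitian x" "hermitian y"
  shows "spectral_le x y \<longleftrightarrow> (\<forall>t v. spectral_family y t v = v \<longrightarrow> spectral_family x t v = v)"
  unfolding spectral_le_def
  using op_le_proj_iff[OF spectral_family_is_projection[OF assms(2)] spectral_family_is_projection[OF assms(1)]]
  by blast

lemma spectral_leD:
  "spectral_le x y \<Longrightarrow> hermitian x \<Longrightarrow> hermitian y \<Longrightarrow> spectral_family y t v = v \<Longrightarrow> spectral_family x t v = v"
  using spectral_le_iff by blast

lemma spectral_le_trans:
  "spectral_le x y \<Longrightarrow> spectral_le y z \<Longrightarrow> hermitian x \<Longrightarrow> hermitian y \<Longrightarrow> hermitian z \<Longrightarrow> spectral_le x z"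
  using spectral_le_iff by metis

lemma spectral_le_imp_op_le:
  assumes x: "hermitian x" and y: "hermitian y" and le: "spectral_le x y"
  shows "op_le x y"
  unfolding op_le_iff[OF x y]
proof
  fix v
  interpret X: proj_family "spectral_family x" by (rule spectral_family_proj_family[OF x])
  interpret Y: proj_family "spectral_family y" by (rule spectral_family_proj_family[OF y])
  obtain b b' where b: "\<And>t. b \<le> t \<Longrightarrow> spectral_family x t = id_blinfun"
    "\<And>t. b' \<le> t \<Longrightarrow> spectral_family y t = id_blinfun"
    using X.bounds Y.bounds by blast
  show "rip (x v) v \<le> rip (y v) v"
  proof (rule stieltjes_le[OF spectral_family_stieltjes[OF x] spectral_family_stieltjes[OF y]])
    fix t
    have "op_le (spectral_family y t) (spectral_family x t)" using le by (simp add: spectral_le_def)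
    then show "rip (spectral_family y t v) v \<le> rip (spectral_family x t v) v"
      using op_le_iff[OF is_projectionD(1)[OF Y.P] is_projectionD(1)[OF X.P]] by blast
  next
    fix t assume "max b b' \<le> t"
    then show "rip (spectral_family x t v) v = rip (spectral_family y t v) v" by (simp add: b)
  qed
qed

lemma spectral_le_antisym:
  "hermitian x \<Longrightarrow> hermitian y \<Longrightarrow> spectral_le x y \<Longrightarrow> spectral_le y x \<Longrightarrow> x = y"
  by (intro op_le_antisym spectral_le_imp_op_le)

lemma op_le_imp_spectral_le:
  assumes x: "hermitian x" and y: "hermitian y" and le: "op_le x y" and comm: "\<And>v. x (y v) = y (x v)"
  shows "spectral_le x y"
  unfolding spectral_le_iff[OF x y]
proof (intro allI impI)
  fix t v assume v: "spectral_family y t v = v"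
  interpret X: proj_family "spectral_family x" by (rule spectral_family_proj_family[OF x])
  show "spectral_family x t v = v"
  proof (rule X.fix_right)
    fix s assume ts: "t < s"
    have "spectral_family y t (x u) = x (spectral_family y t u)" for u
      by (rule generated_commute[OF spectral_family_generated[OF y]]) (simp add: comm)
    then have c: "spectral_family x s (spectral_family y t u) = spectral_family y t (spectral_family x s u)" for u
      by (intro generated_commute[OF spectral_family_generated[OF x]]) simp
    define w where "w = v - spectral_family x s v"
    have w1: "spectral_family y t w = w" by (simp add: w_def blinfun_simps c[symmetric] v)
    have w2: "spectral_family x s w = 0" by (simp add: w_def blinfun_simps X.PP)
    have "w = 0"
    proof (rule ccontr)
      assume "w \<noteq> 0"
      then have "s * (norm w)\<^sup>2 < rip (x w) w" by (rule spectral_family_strict[OF x w2])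
      also have "\<dots> \<le> rip (y w) w" using le op_le_iff[OF x y] by blast
      also have "\<dots> \<le> t * (norm w)\<^sup>2" by (rule spectral_family_upper[OF y w1])
      also have "\<dots> \<le> s * (norm w)\<^sup>2" using ts by (intro mult_right_mono) auto
      finally show False by simp
    qed
    then show "spectral_family x s v = v" by (simp add: w_def)
  qed
qed

lemma null_of_small:
  fixes a :: "'h::complex_hilbert_space"
  assumes "0 \<le> K" and "\<And>e. 0 < e \<Longrightarrow> norm a \<le> e * K"
  shows "a = 0"
proof (rule ccontr)
  assume "a \<noteq> 0"
  then have n: "0 < norm a" by simp
  define e where "e = norm a / (2 * (K + 1))"
  have "0 < e" using n assms(1) by (simp add: e_def)
  from assms(2)[OF this] have "norm a \<le> norm a * (K / (2 * (K + 1)))" by (simp add: e_def)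
  also have "\<dots> < norm a * 1" using n assms(1) by (intro mult_strict_left_mono) (simp_all add: field_simps)
  finally show False by simp
qed

text \<open>
  For a good approximation \<open>x'\<close> of \<open>x\<close>, the gap estimate makes \<open>v - E' s v\<close> small for \<open>v\<close> in the range of
  \<open>E t\<close>, where \<open>t < s\<close>; the range of \<open>E' s\<close> is contained in that of the spectral projection of \<open>y\<close>.
\<close>
lemma spectral_le_limit_right:
  assumes x: "hermitian x" and y: "hermitian y"
    and lim: "\<And>e. 0 < e \<Longrightarrow> \<exists>x'. hermitian x' \<and> norm (x' - x) < e \<and> spectral_le y x'"
  shows "spectral_le y x"
  unfolding spectral_le_iff[OF y x]
proof (intro allI impI)
  fix t v assume v: "spectral_family x t v = v"
  interpret Y: proj_family "spectral_family y" by (rule spectral_family_proj_family[OF y])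
  show "spectral_family y t v = v"
  proof (rule Y.fix_right)
    fix s assume ts: "t < s"
    have "v - spectral_family y s v = 0"
    proof (rule null_of_small[of "norm v"])
      fix e :: real assume e: "0 < e"
      then obtain x' where x': "hermitian x'" "norm (x' - x) < e * (s - t)" "spectral_le y x'"
        using lim[of "e * (s - t)"] ts by auto
      have px: "is_projection (spectral_family x' s)" by (rule spectral_family_is_projection[OF x'(1)])
      have "op_le (spectral_family x' s) (spectral_family y s)"
        using x'(3) by (simp add: spectral_le_def)
      then have "rip (spectral_family x' s v) v \<le> rip (spectral_family y s v) v"
        using op_le_iff[OF is_projectionD(1)[OF px] is_projectionD(1)[OF Y.P]] by blast
      then have "(norm (v - spectral_family y s v))\<^sup>2 \<le> (norm (v - spectral_family x' s v))\<^sup>2"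
        using is_projection_pythagoras[OF px, of v] is_projection_pythagoras[OF Y.P, of v s] norm_is_projection[OF px, of v] Y.form[of s v]
        by linarith
      then have "norm (v - spectral_family y s v) \<le> norm (v - spectral_family x' s v)"
        by (rule power2_le_imp_le) simp
      also have "\<dots> \<le> norm (x' - x) / (s - t) * norm v"
        using spectral_gap_estimate[OF x spectral_family_char[OF x] x'(1) spectral_family_char[OF x'(1)] ts, of v]
        by (simp add: v)
      also have "\<dots> \<le> e * norm v"
        using x'(2) ts by (intro mult_right_mono) (simp_all add: pos_divide_le_eq)
      finally show "norm (v - spectral_family y s v) \<le> e * norm v" .
    qed simp
    then show "spectral_family y s v = v" by simp
  qed
qed

lemma spectral_le_limit_left:
  assumes x: "hermitian x" and y: "hermitian y"
    and lim: "\<And>e. 0 < e \<Longrightarrow> \<exists>x'. hermitian x' \<and> norm (x' - x) < e \<and> spectral_le x' y"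
  shows "spectral_le x y"
  unfolding spectral_le_iff[OF x y]
proof (intro allI impI)
  fix t v assume v: "spectral_family y t v = v"
  interpret X: proj_family "spectral_family x" by (rule spectral_family_proj_family[OF x])
  show "spectral_family x t v = v"
  proof (rule X.fix_right)
    fix s assume ts: "t < s"
    have "v - spectral_family x s v = 0"
    proof (rule null_of_small[of "norm v"])
      fix e :: real assume e: "0 < e"
      then obtain x' where x': "hermitian x'" "norm (x' - x) < e * (s - t)" "spectral_le x' y"
        using lim[of "e * (s - t)"] ts by auto
      have "spectral_family x' t v = v" by (rule spectral_leD[OF x'(3,1) y v])
      then have "norm (v - spectral_family x s v) \<le> norm (x - x') / (s - t) * norm v"
        using spectral_gap_estimate[OF x'(1) spectral_family_char[OF x'(1)] x spectral_family_char[OF x] ts, of v]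
        by simp
      also have "\<dots> \<le> e * norm v"
        using x'(2) ts by (intro mult_right_mono) (simp_all add: pos_divide_le_eq norm_minus_commute)
      finally show "norm (v - spectral_family x s v) \<le> e * norm v" .
    qed simp
    then show "spectral_family x s v = v" by simp
  qed
qed

text \<open>
  Eigenvectors allow to compare spectral families of sums of orthogonal projections without computing
  these families.
\<close>
lemma eigen_fixed:
  assumes x: "hermitian x" and v: "x v = k *\<^sub>R v" and le: "k \<le> s"
  shows "spectral_family x s v = v"
proof (rule ccontr)
  assume n: "spectral_family x s v \<noteq> v"
  define w where "w = v - spectral_family x s v"
  have xw: "x w = k *\<^sub>R w"
    by (simp add: w_def blinfun_simps spectral_family_commute[OF x, symmetric] v scaleR_diff_right)
  have "spectral_family x s w = 0" by (simp add: w_def blinfun_simps spectral_family_idem[OF x])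
  moreover have "w \<noteq> 0" using n by (simp add: w_def)
  ultimately have "s * (norm w)\<^sup>2 < rip (x w) w" by (rule spectral_family_strict[OF x])
  also have "\<dots> = k * (norm w)\<^sup>2" by (simp add: xw rip_simps rip_self)
  also have "\<dots> \<le> s * (norm w)\<^sup>2" using le by (intro mult_right_mono) auto
  finally show False by simp
qed

lemma eigen_killed:
  assumes x: "hermitian x" and v: "x v = k *\<^sub>R v" and less: "s < k"
  shows "spectral_family x s v = 0"
proof -
  define w where "w = spectral_family x s v"
  have xw: "x w = k *\<^sub>R w" by (simp add: w_def blinfun_simps spectral_family_commute[OF x, symmetric] v)
  have "rip (x w) w \<le> s * (norm w)\<^sup>2"
    by (rule spectral_family_upper[OF x]) (simp add: w_def spectral_family_idem[OF x])
  then have "(k - s) * (norm w)\<^sup>2 \<le> 0" by (simp add: xw rip_simps rip_self algebra_simps)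
  then show ?thesis using less by (simp add: mult_le_0_iff w_def)
qed

lemma spectral_family_one:
  assumes x: "hermitian x" and le: "\<And>v. rip (x v) v \<le> s * (norm v)\<^sup>2"
  shows "spectral_family x s v = v"
proof (rule ccontr)
  assume n: "spectral_family x s v \<noteq> v"
  define w where "w = v - spectral_family x s v"
  have "spectral_family x s w = 0" by (simp add: w_def blinfun_simps spectral_family_idem[OF x])
  moreover have "w \<noteq> 0" using n by (simp add: w_def)
  ultimately have "s * (norm w)\<^sup>2 < rip (x w) w" by (rule spectral_family_strict[OF x])
  then show False using le[of w] by simp
qed

section \<open>Spectral projections in a von Neumann algebra\<close>

lemma strong_operator_closedI:
  fixes T :: "'h::complex_hilbert_space \<Rightarrow>\<^sub>L 'h"
  assumes cl: "closedin strong_operator_topology M"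
    and ap: "\<And>A e. finite A \<Longrightarrow> 0 < e \<Longrightarrow> \<exists>S\<in>M. \<forall>v\<in>A. norm (S v - T v) < e"
  shows "T \<in> M"
proof (rule ccontr)
  assume "T \<notin> M"
  have "openin strong_operator_topology (- M)"
    using cl by (simp add: closedin_def strong_operator_topology_topspace Compl_eq_Diff_UNIV)
  then obtain V where V: "open V" "- M = blinfun_apply -` V"
    by (auto simp: strong_operator_topology_def openin_pullback_topology)
  have TV: "blinfun_apply T \<in> V" using V(2) \<open>T \<notin> M\<close> by auto
  have "openin (product_topology (\<lambda>_::'h. euclidean :: 'h topology) UNIV) V"
    using V(1) by (simp add: open_fun_def)
  from product_topology_open_contains_basis[OF this TV] obtain X where
    X: "blinfun_apply T \<in> (\<Pi>\<^sub>E i\<in>UNIV. X i)" "\<And>i. open (X i)" "finite {i. X i \<noteq> UNIV}"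
      "(\<Pi>\<^sub>E i\<in>UNIV. X i) \<subseteq> V" by (auto simp: open_openin[symmetric])
  define A where "A = {i. X i \<noteq> UNIV}"
  have "\<exists>e>0. ball (T i) e \<subseteq> X i" for i
    using X(1) X(2)[of i] open_contains_ball by (metis PiE_mem UNIV_I)
  then obtain e where e: "\<And>i. 0 < e i" "\<And>i. ball (T i) (e i) \<subseteq> X i" by metis
  define d where "d = Min (insert 1 (e ` A))"
  have fin: "finite A" using X(3) by (simp add: A_def)
  have d: "0 < d" "\<And>i. i \<in> A \<Longrightarrow> d \<le> e i" using fin e(1) by (auto simp: d_def)
  obtain S where S: "S \<in> M" "\<And>i. i \<in> A \<Longrightarrow> norm (S i - T i) < d" using ap[OF fin d(1)] by blast
  have "S i \<in> X i" for i
  proof (cases "i \<in> A")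
    case True
    then have "S i \<in> ball (T i) (e i)" using S(2)[OF True] d(2)[OF True]
      by (simp add: dist_norm norm_minus_commute)
    then show ?thesis using e(2) by blast
  qed (simp add: A_def)
  then have "blinfun_apply S \<in> V" using X(4) by (auto simp: PiE_def)
  then show False using V(2) S(1) by auto
qed

lemma strong_operator_closed_seq:
  fixes T :: "'h::complex_hilbert_space \<Rightarrow>\<^sub>L 'h"
  assumes cl: "closedin strong_operator_topology M" and f: "\<And>n. f n \<in> M"
    and lim: "\<And>v. (\<lambda>n. blinfun_apply (f n) v) \<longlonglongrightarrow> T v"
  shows "T \<in> M"
proof (rule strong_operator_closedI[OF cl])
  fix A :: "'h set" and e :: real assume A: "finite A" and e: "0 < e"
  have "\<forall>\<^sub>F n in sequentially. norm (f n v - T v) < e" for v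
    using tendstoD[OF lim e, of v] by (simp add: dist_norm)
  then have "\<forall>\<^sub>F n in sequentially. \<forall>v\<in>A. norm (f n v - T v) < e"
    using A by (simp add: eventually_ball_finite)
  then obtain n where "\<forall>v\<in>A. norm (f n v - T v) < e" by (auto simp: eventually_sequentially)
  then show "\<exists>S\<in>M. \<forall>v\<in>A. norm (S v - T v) < e" using f by blast
qed

lemma von_neumann_algebraD:
  assumes "von_neumann_algebra M"
  shows "T \<in> M \<Longrightarrow> T \<in> bounded_ops" "S \<in> M \<Longrightarrow> T \<in> M \<Longrightarrow> S + T \<in> M"
    "T \<in> M \<Longrightarrow> scaleC_op c T \<in> M" "S \<in> M \<Longrightarrow> T \<in> M \<Longrightarrow> S o\<^sub>L T \<in> M"
    "T \<in> M \<Longrightarrow> adj_op T \<in> M" "closedin strong_operator_topology M" "0 \<in> M"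
  using assms unfolding von_neumann_algebra_def cstar_subalgebra_def by blast+

lemma scaleC_op_of_real: "scaleC_op (complex_of_real r) T = r *\<^sub>R T"
  by (rule blinfun_eqI) (simp add: scaleC_op.rep_eq scaleC_of_real blinfun.scaleR_left)

lemma vn_scaleR: "von_neumann_algebra M \<Longrightarrow> T \<in> M \<Longrightarrow> r *\<^sub>R T \<in> M"
  using von_neumann_algebraD(3)[of M T "complex_of_real r"] by (simp add: scaleC_op_of_real)

lemma vn_diff: "von_neumann_algebra M \<Longrightarrow> S \<in> M \<Longrightarrow> T \<in> M \<Longrightarrow> S - T \<in> M"
  using von_neumann_algebraD(2)[of M S "(-1) *\<^sub>R T"] vn_scaleR[of M T "-1"] by simp

lemma self_adjoint_part_iff:
  "von_neumann_algebra M \<Longrightarrow> T \<in> self_adjoint_part M \<longleftrightarrow> T \<in> M \<and> hermitian T"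
  using von_neumann_algebraD(1) by (auto simp: self_adjoint_part_def hermitian_iff)

text \<open>
  The powers of \<open>1 - w\<^sup>2\<close> need not lie in \<open>M\<close>, which may lack the identity of \<open>B(H)\<close>, but their differences
  to the identity do.
\<close>
lemma vn_range_projection:
  assumes M: "von_neumann_algebra M" and w: "w \<in> M" "hermitian w"
  shows "id_blinfun - Proj {v. blinfun_apply w v = 0} \<in> M"
proof -
  define u where "u = (1 / (norm w + 1)) *\<^sub>R w"
  have n0: "0 < norm w + 1" by (simp add: add_nonneg_pos)
  have u: "u \<in> M" "hermitian u" unfolding u_def using vn_scaleR[OF M w(1)] w(2) by auto
  have contr: "norm (u v) \<le> norm v" for v
  proof -
    have "norm (w v) \<le> (norm w + 1) * norm v"
      using norm_blinfun[of w v] norm_ge_zero[of v] unfolding distrib_right mult_1_left by linarith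
    then show ?thesis using n0 by (simp add: u_def blinfun.scaleR_left pos_divide_le_eq mult.commute)
  qed
  have ker: "{v. blinfun_apply u v = 0} = {v. w v = 0}"
    using n0 by (auto simp: u_def blinfun.scaleR_left)
  define N where "N = {T. id_blinfun - T \<in> M}"
  have "op_power (id_blinfun - (u o\<^sub>L u)) n \<in> N" for n
  proof (rule op_power_in)
    show "id_blinfun \<in> N" using von_neumann_algebraD(7)[OF M] by (simp add: N_def)
    show "id_blinfun - (u o\<^sub>L u) \<in> N" using von_neumann_algebraD(4)[OF M u(1) u(1)] by (simp add: N_def)
    fix S T assume ST: "S \<in> N" "T \<in> N"
    then have ST': "id_blinfun - S \<in> M" "id_blinfun - T \<in> M" by (simp_all add: N_def)
    have "id_blinfun - (S o\<^sub>L T)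
        = (id_blinfun - S) + (id_blinfun - T) - ((id_blinfun - S) o\<^sub>L (id_blinfun - T))"
      by (rule blinfun_eqI) (simp add: blinfun_simps)
    also have "\<dots> \<in> M" by (rule vn_diff[OF M von_neumann_algebraD(2)[OF M ST'] von_neumann_algebraD(4)[OF M ST']])
    finally show "S o\<^sub>L T \<in> N" by (simp add: N_def)
  qed
  then have f: "id_blinfun - op_power (id_blinfun - (u o\<^sub>L u)) (2 * n) \<in> M" for n by (simp add: N_def)
  show ?thesis
  proof (rule strong_operator_closed_seq[OF von_neumann_algebraD(6)[OF M] f])
    fix v
    have "(\<lambda>n. v - op_power (id_blinfun - (u o\<^sub>L u)) (2 * n) v) \<longlonglongrightarrow> v - Proj {v. w v = 0} v"
      using kernel_projection_limit[OF u(2) contr, of v] unfolding ker by (rule tendsto_diff[OF tendsto_const])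
    then show "(\<lambda>n. blinfun_apply (id_blinfun - op_power (id_blinfun - (u o\<^sub>L u)) (2 * n)) v)
        \<longlonglongrightarrow> (id_blinfun - Proj {v. w v = 0}) v"
      by (simp add: blinfun.diff_left)
  qed
qed

lemma Proj_range:
  assumes P: "is_projection P" shows "Proj {v. blinfun_apply P v = v} = P"
proof (rule blinfun_eqI, rule Proj_eqI[OF closed_csubspaceD[OF fixed_csubspace[OF is_projectionD(3)[OF P]]]])
  fix x
  show "P x \<in> {v. P v = v}" using is_projectionD(2)[OF P] by simp
  fix v assume "v \<in> {v. P v = v}"
  then have v: "P v = v" by simp
  have "rip (P x) v = rip x v" using hermitian_rip[OF is_projectionD(1)[OF P], of x v] v by simp
  then show "rip (x - P x) v = 0" by (simp add: rip_simps)
qed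

lemma Proj_kernel:
  assumes P: "is_projection P" shows "Proj {v. blinfun_apply P v = 0} = id_blinfun - P"
proof -
  have "{v. blinfun_apply P v = 0} = {v. (id_blinfun - P) v = v}" by (auto simp: blinfun_simps)
  then show ?thesis using Proj_range[OF is_projection_compl[OF P]] by simp
qed

text \<open>
  If \<open>M\<close> lacks the identity of \<open>B(H)\<close>, the algebra generated by \<open>x\<close> and the identity is not contained in
  \<open>M\<close>; its elements are still left multipliers of \<open>M\<close>, and left multipliers form a strongly closed algebra.
\<close>
lemma vn_spectral_multiplier:
  fixes M :: "('h::complex_hilbert_space \<Rightarrow>\<^sub>L 'h) set"
  assumes M: "von_neumann_algebra M" and x: "x \<in> M" "T \<in> generated x" "m \<in> M"
  shows "T o\<^sub>L m \<in> M"
proof -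
  have "strong_alg {T. \<forall>m\<in>M. T o\<^sub>L m \<in> M}"
  proof (rule strong_algI)
    fix f T assume f: "\<And>n. f n \<in> {T. \<forall>m\<in>M. T o\<^sub>L m \<in> M}"
      and T: "\<And>v. (\<lambda>n. blinfun_apply (f n) v) \<longlonglongrightarrow> blinfun_apply T v"
    have "T o\<^sub>L m \<in> M" if "m \<in> M" for m
    proof (rule strong_operator_closed_seq[OF von_neumann_algebraD(6)[OF M]])
      show "f n o\<^sub>L m \<in> M" for n using f that by blast
      show "(\<lambda>n. blinfun_apply (f n o\<^sub>L m) v) \<longlonglongrightarrow> (T o\<^sub>L m) v" for v using T by simp
    qed
    then show "T \<in> {T. \<forall>m\<in>M. T o\<^sub>L m \<in> M}" by blast
  next
    have "id_blinfun o\<^sub>L m = m" for m :: "'h \<Rightarrow>\<^sub>L 'h" by (rule blinfun_eqI) simp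
    then show "id_blinfun \<in> {T. \<forall>m\<in>M. T o\<^sub>L m \<in> M}" by simp
  next
    fix S T assume ST: "S \<in> {T. \<forall>m\<in>M. T o\<^sub>L m \<in> M}" "T \<in> {T. \<forall>m\<in>M. T o\<^sub>L m \<in> M}"
    have "(S + T) o\<^sub>L m = (S o\<^sub>L m) + (T o\<^sub>L m)" for m :: "'h \<Rightarrow>\<^sub>L 'h"
      by (rule blinfun_eqI) (simp add: blinfun_simps)
    then show "S + T \<in> {T. \<forall>m\<in>M. T o\<^sub>L m \<in> M}" using ST von_neumann_algebraD(2)[OF M] by simp
    have "(S o\<^sub>L T) o\<^sub>L m = S o\<^sub>L (T o\<^sub>L m)" for m :: "'h \<Rightarrow>\<^sub>L 'h" by (rule blinfun_eqI) simp
    then show "S o\<^sub>L T \<in> {T. \<forall>m\<in>M. T o\<^sub>L m \<in> M}" using ST by simp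
  next
    fix r T assume T: "T \<in> {T. \<forall>m\<in>M. T o\<^sub>L m \<in> M}"
    have "(r *\<^sub>R T) o\<^sub>L m = r *\<^sub>R (T o\<^sub>L m)" for m :: "'h \<Rightarrow>\<^sub>L 'h"
      by (rule blinfun_eqI) (simp add: blinfun_simps)
    then show "r *\<^sub>R T \<in> {T. \<forall>m\<in>M. T o\<^sub>L m \<in> M}" using T vn_scaleR[OF M] by simp
  qed
  moreover have "x \<in> {T. \<forall>m\<in>M. T o\<^sub>L m \<in> M}" using x(1) von_neumann_algebraD(4)[OF M] by blast
  ultimately show ?thesis using generated_min[OF x(2)] x(3) by blast
qed

text \<open>
  The projections \<open>E t\<close> for \<open>t < 0\<close> and \<open>1 - E t\<close> for \<open>t \<ge> 0\<close> are the range projections of \<open>E t x\<close> and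
  \<open>(1 - E t) x\<close>, which are elements of \<open>M\<close>.
\<close>
lemma
  assumes M: "von_neumann_algebra M" and x: "x \<in> M" "hermitian x"
  shows vn_spectral_neg: "t < 0 \<Longrightarrow> spectral_family x t \<in> M"
    and vn_spectral_pos: "0 \<le> t \<Longrightarrow> id_blinfun - spectral_family x t \<in> M"
proof -
  let ?E = "spectral_family x t"
  have P: "is_projection ?E" by (rule spectral_family_is_projection[OF x(2)])
  define w where "w = ?E o\<^sub>L x"
  have wM: "w \<in> M" unfolding w_def
    by (rule vn_spectral_multiplier[OF M x(1) spectral_family_generated[OF x(2)] x(1)])
  have ws: "hermitian w" unfolding w_def
    by (rule hermitian_compose[OF is_projectionD(1)[OF P] x(2)])
       (rule blinfun_eqI, simp add: spectral_family_commute[OF x(2)])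
  have wv: "w v = x (?E v)" for v by (simp add: w_def spectral_family_commute[OF x(2)])
  show "?E \<in> M" if t: "t < 0"
  proof -
    have "w v = 0 \<longleftrightarrow> ?E v = 0" for v
    proof
      assume "w v = 0"
      then have "0 \<le> t * (norm (?E v))\<^sup>2"
        using spectral_family_upper[OF x(2) spectral_family_idem[OF x(2)], of t v] wv by (simp add: rip_simps)
      then show "?E v = 0" using t by (simp add: zero_le_mult_iff)
    qed (simp add: wv blinfun_simps)
    then have "{v. blinfun_apply w v = 0} = {v. ?E v = 0}" by blast
    then show ?thesis using vn_range_projection[OF M wM ws] by (simp add: Proj_kernel[OF P])
  qed
  show "id_blinfun - ?E \<in> M" if t: "0 \<le> t"
  proof -
    define u where "u = x - w"
    have u: "u \<in> M" "hermitian u" unfolding u_def using vn_diff[OF M x(1) wM] x(2) ws by auto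
    have uv: "u v = x (v - ?E v)" for v by (simp add: u_def wv blinfun_simps)
    have "u v = 0 \<longleftrightarrow> ?E v = v" for v
    proof
      assume z: "u v = 0"
      show "?E v = v"
      proof (rule ccontr)
        assume "?E v \<noteq> v"
        then have "t * (norm (v - ?E v))\<^sup>2 < rip (x (v - ?E v)) (v - ?E v)"
          by (intro spectral_family_strict[OF x(2)]) (simp_all add: blinfun_simps spectral_family_idem[OF x(2)])
        then have "t * (norm (v - ?E v))\<^sup>2 < 0" using z by (simp add: uv rip_simps)
        then show False using t by (simp add: mult_less_0_iff)
      qed
    qed (simp add: uv blinfun_simps)
    then have "{v. blinfun_apply u v = 0} = {v. ?E v = v}" by blast
    then show ?thesis using vn_range_projection[OF M u] by (simp add: Proj_range[OF P])
  qed
qed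

section \<open>Noncommuting elements of a nonabelian algebra\<close>

text \<open>
  Polarization keeps the distribution functions monotone: if \<open>b\<close> commutes with \<open>E t\<close>, the distribution
  functions of \<open>b v + w\<close> and \<open>v - b w\<close> add up to those of \<open>b v\<close>, \<open>w\<close>, \<open>v\<close> and \<open>b w\<close>, since the mixed terms
  cancel. The same relation between the integrals is \<open>\<langle>x b v, w\<rangle> = \<langle>x v, b w\<rangle>\<close>.
\<close>
lemma commute_with_spectral_family:
  assumes x: "hermitian x" and b: "hermitian b"
    and comm: "\<And>t v. spectral_family x t (b v) = b (spectral_family x t v)"
  shows "x (b v) = b (x v)"
proof (rule rip_eqI)
  fix w
  let ?F = "\<lambda>v t. rip (spectral_family x t v) v" and ?q = "\<lambda>v. rip (x v) v"
  note st = spectral_family_stieltjes[OF x]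
  have "stieltjes (\<lambda>t. ?F (b v + w) t + ?F (v - b w) t) (?q (b v + w) + ?q (v - b w))"
    by (intro stieltjes_add st)
  moreover have "?F (b v + w) t + ?F (v - b w) t = (?F (b v) t + ?F w t) + (?F v t + ?F (b w) t)" for t
  proof -
    let ?e = "spectral_family x t"
    have "rip (?e (b v)) w = rip (?e v) (b w)" by (simp add: comm hermitian_rip[OF b])
    moreover have "rip (?e w) (b v) = rip (?e (b v)) w" "rip (?e (b w)) v = rip (?e v) (b w)"
      using hermitian_rip[OF is_projectionD(1)[OF spectral_family_is_projection[OF x]]] rip_commute by metis+
    ultimately show ?thesis by (simp add: blinfun_simps rip_simps)
  qed
  moreover have "stieltjes (\<lambda>t. (?F (b v) t + ?F w t) + (?F v t + ?F (b w) t))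
      ((?q (b v) + ?q w) + (?q v + ?q (b w)))"
    by (intro stieltjes_add st)
  ultimately have "?q (b v + w) + ?q (v - b w) = (?q (b v) + ?q w) + (?q v + ?q (b w))"
    using stieltjes_unique by simp
  moreover have "rip (x w) (b v) = rip (x (b v)) w" "rip (x (b w)) v = rip (x v) (b w)"
    using hermitian_rip[OF x] rip_commute by metis+
  ultimately have "rip (x (b v)) w = rip (x v) (b w)" by (simp add: blinfun_simps rip_simps)
  then show "rip (x (b v)) w = rip (b (x v)) w" by (simp add: hermitian_rip[OF b])
qed

lemma scaleC_minus_left: "(- c) *\<^sub>c x = - (c *\<^sub>c (x::'h::complex_hilbert_space))"
  unfolding scaleC_split[of "- c"] scaleC_split[of c] by simp

text \<open>
  Real and imaginary part of \<open>S\<close> belong to \<open>M\<close>.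
\<close>
lemma commute_with_self_adjoint:
  assumes M: "von_neumann_algebra M" and B: "B \<in> bounded_ops"
    and comm: "\<And>a v. a \<in> M \<Longrightarrow> hermitian a \<Longrightarrow> a (B v) = B (a v)" and S: "S \<in> M"
  shows "S (B v) = B (S v)"
proof -
  let ?S' = "adj_op S"
  have Sb: "S \<in> bounded_ops" "?S' \<in> bounded_ops" "?S' \<in> M" using von_neumann_algebraD(1,5)[OF M] S by auto
  have r1: "rip (S x) y = rip x (?S' y)" for x y by (rule adj_rip[OF Sb(1)])
  have r2: "rip (?S' x) y = rip x (S y)" for x y by (metis r1 rip_commute)
  have "hermitian (S + ?S')"
    by (rule hermitianI) (auto intro: bounded_ops_intros Sb simp: blinfun_simps rip_simps r1 r2)
  moreover have "S + ?S' \<in> M" using von_neumann_algebraD(2)[OF M S Sb(3)] .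
  ultimately have 1: "S (B v) + ?S' (B v) = B (S v) + B (?S' v)"
    using comm[of "S + ?S'" v] by (simp add: blinfun_simps)
  let ?J = "scaleC_op \<i> (S - ?S')"
  have Jv: "?J v = \<i> *\<^sub>c (S v - ?S' v)" for v by (simp add: scaleC_op.rep_eq blinfun_simps)
  have db: "S - ?S' \<in> bounded_ops" using Sb by blast
  have "hermitian ?J"
  proof (rule hermitianI)
    show "?J \<in> bounded_ops"
    proof (rule bounded_opsI)
      fix c x
      have "?J (c *\<^sub>c x) = \<i> *\<^sub>c c *\<^sub>c (S - ?S') x" by (simp only: scaleC_op.rep_eq bounded_ops_scaleC[OF db])
      then show "?J (c *\<^sub>c x) = c *\<^sub>c ?J x" by (simp add: scaleC_op.rep_eq scaleC_scaleC mult.commute)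
    qed
    fix x y
    have "rip (?J x) y = rip ((S - ?S') x) (- \<i> *\<^sub>c y)" by (simp add: scaleC_op.rep_eq rip_scaleC)
    also have "\<dots> = rip x ((?S' - S) (- \<i> *\<^sub>c y))" by (simp add: blinfun_simps rip_simps r1 r2)
    also have "(?S' - S) (- \<i> *\<^sub>c y) = - \<i> *\<^sub>c (?S' - S) y"
      by (rule bounded_ops_scaleC) (use Sb in blast)
    also have "\<dots> = ?J y"
      by (simp add: Jv blinfun_simps scaleC_minus_left scaleC_diff)
    finally show "rip (?J x) y = rip x (?J y)" .
  qed
  moreover have "?J \<in> M" using von_neumann_algebraD(3)[OF M vn_diff[OF M S Sb(3)]] .
  ultimately have "\<i> *\<^sub>c (S (B v) - ?S' (B v)) = B (\<i> *\<^sub>c (S v - ?S' v))"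
    using comm[of ?J v] by (simp only: Jv)
  also have "\<dots> = \<i> *\<^sub>c (B (S v) - B (?S' v))" by (simp add: bounded_ops_scaleC[OF B] blinfun_simps)
  finally have "S (B v) - ?S' (B v) = B (S v) - B (?S' v)" by (metis scaleC_i_i neg_equal_iff_equal)
  with 1 have "(S (B v) + ?S' (B v)) + (S (B v) - ?S' (B v)) = (B (S v) + B (?S' v)) + (B (S v) - B (?S' v))"
    by (simp only:)
  then have "2 *\<^sub>R S (B v) = 2 *\<^sub>R B (S v)" by (simp add: scaleR_2)
  then show ?thesis by simp
qed

text \<open>
  For noncommuting hermitian \<open>a\<close> and \<open>b\<close>, some spectral projection \<open>p\<close> of \<open>a\<close> does not commute with \<open>b\<close>. One of the
  positive elements \<open>b\<^sup>2\<close> and \<open>(b + p)\<^sup>2\<close> does not commute with \<open>p\<close> either: otherwise \<open>p\<close> commutes with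
  \<open>b p + p b\<close>, and \<open>p (b p + p b) = (b p + p b) p\<close> means \<open>p b = b p\<close>.
\<close>
lemma noncommuting_pair:
  assumes M: "von_neumann_algebra M" and na: "\<not> abelian M"
  obtains p h where "p \<in> M" "h \<in> M" "is_projection p" "hermitian h" "\<And>v. 0 \<le> rip (h v) v" "\<exists>v. p (h v) \<noteq> h (p v)"
proof -
  \<comment> \<open>Otherwise the hermitian elements commute with each other, hence with \<open>M\<close>, and so does \<open>M\<close> with itself.\<close>
  have "\<exists>a b v. a \<in> M \<and> hermitian a \<and> b \<in> M \<and> hermitian b \<and> a (b v) \<noteq> b (a v)"
  proof (rule ccontr)
    assume "\<not> ?thesis"
    then have sa: "a (b v) = b (a v)" if "a \<in> M" "hermitian a" "b \<in> M" "hermitian b" for a b v using that by blast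
    have 1: "S (b v) = b (S v)" if S: "S \<in> M" and b: "b \<in> M" "hermitian b" for S b v
    proof (rule commute_with_self_adjoint[OF M von_neumann_algebraD(1)[OF M b(1)] _ S])
      show "a (b v) = b (a v)" if "a \<in> M" "hermitian a" for a v by (rule sa[OF that b])
    qed
    have 2: "S (T v) = T (S v)" if S: "S \<in> M" and T: "T \<in> M" for S T v
    proof (rule commute_with_self_adjoint[OF M von_neumann_algebraD(1)[OF M T] _ S])
      show "a (T v) = T (a v)" if "a \<in> M" "hermitian a" for a v by (rule 1[OF T that, symmetric])
    qed
    have "abelian M" unfolding abelian_def
    proof (intro ballI blinfun_eqI)
      fix S T v assume "S \<in> M" "T \<in> M"
      from 2[OF this, of v] show "(S o\<^sub>L T) v = (T o\<^sub>L S) v" by (simp only: blinfun_apply_blinfun_compose)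
    qed
    then show False using na by simp
  qed
  then obtain a b v where ab: "a \<in> M" "hermitian a" "b \<in> M" "hermitian b" "a (b v) \<noteq> b (a v)" by blast
  then obtain t v where tv: "spectral_family a t (b v) \<noteq> b (spectral_family a t v)"
    using commute_with_spectral_family[OF ab(2,4)] by metis
  define p where "p = (if t < 0 then spectral_family a t else id_blinfun - spectral_family a t)"
  have Pa: "is_projection (spectral_family a t)" by (rule spectral_family_is_projection[OF ab(2)])
  have p: "p \<in> M" "is_projection p"
    using vn_spectral_neg[OF M ab(1,2), of t] vn_spectral_pos[OF M ab(1,2), of t] Pa is_projection_compl[OF Pa]
    by (auto simp: p_def)
  have pb: "p (b v) \<noteq> b (p v)" using tv by (auto simp: p_def blinfun_simps)
  have ps: "hermitian p" by (rule is_projectionD(1)[OF p(2)])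
  have sq: "h o\<^sub>L h \<in> M" "hermitian (h o\<^sub>L h)" "0 \<le> rip ((h o\<^sub>L h) v) v" if "h \<in> M" "hermitian h" for h v
    using von_neumann_algebraD(4)[OF M that(1) that(1)] hermitian_square[OF that(2)] hermitian_rip[OF that(2), of "h v" v]
    by (simp_all add: rip_self)
  have bp: "b + p \<in> M" "hermitian (b + p)" using von_neumann_algebraD(2)[OF M ab(3) p(1)] ab(4) ps by auto
  show ?thesis
  proof (cases "\<exists>v. p ((b o\<^sub>L b) v) \<noteq> (b o\<^sub>L b) (p v)")
    case True
    then show ?thesis using that[OF p(1) sq(1)[OF ab(3,4)] p(2) sq(2)[OF ab(3,4)] sq(3)[OF ab(3,4)]] by blast
  next
    case False
    then have "p (b (b v)) = b (b (p v))" by simp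
    then have "p (((b + p) o\<^sub>L (b + p)) v) \<noteq> ((b + p) o\<^sub>L (b + p)) (p v)"
      using pb is_projectionD(2)[OF p(2)] by (simp add: blinfun_simps)
    then show ?thesis using that[OF p(1) sq(1)[OF bp] p(2) sq(2)[OF bp] sq(3)[OF bp]] by blast
  qed
qed


section \<open>Dependence of the order topology on the order\<close>

lemma order_convergent_cong:
  assumes conv: "order_convergent P le I r x l" and x: "x ` I \<subseteq> P"
    and eq: "\<And>a b. a \<in> P \<Longrightarrow> b \<in> P \<Longrightarrow> le a b = le' a b"
  shows "order_convergent P le' I r x l"
proof -
  obtain y z where yz: "y ` I \<subseteq> P" "z ` I \<subseteq> P"
    "monotone_on I r le y" "monotone_on I r (\<lambda>a b. le b a) z"
    "\<forall>i\<in>I. le (y i) (x i) \<and> le (x i) (z i)"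
    "is_sup P le (y ` I) l" "is_inf P le (z ` I) l"
    using conv unfolding order_convergent_def by blast
  have yP: "y i \<in> P" and zP: "z i \<in> P" and xP: "x i \<in> P" if "i \<in> I" for i
    using yz(1,2) x that by blast+
  have lP: "l \<in> P" using yz(6) by (simp add: is_sup_def)
  show ?thesis
    unfolding order_convergent_def
  proof (rule exI[of _ y], rule exI[of _ z], intro conjI)
    show "monotone_on I r le' y"
      using yz(3) eq yP unfolding monotone_on_def by blast
    show "monotone_on I r (\<lambda>a b. le' b a) z"
      using yz(4) eq zP unfolding monotone_on_def by blast
    show "\<forall>i\<in>I. le' (y i) (x i) \<and> le' (x i) (z i)"
      using yz(5) eq xP yP zP by blast
    show "is_sup P le' (y ` I) l" unfolding is_sup_def
    proof (intro conjI ballI impI)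
      show "le' a l" if "a \<in> y ` I" for a
        using that yz(6) eq lP yP unfolding is_sup_def by blast
      fix u assume u: "u \<in> P" "\<forall>a\<in>y ` I. le' a u"
      then have "\<forall>a\<in>y ` I. le a u" using eq yP by blast
      then have "le l u" using yz(6) u(1) unfolding is_sup_def by blast
      then show "le' l u" using eq lP u(1) by blast
    qed (rule lP)
    show "is_inf P le' (z ` I) l" unfolding is_inf_def
    proof (intro conjI ballI impI)
      show "le' l a" if "a \<in> z ` I" for a
        using that yz(7) eq lP zP unfolding is_inf_def by blast
      fix u assume u: "u \<in> P" "\<forall>a\<in>z ` I. le' u a"
      then have "\<forall>a\<in>z ` I. le u a" using eq zP by blast
      then have "le u l" using yz(7) u(1) unfolding is_inf_def by blast
      then show "le' u l" using eq lP u(1) by blast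
    qed (rule lP)
  qed (use yz(1,2) in auto)
qed

lemma order_closed_cong:
  assumes eq: "\<And>a b. a \<in> P \<Longrightarrow> b \<in> P \<Longrightarrow> le a b = le' a b"
  shows "order_closed P le C \<longleftrightarrow> order_closed P le' C"
proof -
  have imp: "order_closed P le' C"
    if c: "order_closed P le C" and eq: "\<And>a b. a \<in> P \<Longrightarrow> b \<in> P \<Longrightarrow> le a b = le' a b"
    for le le' :: "'a \<Rightarrow> 'a \<Rightarrow> bool"
    unfolding order_closed_def
  proof (intro conjI notI)
    show CP: "C \<subseteq> P" using c by (simp add: order_closed_def)
    assume "\<exists>(I :: ('a \<times> 'a \<times> 'a) set) r x l. directed_set I r \<and> x ` I \<subseteq> C \<and>
      l \<in> P - C \<and> order_convergent P le' I r x l"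
    then obtain I :: "('a \<times> 'a \<times> 'a) set" and r x l where
      *: "directed_set I r" "x ` I \<subseteq> C" "l \<in> P - C" "order_convergent P le' I r x l" by blast
    have "order_convergent P le I r x l"
      by (rule order_convergent_cong[OF *(4)]) (use *(2) CP eq in auto)
    then show False using c * unfolding order_closed_def by blast
  qed
  show ?thesis using imp[of le le'] imp[of le' le] eq by blast
qed

lemma order_top_cong:
  assumes eq: "\<And>a b. a \<in> P \<Longrightarrow> b \<in> P \<Longrightarrow> le a b = le' a b"
  shows "order_top P le = order_top P le'"
  unfolding order_top_def using order_closed_cong[of P le le', OF eq] by simp

lemma order_closed_of_order_top_eq:
  assumes "transp_on P le" "transp_on P le'" "order_top P le = order_top P le'"
    and C: "order_closed P le C"
  shows "order_closed P le' C"
proof -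
  have "C \<subseteq> P" using C by (simp add: order_closed_def)
  then have PC: "P - (P - C) = C" by blast
  then have "openin (order_top P le) (P - C)" using C openin_order_top[OF assms(1)] by auto
  then show ?thesis using openin_order_top[OF assms(2), of "P - C"] assms(3) PC by simp
qed

lemma transp_op_le: "(\<And>x. x \<in> P \<Longrightarrow> hermitian x) \<Longrightarrow> transp_on P op_le"
  by (rule transp_onI) (auto simp: op_le_iff intro: order_trans)

lemma transp_spectral_le: "(\<And>x. x \<in> P \<Longrightarrow> hermitian x) \<Longrightarrow> transp_on P spectral_le"
  by (rule transp_onI) (metis spectral_le_trans)

section \<open>Decreasing nets whose spectral infimum is a projection\<close>

lemma directed_finite:
  assumes dir: "directed_set I r" and fin: "finite A"
    and ev: "\<And>v. v \<in> A \<Longrightarrow> \<exists>i\<in>I. \<forall>j\<in>I. r i j \<longrightarrow> Q j v"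
  shows "\<exists>i\<in>I. \<forall>j\<in>I. r i j \<longrightarrow> (\<forall>v\<in>A. Q j v)"
  using fin ev
proof (induction A rule: finite_induct)
  case empty
  then show ?case using dir by (auto simp: directed_set_def)
next
  case (insert a A)
  obtain i where i: "i \<in> I" "\<forall>j\<in>I. r i j \<longrightarrow> (\<forall>v\<in>A. Q j v)" using insert by blast
  obtain k where k: "k \<in> I" "\<forall>j\<in>I. r k j \<longrightarrow> Q j a" using insert.prems by blast
  obtain m where m: "m \<in> I" "r i m" "r k m" using dir i k unfolding directed_set_def by blast
  have tr: "transp_on I r" using dir by (simp add: directed_set_def)
  have "r i j" "r k j" if "j \<in> I" "r m j" for j
    using tr that m i(1) k(1) unfolding transp_on_def by blast+
  then show ?case using i(2) k(2) m(1) by (intro bexI[of _ m]) auto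
qed

lemma directed_refl: "directed_set I r \<Longrightarrow> i \<in> I \<Longrightarrow> r i i"
  unfolding directed_set_def reflp_on_def by blast

text \<open>
  The range of \<open>p\<close> consists of eigenvectors for the eigenvalue \<open>1\<close>, which are killed by the spectral
  projection at \<open>t < 1\<close>.
\<close>
lemma below_projection:
  assumes p: "is_projection p" and t: "t < 1" and v: "spectral_family p t v = v"
  shows "p v = 0"
proof -
  note ps = is_projectionD(1)[OF p]
  have "spectral_family p t (p v) = 0"
    by (rule eigen_killed[OF ps, of _ 1]) (use t is_projectionD(2)[OF p] in auto)
  then show ?thesis by (simp add: spectral_family_commute[OF ps] v)
qed

text \<open>
  The projections \<open>1 - E t\<close> of the \<open>z i\<close> decrease strongly to a projection \<open>D \<ge> p\<close>, which belongs to \<open>M\<close>. If \<open>D\<close>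
  were larger than \<open>p\<close>, the operator \<open>w = p + t (D - p)\<close> would be a spectral lower bound of all \<open>z i\<close>
  not below their infimum \<open>p\<close>. So \<open>D = p\<close>, and the ranges of the \<open>E t\<close> exhaust the kernel of \<open>p\<close>.
\<close>
lemma inf_projection_approx:
  fixes M :: "('h::complex_hilbert_space \<Rightarrow>\<^sub>L 'h) set"
  assumes M: "von_neumann_algebra M" and p: "p \<in> M" "is_projection p"
    and dir: "directed_set I r" and zM: "\<And>i. i \<in> I \<Longrightarrow> z i \<in> self_adjoint_part M"
    and dec: "monotone_on I r (\<lambda>a b. spectral_le b a) z"
    and inf: "is_inf (self_adjoint_part M) spectral_le (z ` I) p"
    and t: "0 < t" "t < 1" and v: "p v = 0" and e: "0 < e"
  shows "\<exists>i\<in>I. norm (v - spectral_family (z i) t v) < e"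
proof -
  define E where "E i = spectral_family (z i)" for i
  have zs: "hermitian (z i)" "z i \<in> M" if "i \<in> I" for i using zM[OF that] self_adjoint_part_iff[OF M] by auto
  note ps = is_projectionD(1)[OF p(2)]
  have le_p: "spectral_le p (z i)" if "i \<in> I" for i using inf that by (simp add: is_inf_def)
  have EP: "is_projection (E i s)" if "i \<in> I" for i s
    unfolding E_def by (rule spectral_family_is_projection[OF zs(1)[OF that]])
  have Ep: "spectral_family p s u = u" if "i \<in> I" "E i s u = u" for i s u
    using spectral_leD[OF le_p[OF that(1)] ps zs(1)[OF that(1)]] that(2) by (simp add: E_def)
  define Q where "Q i = id_blinfun - E i t" for i
  have QP: "is_projection (Q i)" if "i \<in> I" for i unfolding Q_def by (rule is_projection_compl[OF EP[OF that]])
  have QM: "Q i \<in> M" if "i \<in> I" for i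
    unfolding Q_def E_def by (rule vn_spectral_pos[OF M zs(2)[OF that] zs(1)[OF that]]) (use t in simp)
  have Qfix: "Q i u = u \<longleftrightarrow> E i t u = 0" for i u by (simp add: Q_def blinfun_simps)
  have Qmono: "Q i u = u" if ij: "i \<in> I" "j \<in> I" "r i j" and u: "Q j u = u" for i j u
  proof -
    have "spectral_le (z j) (z i)" using dec ij by (simp add: monotone_on_def)
    then have "E j t w = w" if "E i t w = w" for w
      using that spectral_leD[OF _ zs(1)[OF ij(2)] zs(1)[OF ij(1)]] by (simp add: E_def)
    moreover have "E j t u = 0" using u unfolding Qfix .
    ultimately have "E i t u = 0" using proj_ker_range[OF EP[OF ij(2)] EP[OF ij(1)]] by blast
    then show ?thesis by (simp add: Qfix)
  qed
  define W where "W = (\<Inter>i\<in>I. {u. Q i u = u})"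
  have W: "closed_csubspace W" unfolding W_def using is_projectionD(3)[OF QP] by (intro closed_csubspace_INT fixed_csubspace)
  note W' = closed_csubspaceD[OF W]
  define D where "D = Proj W"
  have DP: "is_projection D" unfolding D_def by (rule Proj_is_projection[OF W])
  note Ds = is_projectionD(1)[OF DP]
  have lim: "\<exists>i\<in>I. \<forall>j\<in>I. (\<forall>u. Q j u = u \<longrightarrow> Q i u = u) \<longrightarrow> norm (Q j u - D u) < e"
    if "0 < e" for e u
    unfolding D_def W_def
  proof (rule proj_decreasing_limit[OF QP _ _ that])
    show "I \<noteq> {}" using dir by (simp add: directed_set_def)
    fix i j assume ij: "i \<in> I" "j \<in> I"
    then obtain k where "k \<in> I" "r i k" "r j k" using dir unfolding directed_set_def by blast
    then show "\<exists>k\<in>I. \<forall>u. Q k u = u \<longrightarrow> Q i u = u \<and> Q j u = u" using Qmono ij by blast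
  qed
  have lim': "\<exists>i\<in>I. \<forall>j\<in>I. r i j \<longrightarrow> norm (Q j u - D u) < e" if "0 < e" for e u
    using lim[OF that, of u] Qmono by blast
  have DM: "D \<in> M"
  proof (rule strong_operator_closedI[OF von_neumann_algebraD(6)[OF M]])
    fix A :: "'h set" and e :: real assume A: "finite A" and e: "0 < e"
    obtain i where i: "i \<in> I" "\<forall>j\<in>I. r i j \<longrightarrow> (\<forall>u\<in>A. norm (Q j u - D u) < e)"
      using directed_finite[OF dir A, of "\<lambda>j u. norm (Q j u - D u) < e"] lim'[OF e] by blast
    then have "\<forall>u\<in>A. norm (Q i u - D u) < e" using directed_refl[OF dir] by blast
    then show "\<exists>S\<in>M. \<forall>u\<in>A. norm (S u - D u) < e" using QM[OF i(1)] by blast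
  qed
  have Dp: "D u = u" if "p u = u" for u
  proof -
    have k: "spectral_family p t u = 0"
      by (rule eigen_killed[OF ps, of _ 1]) (use t that in auto)
    have "E i t u = 0" if i: "i \<in> I" for i
      by (rule proj_ker_range[OF spectral_family_is_projection[OF ps, of t] EP[OF i] _ k]) (rule Ep[OF i])
    then show ?thesis unfolding D_def by (intro Proj_fix[OF W']) (simp add: W_def Qfix)
  qed
  have pD: "p (D u) = p u" for u
  proof (rule rip_eqI)
    fix y
    have "D (p y) = p y" by (rule Dp) (rule is_projectionD(2)[OF p(2)])
    then show "rip (p (D u)) y = rip (p u) y" by (simp add: hermitian_rip[OF ps] hermitian_rip[OF Ds])
  qed
  define w where "w = p + t *\<^sub>R (D - p)"
  have ws: "hermitian w" unfolding w_def using ps Ds by blast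
  have wM: "w \<in> self_adjoint_part M"
    using von_neumann_algebraD(2)[OF M p(1) vn_scaleR[OF M vn_diff[OF M DM p(1)]]] ws self_adjoint_part_iff[OF M]
    by (simp add: w_def)
  have wv: "w u = p u + t *\<^sub>R (D u - p u)" for u by (simp add: w_def blinfun_simps)
  have "spectral_le w (z i)" if i: "i \<in> I" for i
    unfolding spectral_le_iff[OF ws zs(1)[OF i]]
  proof (intro allI impI)
    fix s u assume "spectral_family (z i) s u = u"
    then have u: "E i s u = u" by (simp add: E_def)
    note pu = Ep[OF i u]
    \<comment> \<open>The values of \<open>w\<close> are \<open>0\<close>, \<open>t\<close> and \<open>1\<close>, taken on the kernel of \<open>D\<close>, on the range of \<open>D - p\<close> and on the range of \<open>p\<close>.\<close>
    consider "s < 0" | "0 \<le> s" "s < t" | "t \<le> s" "s < 1" | "1 \<le> s" by linarith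
    then show "spectral_family w s u = u"
    proof cases
      case 1
      have "rip (p u) u \<le> s * (norm u)\<^sup>2" by (rule spectral_family_upper[OF ps pu])
      then have "0 \<le> s * (norm u)\<^sup>2" using norm_is_projection[OF p(2), of u] by (smt (verit) zero_le_power2)
      then have "u = 0" using 1 by (simp add: zero_le_mult_iff)
      then show ?thesis by (simp add: blinfun_simps)
    next
      case 2
      have pu0: "p u = 0" by (rule below_projection[OF p(2) _ pu]) (use 2 t in simp)
      have "proj_family (E i)" unfolding E_def by (rule spectral_family_proj_family[OF zs(1)[OF i]])
      then have Et: "E i t u = u" using proj_family.mono[of "E i" s t u] 2 u by simp
      have "D u = 0"
        unfolding D_def
      proof (subst Proj_0_iff[OF W'], intro ballI)
        fix y assume "y \<in> W"
        then have "E i t y = 0" using i by (simp add: W_def Qfix)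
        then show "rip u y = 0"
          using hermitian_rip[OF is_projectionD(1)[OF EP[OF i]], of t u y] Et by (simp add: rip_simps)
      qed
      then have "w u = 0 *\<^sub>R u" using pu0 by (simp add: wv)
      then show ?thesis by (rule eigen_fixed[OF ws]) (use 2 in simp)
    next
      case 3
      have pu0: "p u = 0" by (rule below_projection[OF p(2) _ pu]) (use 3 in simp)
      have DD: "D (D u) = D u" by (rule is_projectionD(2)[OF DP])
      have "w (D u) = t *\<^sub>R D u" using pu0 pD[of u] by (simp add: wv DD)
      then have 1: "spectral_family w s (D u) = D u" by (rule eigen_fixed[OF ws]) (use 3 in simp)
      have "w (u - D u) = 0 *\<^sub>R (u - D u)" using pu0 pD[of u] by (simp add: wv blinfun_simps DD)
      then have 2: "spectral_family w s (u - D u) = u - D u" by (rule eigen_fixed[OF ws]) (use 3 t in simp)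
      have "spectral_family w s (D u + (u - D u)) = D u + (u - D u)"
        unfolding blinfun.add_right 1 2 ..
      then show ?thesis by simp
    next
      case 4
      show ?thesis
      proof (rule spectral_family_one[OF ws])
        fix y
        have "(norm (p y))\<^sup>2 \<le> (norm y)\<^sup>2" "(norm (D y))\<^sup>2 \<le> (norm y)\<^sup>2"
          using is_projection_norm_le[OF p(2)] is_projection_norm_le[OF DP] by (simp_all add: power_mono)
        then have "(1 - t) * (norm (p y))\<^sup>2 \<le> (1 - t) * (norm y)\<^sup>2" "t * (norm (D y))\<^sup>2 \<le> t * (norm y)\<^sup>2"
          using t by (simp_all add: mult_left_mono)
        moreover have "rip (w y) y = (1 - t) * (norm (p y))\<^sup>2 + t * (norm (D y))\<^sup>2"
          unfolding norm_is_projection[OF p(2)] norm_is_projection[OF DP] by (simp add: wv rip_simps algebra_simps)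
        ultimately have "rip (w y) y \<le> 1 * (norm y)\<^sup>2" by (simp add: algebra_simps)
        also have "\<dots> \<le> s * (norm y)\<^sup>2" using 4 by (intro mult_right_mono) auto
        finally show "rip (w y) y \<le> s * (norm y)\<^sup>2" .
      qed
    qed
  qed
  then have "spectral_le w p" using inf wM unfolding is_inf_def by blast
  then have "op_le w p" by (rule spectral_le_imp_op_le[OF ws ps])
  then have "rip (w u) u \<le> rip (p u) u" for u using op_le_iff[OF ws ps] by blast
  then have "t * (rip (D u) u - rip (p u) u) \<le> 0" for u by (simp add: wv rip_simps)
  then have "op_le D p" using t unfolding op_le_iff[OF Ds ps] by (simp add: mult_le_0_iff)
  then have "p (D v) = D v" using op_le_proj_iff[OF DP p(2)] is_projectionD(2)[OF DP] by blast
  then have Dv: "D v = 0" using pD[of v] v by simp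
  obtain i where i: "i \<in> I" "\<forall>j\<in>I. r i j \<longrightarrow> norm (Q j v - D v) < e" using lim'[OF e] by blast
  then have "norm (Q i v - D v) < e" using directed_refl[OF dir] by blast
  then show ?thesis using i(1) Dv by (auto simp: Q_def E_def blinfun_simps)
qed

section \<open>A set separating the two topologies\<close>

text \<open>
  A net in this set with no cofinally constant subnet can only converge to \<open>p\<close>. In that case the upper
  bounds \<open>z i\<close> would have spectral projections below those of infinitely many \<open>X n\<close> and, at the
  same time, exhausting the kernel of \<open>p\<close>, which forces \<open>p h (1 - p) = 0\<close>.
\<close>
lemma perturbed_projection_order_closed:
  fixes M :: "('h::complex_hilbert_space \<Rightarrow>\<^sub>L 'h) set"
  assumes M: "von_neumann_algebra M" and p: "p \<in> M" "is_projection p"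
    and h: "h \<in> M" "hermitian h" "\<And>v. 0 \<le> rip (h v) v" and nc: "\<exists>v. p (h v) \<noteq> h (p v)"
  shows "order_closed (self_adjoint_part M) spectral_le (range (\<lambda>n. p + (1 / real (Suc n)) *\<^sub>R h))"
proof -
  let ?P = "self_adjoint_part M"
  define X where "X n = p + (1 / real (Suc n)) *\<^sub>R h" for n
  note ps = is_projectionD(1)[OF p(2)]
  note Piff = self_adjoint_part_iff[OF M]
  have Xs: "hermitian (X n)" for n unfolding X_def using ps h(2) by blast
  have XP: "X n \<in> ?P" for n
    using von_neumann_algebraD(2)[OF M p(1) vn_scaleR[OF M h(1)]] Xs[of n] by (simp add: Piff X_def)
  have pP: "p \<in> ?P" using p(1) ps by (simp add: Piff)
  show ?thesis
    unfolding order_closed_def X_def[symmetric]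
  proof (intro conjI notI)
    show "range X \<subseteq> ?P" using XP by blast
    assume "\<exists>(I :: (('h \<Rightarrow>\<^sub>L 'h) \<times> ('h \<Rightarrow>\<^sub>L 'h) \<times> ('h \<Rightarrow>\<^sub>L 'h)) set) r x l. directed_set I r \<and>
      x ` I \<subseteq> range X \<and> l \<in> ?P - range X \<and> order_convergent ?P spectral_le I r x l"
    then obtain I :: "(('h \<Rightarrow>\<^sub>L 'h) \<times> ('h \<Rightarrow>\<^sub>L 'h) \<times> ('h \<Rightarrow>\<^sub>L 'h)) set" and r x l where
      dir: "directed_set I r" and xX: "x ` I \<subseteq> range X" and l: "l \<in> ?P - range X"
      and conv: "order_convergent ?P spectral_le I r x l" by blast
    obtain y z where yz: "y ` I \<subseteq> ?P" "z ` I \<subseteq> ?P"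
      and ymono: "monotone_on I r spectral_le y" and zmono: "monotone_on I r (\<lambda>a b. spectral_le b a) z"
      and yxz: "\<forall>i\<in>I. spectral_le (y i) (x i) \<and> spectral_le (x i) (z i)"
      and sup: "is_sup ?P spectral_le (y ` I) l" and inf: "is_inf ?P spectral_le (z ` I) l"
      using conv unfolding order_convergent_def by blast
    have ys: "hermitian (y i)" and zs: "hermitian (z i)" if "i \<in> I" for i using yz that Piff by blast+
    have ls: "hermitian l" using l Piff by blast
    have squeeze: "spectral_le (y i) (X n) \<and> spectral_le (X n) (z i)"
      if ij: "i \<in> I" "j \<in> I" "r i j" "x j = X n" for i j n
    proof
      have "spectral_le (y i) (y j)" using ymono ij by (simp add: monotone_on_def)
      then show "spectral_le (y i) (X n)"
        by (rule spectral_le_trans) (use ij yxz ys Xs in auto)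
      have "spectral_le (z j) (z i)" using zmono ij by (simp add: monotone_on_def)
      then show "spectral_le (X n) (z i)"
        by (rule spectral_le_trans[rotated]) (use ij yxz zs Xs in auto)
    qed
    have between: "l = a" if a: "a \<in> ?P" "\<And>i. i \<in> I \<Longrightarrow> spectral_le (y i) a \<and> spectral_le a (z i)" for a
    proof (rule spectral_le_antisym[OF ls])
      show "hermitian a" using a(1) Piff by blast
      show "spectral_le l a" using sup a unfolding is_sup_def by blast
      show "spectral_le a l" using inf a unfolding is_inf_def by blast
    qed
    have not_cofinal: "\<exists>i\<in>I. \<forall>j\<in>I. r i j \<longrightarrow> x j \<noteq> X m" for m
    proof (rule ccontr)
      assume "\<not> ?thesis"
      then have "l = X m" using squeeze by (intro between XP) blast
      then show False using l by blast
    qed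
    have tail: "\<exists>j\<in>I. \<exists>n\<ge>N. r i j \<and> x j = X n" if i: "i \<in> I" for i N
    proof -
      have "\<exists>k\<in>I. \<forall>j\<in>I. r k j \<longrightarrow> (\<forall>m\<in>{..<N}. x j \<noteq> X m)"
        by (rule directed_finite[OF dir finite_lessThan not_cofinal])
      then obtain k where k: "k \<in> I" "\<forall>j\<in>I. r k j \<longrightarrow> (\<forall>m\<in>{..<N}. x j \<noteq> X m)" by blast
      obtain j where j: "j \<in> I" "r i j" "r k j" using dir i k(1) unfolding directed_set_def by blast
      obtain n where n: "x j = X n" using xX j(1) by blast
      have "N \<le> n" using k(2) j n by (metis lessThan_iff not_le)
      then show ?thesis using j n by blast
    qed
    have close: "\<exists>n. norm (X n - p) < e \<and> spectral_le (y i) (X n) \<and> spectral_le (X n) (z i)"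
      if e: "0 < e" and i: "i \<in> I" for e i
    proof -
      obtain N where N: "norm h / e < real N" using reals_Archimedean2 by blast
      obtain j n where jn: "j \<in> I" "N \<le> n" "r i j" "x j = X n" using tail[OF i] by blast
      have "norm h / e < real (Suc n)" using N jn(2) by simp
      then have "norm h < e * real (Suc n)" using e by (simp add: pos_divide_less_eq mult.commute)
      then have "norm (X n - p) < e" by (simp add: X_def pos_divide_less_eq)
      then show ?thesis using squeeze[OF i jn(1,3,4)] by blast
    qed
    have lp: "l = p"
    proof (rule between[OF pP])
      fix i assume i: "i \<in> I"
      show "spectral_le (y i) p \<and> spectral_le p (z i)"
      proof
        show "spectral_le (y i) p"
          by (rule spectral_le_limit_right[OF ps ys[OF i]]) (use close[OF _ i] Xs in blast)
        show "spectral_le p (z i)"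
          by (rule spectral_le_limit_left[OF ps zs[OF i]]) (use close[OF _ i] Xs in blast)
      qed
    qed
    have bound: "(norm (p (h u)))\<^sup>2 \<le> t * (norm (h u))\<^sup>2"
      if t: "0 < t" "t < 1" and i: "i \<in> I" and u: "spectral_family (z i) t u = u" for t i u
    proof -
      have "spectral_le p (z i)" using inf i lp by (simp add: is_inf_def)
      then have "spectral_family p t u = u" using spectral_leD ps zs[OF i] u by blast
      then have pu: "p u = 0" by (rule below_projection[OF p(2) t(2)])
      obtain n where n: "spectral_le (X n) (z i)" using close[OF zero_less_one i] by blast
      have Eu: "spectral_family (X n) t u = u" by (rule spectral_leD[OF n Xs zs[OF i] u])
      have "X n u = (1 / real (Suc n)) *\<^sub>R h u" by (simp add: X_def blinfun_simps pu)
      then have hu: "h u = real (Suc n) *\<^sub>R X n u" by simp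
      have "spectral_family (X n) t (h u) = h u"
        unfolding hu blinfun.scaleR_right by (simp only: spectral_family_commute[OF Xs] Eu)
      then have "rip (X n (h u)) (h u) \<le> t * (norm (h u))\<^sup>2" by (rule spectral_family_upper[OF Xs])
      \<comment> \<open>The contribution of \<open>h\<close> is nonnegative, so a single \<open>n\<close> is enough and no limit is taken.\<close>
      moreover have "rip (X n (h u)) (h u)
          = (norm (p (h u)))\<^sup>2 + (1 / real (Suc n)) * rip (h (h u)) (h u)"
        unfolding norm_is_projection[OF p(2)] by (simp add: X_def blinfun_simps rip_simps)
      moreover have "0 \<le> (1 / real (Suc n)) * rip (h (h u)) (h u)" using h(3) by simp
      ultimately show ?thesis by linarith
    qed
    have bound': "(norm (p (h u)))\<^sup>2 \<le> t * (norm (h u))\<^sup>2"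
      if t: "0 < t" "t < 1" and u: "p u = 0" for t u
    proof -
      have "\<exists>i\<in>I. norm (u - spectral_family (z i) t u) < 1 / real (Suc n)" for n
        by (rule inf_projection_approx[OF M p dir _ zmono inf[unfolded lp] t u]) (use yz(2) in auto)
      then obtain f where f: "\<And>n. f n \<in> I"
        "\<And>n. norm (u - spectral_family (z (f n)) t u) < 1 / real (Suc n)" by metis
      define a where "a n = spectral_family (z (f n)) t u" for n
      have "(\<lambda>n. u - a n) \<longlonglongrightarrow> 0"
      proof (rule Lim_null_comparison)
        show "\<forall>\<^sub>F n in sequentially. norm (u - a n) \<le> 1 / real (Suc n)"
          using f(2) by (simp add: a_def less_imp_le)
        show "(\<lambda>n. 1 / real (Suc n)) \<longlonglongrightarrow> 0"
          by (rule LIMSEQ_Suc[OF lim_1_over_n, unfolded comp_def])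
      qed
      from tendsto_diff[OF tendsto_const[of u] this] have a: "a \<longlonglongrightarrow> u" by simp
      have hl: "(\<lambda>n. h (a n)) \<longlonglongrightarrow> h u" by (rule blinfun.tendsto[OF tendsto_const a])
      have phl: "(\<lambda>n. p (h (a n))) \<longlonglongrightarrow> p (h u)" by (rule blinfun.tendsto[OF tendsto_const hl])
      show ?thesis
      proof (rule LIMSEQ_le)
        show "(\<lambda>n. (norm (p (h (a n))))\<^sup>2) \<longlonglongrightarrow> (norm (p (h u)))\<^sup>2"
          by (rule tendsto_power[OF tendsto_norm[OF phl]])
        show "(\<lambda>n. t * (norm (h (a n)))\<^sup>2) \<longlonglongrightarrow> t * (norm (h u))\<^sup>2"
          by (rule tendsto_mult[OF tendsto_const tendsto_power[OF tendsto_norm[OF hl]]])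
        have "(norm (p (h (a n))))\<^sup>2 \<le> t * (norm (h (a n)))\<^sup>2" for n
          by (rule bound[OF t f(1)[of n]]) (simp add: a_def spectral_family_idem[OF zs[OF f(1)]])
        then show "\<exists>N. \<forall>n\<ge>N. (norm (p (h (a n))))\<^sup>2 \<le> t * (norm (h (a n)))\<^sup>2" by blast
      qed
    qed
    have zero: "p (h u) = 0" if u: "p u = 0" for u
    proof -
      have "(norm (p (h u)))\<^sup>2 \<le> 0"
      proof (rule LIMSEQ_le_const)
        have "(\<lambda>n. 1 / real (Suc (Suc n)) * (norm (h u))\<^sup>2) \<longlonglongrightarrow> 0 * (norm (h u))\<^sup>2"
          by (intro tendsto_mult tendsto_const LIMSEQ_Suc[OF LIMSEQ_Suc[OF lim_1_over_n], unfolded comp_def])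
        then show "(\<lambda>n. 1 / real (Suc (Suc n)) * (norm (h u))\<^sup>2) \<longlonglongrightarrow> 0" by simp
        have "(norm (p (h u)))\<^sup>2 \<le> 1 / real (Suc (Suc n)) * (norm (h u))\<^sup>2" for n
          by (rule bound'[OF _ _ u]) simp_all
        then show "\<exists>N. \<forall>n\<ge>N. (norm (p (h u)))\<^sup>2 \<le> 1 / real (Suc (Suc n)) * (norm (h u))\<^sup>2" by blast
      qed
      then show ?thesis by simp
    qed
    have php: "p (h v) = p (h (p v))" for v
    proof -
      have "p (v - p v) = 0" by (simp add: blinfun_simps is_projectionD(2)[OF p(2)])
      from zero[OF this] show ?thesis by (simp add: blinfun_simps)
    qed
    have "p (h v) = h (p v)" for v
    proof (rule rip_eqI)
      fix u
      have "rip (h (p v)) u = rip v (p (h u))" by (simp only: hermitian_rip[OF h(2)] hermitian_rip[OF ps])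
      also have "\<dots> = rip v (p (h (p u)))" by (simp only: php[symmetric])
      also have "\<dots> = rip (p (h (p v))) u" by (simp only: hermitian_rip[OF h(2)] hermitian_rip[OF ps])
      finally show "rip (p (h v)) u = rip (h (p v)) u" by (simp only: php[symmetric])
    qed
    then show False using nc by blast
  qed
qed

lemma perturbed_projection_not_order_closed:
  fixes M :: "('h::complex_hilbert_space \<Rightarrow>\<^sub>L 'h) set"
  assumes M: "von_neumann_algebra M" and p: "p \<in> M" "is_projection p"
    and h: "h \<in> M" "hermitian h" "\<And>v. 0 \<le> rip (h v) v" and nz: "h \<noteq> 0"
  shows "\<not> order_closed (self_adjoint_part M) op_le (range (\<lambda>n. p + (1 / real (Suc n)) *\<^sub>R h))"
proof
  let ?P = "self_adjoint_part M"
  define X where "X n = p + (1 / real (Suc n)) *\<^sub>R h" for n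
  note ps = is_projectionD(1)[OF p(2)]
  note Piff = self_adjoint_part_iff[OF M]
  have Ps: "hermitian a" if "a \<in> ?P" for a using that Piff by blast
  have Xs: "hermitian (X n)" for n unfolding X_def using ps h(2) by blast
  have XP: "X n \<in> ?P" for n
    using von_neumann_algebraD(2)[OF M p(1) vn_scaleR[OF M h(1)]] Xs[of n] by (simp add: Piff X_def)
  have pP: "p \<in> ?P" using p(1) ps by (simp add: Piff)
  have Xf: "rip (X n v) v = rip (p v) v + 1 / real (Suc n) * rip (h v) v" for n v
    by (simp add: X_def blinfun_simps rip_simps)
  assume "order_closed ?P op_le (range (\<lambda>n. p + (1 / real (Suc n)) *\<^sub>R h))"
  then have cl: "order_closed ?P op_le (range X)" by (simp add: X_def[abs_def])
  have pX: "op_le p (X n)" for n unfolding op_le_iff[OF ps Xs] Xf using h(3) by simp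
  have "p \<in> range X"
  proof (rule order_closed_net[OF _ transp_op_le[OF Ps] cl, of UNIV "(\<le>)" X])
    show "reflp_on ?P op_le" using Ps by (auto simp: reflp_on_def op_le_iff)
    show "directed_set (UNIV :: nat set) (\<le>)"
      unfolding directed_set_def
      by (auto simp: reflp_on_def transp_on_def intro: max.cobounded1 max.cobounded2)
    show "order_convergent ?P op_le UNIV (\<le>) X p"
      unfolding order_convergent_def
    proof (rule exI[of _ "\<lambda>_. p"], rule exI[of _ X], intro conjI)
      show "monotone_on UNIV (\<le>) op_le (\<lambda>_::nat. p)"
        by (simp add: monotone_on_def op_le_iff[OF ps ps])
      show "monotone_on UNIV (\<le>) (\<lambda>a b. op_le b a) X"
        unfolding monotone_on_def op_le_iff[OF Xs Xs] Xf
        using h(3) by (auto intro!: mult_right_mono frac_le)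
      show "\<forall>i\<in>UNIV. op_le p (X i) \<and> op_le (X i) (X i)"
        using pX by (simp add: op_le_iff[OF Xs Xs])
      show "is_sup ?P op_le ((\<lambda>_::nat. p) ` UNIV) p"
        using pP by (simp add: is_sup_def op_le_iff[OF ps ps])
      show "is_inf ?P op_le (range X) p"
        unfolding is_inf_def
      proof (intro conjI ballI impI)
        fix u assume u: "u \<in> ?P" "\<forall>a\<in>range X. op_le u a"
        show "op_le u p"
          unfolding op_le_iff[OF Ps[OF u(1)] ps]
        proof
          fix v
          show "rip (u v) v \<le> rip (p v) v"
          proof (rule LIMSEQ_le_const)
            have "(\<lambda>n. rip (p v) v + 1 / real (Suc n) * rip (h v) v) \<longlonglongrightarrow> rip (p v) v + 0 * rip (h v) v"
              by (intro tendsto_add tendsto_mult tendsto_const LIMSEQ_Suc[OF lim_1_over_n, unfolded comp_def])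
            then show "(\<lambda>n. rip (X n v) v) \<longlonglongrightarrow> rip (p v) v" by (simp add: Xf)
            show "\<exists>N. \<forall>n\<ge>N. rip (u v) v \<le> rip (X n v) v"
              using u(2) op_le_iff[OF Ps[OF u(1)] Xs] by blast
          qed
        qed
      qed (use pP pX in auto)
    qed (use pP XP in auto)
  qed (use pP in auto)
  then obtain n where "p = X n" by blast
  then show False using nz by (simp add: X_def)
qed

theorem mainTheorem8:
  fixes M :: "('h::complex_hilbert_space \<Rightarrow>\<^sub>L 'h) set"
  assumes "von_neumann_algebra M"
  shows "order_top (self_adjoint_part M) spectral_le = order_top (self_adjoint_part M) op_le
    \<longleftrightarrow> abelian M"
proof
  let ?P = "self_adjoint_part M"
  note M = assms
  have Ps: "hermitian a" "a \<in> M" if "a \<in> ?P" for a using that self_adjoint_part_iff[OF M] by auto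
  show "abelian M" if eq: "order_top ?P spectral_le = order_top ?P op_le"
  proof (rule ccontr)
    assume "\<not> abelian M"
    from noncommuting_pair[OF M this] obtain p h where
      ph: "p \<in> M" "h \<in> M" "is_projection p" "hermitian h" "\<And>v. 0 \<le> rip (h v) v" "\<exists>v. p (h v) \<noteq> h (p v)" by blast
    have "h \<noteq> 0" using ph(6) by (auto simp: blinfun_simps)
    then show False
      using order_closed_of_order_top_eq[OF transp_spectral_le[OF Ps(1)] transp_op_le[OF Ps(1)] eq
          perturbed_projection_order_closed[OF M ph(1,3,2,4,5,6)]]
        perturbed_projection_not_order_closed[OF M ph(1,3,2,4,5)] by blast
  qed
  show "order_top ?P spectral_le = order_top ?P op_le" if ab: "abelian M"
  proof (rule order_top_cong)
    fix x y assume xy: "x \<in> ?P" "y \<in> ?P"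
    have "x o\<^sub>L y = y o\<^sub>L x" using ab Ps(2) xy by (simp add: abelian_def)
    then have "x (y v) = y (x v)" for v by (metis blinfun_apply_blinfun_compose)
    then show "spectral_le x y = op_le x y"
      using spectral_le_imp_op_le[OF Ps(1)[OF xy(1)] Ps(1)[OF xy(2)]]
        op_le_imp_spectral_le[OF Ps(1)[OF xy(1)] Ps(1)[OF xy(2)]] by blast
  qed
qed

end
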